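(* Assume that $\int\frac{dF}{G}<\infty$, that $a_G\le a_F$ and $F\{a_F\}=0$, and that $F$ is continuous. For $x\in\mathbb{R}$ put $$\psi_x(y)=\int_{\{y<z\}}\left[\mathbf 1_{(-\infty,x]}(y)-\mathbf 1_{(-\infty,x]}(z)\right]F(dz),\qquad y\in\mathbb{R}.$$ Then, as $n\to\infty$, $$F_n(x)-F(x)=\int\frac{\psi_x}{C}\,[dF_n^*-dF^*]-\int\frac{C_n(y)-C(y)}{C^2(y)}\,\psi_x(y)\,F^*(dy)+o_{\mathbb{P}}(n^{-1/2})$$ uniformly in $x\in\mathbb{R}$; that is, denoting the remainder by $R_n(x)$, one has $n^{1/2}\sup_{x\in\mathbb{R}}|R_n(x)|\to0$ in probability.
   Context: Left-truncation model: $X$ and $Y$ are independent real random variables with distribution functions $F$ and $G$, and $\alpha:=\mathbb{P}(Y\le X)>0$. A pair is observed only when $Y\le X$; conditionally on the number $n$ of observed pairs, the observed data $(X_1,Y_1),\dots,(X_n,Y_n)$ are i.i.d. with joint distribution function $H^*(x,y)=\mathbb{P}(X\le x,Y\le y\mid Y\le X)=\alpha^{-1}\int_{(-\infty,x]}G(y\wedge z)\,F(dz)$. All stochastic statements refer to these i.i.d. data as $n\to\infty$. Notation: $F(z-)=\lim_{x\uparrow z}F(x)$; $F\{z\}=F(z)-F(z-)$ (similarly for other distribution functions); $a_G=\inf\{x:G(x)>0\}$, $a_F=\inf\{x:F(x)>0\}$. Further $$F^*(x)=\mathbb{P}(X\le x\mid Y\le X)=\alpha^{-1}\int_{(-\infty,x]}G(z)\,F(dz),\qquad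 C(z)=\mathbb{P}(Y\le z\le X\mid Y\le X)=\alpha^{-1}G(z)[1-F(z-)],$$ $$F_n^*(x)=\frac1n\sum_{i=1}^n\mathbf 1_{\{X_i\le x\}},\qquad C_n(z)=\frac1n\sum_{i=1}^n\mathbf 1_{\{Y_i\le z\le X_i\}}.$$ The Lynden-Bell estimator $F_n$ of $F$ is defined by $$1-F_n(x)=\prod_{\text{distinct }X_i\le x}\left[1-\frac{F_n^*\{X_i\}}{C_n(X_i)}\right],$$ the product running over the distinct values among the observed $X_i$ that are $\le x$. *)

theory Defs
  imports "HOL-Probability.Probability"
begin

text \<open>
  Notation for distribution functions \<open>H\<close>: \<open>left_limit H z\<close> is $H(z-)$, \<open>jump H z\<close> is $H\{z\}$
  and \<open>lower_end H\<close> is $a_H$, which may be $-\infty$ and is therefore extended real.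
  Integrals with respect to $dH$ are integrals over \<^term>\<open>interval_measure H\<close>.
\<close>

definition left_limit :: "(real \<Rightarrow> real) \<Rightarrow> real \<Rightarrow> real" where
  "left_limit H z = Lim (at_left z) H"

definition jump :: "(real \<Rightarrow> real) \<Rightarrow> real \<Rightarrow> real" where
  "jump H z = H z - left_limit H z"

definition lower_end :: "(real \<Rightarrow> real) \<Rightarrow> ereal" where
  "lower_end H = (INF x\<in>{x. H x > 0}. ereal x)"

text \<open>Population quantities, for the lifetime \<open>X\<close> and the truncation variable \<open>Y\<close> on the space \<open>N\<close>.\<close>

definition trunc_Fstar :: "'b measure \<Rightarrow> ('b \<Rightarrow> real) \<Rightarrow> ('b \<Rightarrow> real) \<Rightarrow> real \<Rightarrow> real" where
  "trunc_Fstar N X Y x = \<P>(v in N. X v \<le> x \<bar> Y v \<le> X v)"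

definition trunc_Hstar :: "'b measure \<Rightarrow> ('b \<Rightarrow> real) \<Rightarrow> ('b \<Rightarrow> real) \<Rightarrow> real \<Rightarrow> real \<Rightarrow> real" where
  "trunc_Hstar N X Y x y = \<P>(v in N. X v \<le> x \<and> Y v \<le> y \<bar> Y v \<le> X v)"

definition trunc_C :: "'b measure \<Rightarrow> ('b \<Rightarrow> real) \<Rightarrow> ('b \<Rightarrow> real) \<Rightarrow> real \<Rightarrow> real" where
  "trunc_C N X Y z = \<P>(v in N. Y v \<le> z \<and> z \<le> X v \<bar> Y v \<le> X v)"

definition psi :: "(real \<Rightarrow> real) \<Rightarrow> real \<Rightarrow> real \<Rightarrow> real" where
  "psi F x y = (LINT z:{z. y < z}|interval_measure F. indicator {..x} y - indicator {..x} z)"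

text \<open>
  Sample quantities, as functions of the sample size \<open>n\<close> and of the observed values
  \<open>xs i\<close>, \<open>ys i\<close> for \<open>i < n\<close>.
\<close>

definition emp_Fstar :: "nat \<Rightarrow> (nat \<Rightarrow> real) \<Rightarrow> real \<Rightarrow> real" where
  "emp_Fstar n xs x = (\<Sum>i<n. of_bool (xs i \<le> x)) / real n"

definition emp_C :: "nat \<Rightarrow> (nat \<Rightarrow> real) \<Rightarrow> (nat \<Rightarrow> real) \<Rightarrow> real \<Rightarrow> real" where
  "emp_C n xs ys z = (\<Sum>i<n. of_bool (ys i \<le> z \<and> z \<le> xs i)) / real n"

text \<open>The product ranges over a set of values, so tied observations contribute a single factor.\<close>

definition lynden_bell :: "nat \<Rightarrow> (nat \<Rightarrow> real) \<Rightarrow> (nat \<Rightarrow> real) \<Rightarrow> real \<Rightarrow> real" where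
  "lynden_bell n xs ys x =
     1 - (\<Prod>z\<in>{z \<in> xs ` {..<n}. z \<le> x}. 1 - jump (emp_Fstar n xs) z / emp_C n xs ys z)"

definition remainder ::
  "(real \<Rightarrow> real) \<Rightarrow> (real \<Rightarrow> real) \<Rightarrow> (real \<Rightarrow> real) \<Rightarrow> nat \<Rightarrow> (nat \<Rightarrow> real) \<Rightarrow> (nat \<Rightarrow> real) \<Rightarrow> real \<Rightarrow> real"
where
  "remainder F Fs C n xs ys x =
     (lynden_bell n xs ys x - F x)
     - (((LINT y|interval_measure (emp_Fstar n xs). psi F x y / C y)
          - (LINT y|interval_measure Fs. psi F x y / C y))
        - (LINT y|interval_measure Fs. (emp_C n xs ys y - C y) / (C y)\<^sup>2 * psi F x y))"

text \<open>
  Measurability is part of the notion: \<^const>\<open>measure\<close> assigns 0 to non-measurable sets, so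
  without it the limit could hold vacuously. Extended real values are allowed because the
  variables of interest are suprema.
\<close>

definition tends_to_0_in_prob :: "'a measure \<Rightarrow> (nat \<Rightarrow> 'a \<Rightarrow> ereal) \<Rightarrow> bool" where
  "tends_to_0_in_prob M Z \<longleftrightarrow>
     (\<forall>n. Z n \<in> borel_measurable M) \<and>
     (\<forall>\<epsilon>::real. \<epsilon> > 0 \<longrightarrow> (\<lambda>n. \<P>(w in M. \<bar>Z n w\<bar> > ereal \<epsilon>)) \<longlonglongrightarrow> 0)"

end

theory Submission
  imports Defs
begin

text \<open>
  Write \<open>S = 1 - F\<close>. As \<open>F\<close> is continuous, \<open>C = G * S / \<alpha>\<close>, and the observed lifetimes have density
  \<open>G / \<alpha>\<close> with respect to \<open>F\<close>; so \<open>dF* / C = dF / S\<close> is the hazard measure, and \<open>- ln (S x)\<close> is its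
  mass up to \<open>x\<close>. Moreover \<open>psi F x y\<close> equals \<open>S x\<close> for \<open>y \<le> x\<close> and \<open>0\<close> otherwise, so that the
  linear term of the expansion is \<open>S x * L x\<close> with \<open>L = A - E\<close>, where
  \<open>A x = \<integral>\<^bsub>y \<le> x\<^esub> d(F\<^sub>n* - F*) / C\<close> and \<open>E x = \<integral>\<^bsub>y \<le> x\<^esub> (C\<^sub>n - C) / C\<^sup>2 dF*\<close>.

  Almost surely the estimator satisfies \<open>1 - F\<^sub>n x = (\<Prod>X\<^sub>i \<le> x. 1 - 1 / (n * C\<^sub>n X\<^sub>i))\<close>. Let \<open>D\<close> be the
  difference of \<open>- ln (1 - F\<^sub>n)\<close> and \<open>- ln S\<close>; then \<open>F\<^sub>n - F = S * (1 - exp (- D))\<close>, and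
  expanding the logarithm and \<open>1 / C\<^sub>n\<close> around \<open>C\<close> gives \<open>D = L + Q + \<close> square errors
  (\<open>log_survival_expansion\<close>), where \<open>Q x = \<integral>\<^bsub>y \<le> x\<^esub> (C - C\<^sub>n) / C\<^sup>2 d(F\<^sub>n* - F*)\<close> is a degenerate
  second-order term. It remains to show that \<open>S * \<bar>Q\<bar>\<close>, \<open>S\<close> times the square errors, and \<open>S * L\<^sup>2\<close> are
  \<open>o(n powr (-1/2))\<close>, uniformly in \<open>x\<close> outside the far right tail.

  Only first and second moments are used. Two observations make them sufficient. The factor \<open>S x\<close> is
  nonincreasing, so it may be moved under the integrals over \<open>y \<le> x\<close>, where a bound by absolute values
  no longer depends on \<open>x\<close>. Given an observed lifetime \<open>z\<close>, the size of its risk set is \<open>1\<close> plus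
  a binomial variable (\<open>nn_integral_risk_set\<close>), whose inverse moments are explicit; in particular
  \<open>(C\<^sub>n - C)\<^sup>2 / C\<^sub>n\<close> has mean at most \<open>1 / n\<close> however small \<open>C\<close> is
  (\<open>mean_relative_square_error\<close>). Hence the left tail only costs \<open>\<integral> dF / G\<close>, and all bounds go back to
  the finiteness of \<open>\<integral> dF / (G * S powr (3/4))\<close> (\<open>K_finite\<close>).

  In the right tail \<open>C\<close> vanishes with \<open>S\<close>. The expansion is therefore used up to the point \<open>b n\<close> with
  \<open>S (b n) = \<eta> / sqrt n\<close>, for small \<open>\<eta>\<close>; there \<open>S * L\<^sup>2\<close> is still small compared with \<open>S (b n)\<close>, so
  \<open>D\<close> is small (\<open>whp_linear_A\<close>, \<open>whp_linear_E\<close>). Beyond \<open>b n\<close> both \<open>F\<^sub>n\<close> and \<open>F\<close> are monotone and bounded by \<open>1\<close>, and the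
  linear term changes by little (\<open>linear_term_beyond\<close>).

  For \<open>Q\<close> (\<open>whp_degenerate\<close>), the region of small \<open>C\<close> contributes little in mean absolute value.
  Elsewhere the weight \<open>1 / C\<^sup>2\<close> is bounded, and \<open>C\<^sub>n - C\<close>, of order \<open>n powr (-1/2)\<close>, may be
  replaced by a step function, whose integrals against \<open>F\<^sub>n* - F*\<close> are of smaller order by a weighted
  Glivenko-Cantelli theorem (\<open>degenerate_term_bounded_weight\<close>).
\<close>

section \<open>Independent identically distributed samples\<close>

lemma (in prob_space) nn_integral_le_sqrt:
  fixes X :: "'a \<Rightarrow> real"
  assumes [measurable]: "X \<in> borel_measurable M" and "(\<integral>\<^sup>+w. ennreal ((X w)\<^sup>2) \<partial>M) \<le> ennreal c" "0 \<le> c"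
  shows "(\<integral>\<^sup>+w. ennreal \<bar>X w\<bar> \<partial>M) \<le> ennreal (sqrt c)"
proof -
  have "(\<integral>\<^sup>+w. ennreal ((X w)\<^sup>2) \<partial>M) < \<infinity>" using assms(2) by (simp add: le_less_trans)
  then have i2: "integrable M (\<lambda>w. (X w)\<^sup>2)" by (intro integrableI_bounded) auto
  then have i1: "integrable M (\<lambda>w. \<bar>X w\<bar>)"
    using square_integrable_imp_integrable[OF assms(1)] by simp
  have "(\<integral>w. \<bar>X w\<bar> \<partial>M)\<^sup>2 \<le> (\<integral>w. \<bar>X w\<bar>\<^sup>2 \<partial>M)"
    using variance_eq[OF i1] i2 variance_positive[of "\<lambda>w. \<bar>X w\<bar>"] by (simp only: power2_abs)
  also have "\<dots> \<le> c"
    using assms(2,3) i2 by (simp add: nn_integral_eq_integral)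
  finally have "(\<integral>w. \<bar>X w\<bar> \<partial>M) \<le> sqrt c" by (rule real_le_rsqrt)
  then show ?thesis using i1 by (simp add: nn_integral_eq_integral ennreal_leI)
qed

locale iid_sample = prob_space M for M :: "'a measure" +
  fixes P :: "'b measure" and Z :: "nat \<Rightarrow> 'a \<Rightarrow> 'b"
  assumes indep: "indep_vars (\<lambda>_. P) Z UNIV"
    and law: "\<And>i. distr M P (Z i) = P"
begin

lemma Z_measurable [measurable]: "Z i \<in> measurable M P"
  using indep by (simp add: indep_vars_def)

lemma prob_space_P: "prob_space P"
  using prob_space_distr[OF Z_measurable[of 0]] by (simp add: law)

sublocale P: prob_space P
  by (rule prob_space_P)

lemma nn_integral_Z:
  assumes [measurable]: "f \<in> borel_measurable P"
  shows "(\<integral>\<^sup>+w. f (Z i w) \<partial>M) = (\<integral>\<^sup>+z. f z \<partial>P)"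
  using nn_integral_distr[OF Z_measurable[of i], of f] by (simp add: law)

lemma integral_Z:
  fixes f :: "'b \<Rightarrow> real"
  assumes [measurable]: "f \<in> borel_measurable P"
  shows "(\<integral>w. f (Z i w) \<partial>M) = (\<integral>z. f z \<partial>P)"
  using integral_distr[OF Z_measurable[of i], of f] by (simp add: law)

lemma integrable_Z:
  fixes f :: "'b \<Rightarrow> real"
  assumes "integrable P f"
  shows "integrable M (\<lambda>w. f (Z i w))"
  using integrable_distr_eq[OF Z_measurable[of i], of f] assms by (simp add: law)

lemma AE_Z:
  assumes "AE z in P. Q z"
  shows "AE w in M. Q (Z i w)"
proof -
  have "AE z in distr M P (Z i). Q z" unfolding law by (rule assms)
  then show ?thesis by (rule AE_distrD[OF Z_measurable])
qed

text \<open>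
  Independence and centring make the expectations of the mixed products vanish.
\<close>

lemma second_moment_centred_sum:
  fixes h :: "'b \<Rightarrow> real"
  assumes [measurable]: "h \<in> borel_measurable P"
    and sq: "integrable P (\<lambda>z. (h z)\<^sup>2)" and mean: "(\<integral>z. h z \<partial>P) = 0" and "finite I"
  shows "integrable M (\<lambda>w. (\<Sum>i\<in>I. h (Z i w))\<^sup>2)
    \<and> (\<integral>w. (\<Sum>i\<in>I. h (Z i w))\<^sup>2 \<partial>M) = card I * (\<integral>z. (h z)\<^sup>2 \<partial>P)"
  using \<open>finite I\<close>
proof (induction I)
  case empty
  then show ?case by simp
next
  case (insert j I)
  have h1: "integrable P h"
    by (rule P.square_integrable_imp_integrable[OF assms(1) sq])
  let ?X = "\<lambda>w. h (Z j w)" and ?S = "\<lambda>w. \<Sum>i\<in>I. h (Z i w)"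
  have ind: "indep_vars (\<lambda>_. borel) (\<lambda>i w. h (Z i w)) (insert j I)"
    by (rule indep_vars_compose2[OF indep_vars_subset[OF indep]]) auto
  have iv: "indep_var borel ?X borel ?S"
    by (rule indep_vars_sum[OF insert(1,2) ind])
  have iX: "integrable M ?X" by (rule integrable_Z[OF h1])
  have iS: "integrable M ?S" by (intro Bochner_Integration.integrable_sum integrable_Z[OF h1])
  have iX2: "integrable M (\<lambda>w. (?X w)\<^sup>2)" by (rule integrable_Z[OF sq])
  have iXS: "integrable M (\<lambda>w. ?X w * ?S w)" by (rule indep_var_integrable[OF iv iX iS])
  have eXS: "(\<integral>w. ?X w * ?S w \<partial>M) = 0"
    using indep_var_lebesgue_integral[OF iv iX iS] integral_Z[of h j] mean by simp
  have eq: "(\<Sum>i\<in>insert j I. h (Z i w))\<^sup>2 = (?X w)\<^sup>2 + 2 * (?X w * ?S w) + (?S w)\<^sup>2" for w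
    using insert(1,2) by (simp add: power2_sum)
  have "integrable M (\<lambda>w. (?X w)\<^sup>2 + 2 * (?X w * ?S w) + (?S w)\<^sup>2)"
    using iX2 iXS insert.IH by auto
  moreover have "(\<integral>w. (?X w)\<^sup>2 + 2 * (?X w * ?S w) + (?S w)\<^sup>2 \<partial>M)
     = (\<integral>w. (?X w)\<^sup>2 \<partial>M) + 2 * (\<integral>w. ?X w * ?S w \<partial>M) + (\<integral>w. (?S w)\<^sup>2 \<partial>M)"
    using iX2 iXS insert.IH by simp
  moreover have "(\<integral>w. (?X w)\<^sup>2 \<partial>M) = (\<integral>z. (h z)\<^sup>2 \<partial>P)" by (rule integral_Z) simp
  ultimately show ?case
    unfolding eq using eXS insert by (simp add: algebra_simps)
qed

lemma mean_square_sum_le: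
  fixes g :: "'b \<Rightarrow> real"
  assumes [measurable]: "g \<in> borel_measurable P"
    and sq: "integrable P (\<lambda>z. (g z)\<^sup>2)" and I: "finite I"
  shows "(\<integral>\<^sup>+w. ennreal ((\<Sum>i\<in>I. g (Z i w) - (\<integral>z. g z \<partial>P))\<^sup>2) \<partial>M)
    \<le> ennreal (card I * (\<integral>z. (g z)\<^sup>2 \<partial>P))"
proof -
  define h where "h z = g z - (\<integral>z. g z \<partial>P)" for z
  have g1: "integrable P g"
    by (rule P.square_integrable_imp_integrable[OF assms(1) sq])
  have hm[measurable]: "h \<in> borel_measurable P" unfolding h_def by simp
  have mean: "(\<integral>z. h z \<partial>P) = 0" unfolding h_def using g1 by (simp add: P.prob_space)
  have h2: "integrable P (\<lambda>z. (h z)\<^sup>2)"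
    unfolding h_def power2_diff using g1 sq by simp
  have "(\<integral>z. (h z)\<^sup>2 \<partial>P) = (\<integral>z. (g z)\<^sup>2 \<partial>P) - (\<integral>z. g z \<partial>P)\<^sup>2"
    unfolding h_def using P.variance_eq[OF g1 sq] by simp
  then have le: "(\<integral>z. (h z)\<^sup>2 \<partial>P) \<le> (\<integral>z. (g z)\<^sup>2 \<partial>P)" by simp
  have "(\<integral>\<^sup>+w. ennreal ((\<Sum>i\<in>I. h (Z i w))\<^sup>2) \<partial>M) = ennreal (card I * (\<integral>z. (h z)\<^sup>2 \<partial>P))"
    using second_moment_centred_sum[OF hm h2 mean I]
      nn_integral_eq_integral[of M "\<lambda>w. (\<Sum>i\<in>I. h (Z i w))\<^sup>2"] by simp
  then show ?thesis unfolding h_def[symmetric]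
    using le by (auto intro!: ennreal_leI mult_left_mono)
qed

lemma mean_abs_sum_le:
  fixes g :: "'b \<Rightarrow> real"
  assumes [measurable]: "g \<in> borel_measurable P"
    and sq: "integrable P (\<lambda>z. (g z)\<^sup>2)" and I: "finite I"
  shows "(\<integral>\<^sup>+w. ennreal \<bar>\<Sum>i\<in>I. g (Z i w) - (\<integral>z. g z \<partial>P)\<bar> \<partial>M)
    \<le> ennreal (sqrt (card I * (\<integral>z. (g z)\<^sup>2 \<partial>P)))"
  by (rule nn_integral_le_sqrt[OF _ mean_square_sum_le[OF assms]]) auto

text \<open>
  One observation is independent of the others, so it can be integrated out last. This turns a
  statistic in which the \<open>i\<close>-th observation chooses the point where the sample is evaluated
  into a statistic at a fixed point.
\<close>

lemma leave_one_out:
  fixes g :: "'b \<Rightarrow> 'b \<Rightarrow> real" and \<Phi> :: "'b \<Rightarrow> real \<Rightarrow> ennreal"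
  assumes [measurable]: "(\<lambda>(p, q). g p q) \<in> borel_measurable (P \<Otimes>\<^sub>M P)"
    "(\<lambda>(p, s). \<Phi> p s) \<in> borel_measurable (P \<Otimes>\<^sub>M borel)"
    and J: "finite J" "i \<notin> J"
  shows "(\<integral>\<^sup>+w. \<Phi> (Z i w) (\<Sum>j\<in>J. g (Z i w) (Z j w)) \<partial>M)
    = (\<integral>\<^sup>+p. (\<integral>\<^sup>+w. \<Phi> p (\<Sum>j\<in>J. g p (Z j w)) \<partial>M) \<partial>P)"
proof -
  let ?R = "\<lambda>w. \<lambda>j\<in>J. Z j w"
  have R[measurable]: "?R \<in> measurable M (PiM J (\<lambda>_. P))" by simp
  let ?A = "\<lambda>w. \<lambda>j\<in>{i}. Z j w"
  have A[measurable]: "?A \<in> measurable M (PiM {i} (\<lambda>_. P))" by simp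
  have "indep_var (PiM {i} (\<lambda>_. P)) ?A (PiM J (\<lambda>_. P)) ?R"
    using J by (intro indep_var_restrict[OF indep]) auto
  moreover define DA D where "DA = distr M (PiM {i} (\<lambda>_. P)) ?A" and "D = distr M (PiM J (\<lambda>_. P)) ?R"
  ultimately have D: "distr M (PiM {i} (\<lambda>_. P) \<Otimes>\<^sub>M PiM J (\<lambda>_. P)) (\<lambda>w. (?A w, ?R w)) = DA \<Otimes>\<^sub>M D"
    unfolding indep_var_distribution_eq by simp
  interpret D: prob_space D unfolding D_def by (rule prob_space_distr[OF R])
  define f where "f = (\<lambda>(p, q). \<Phi> p (\<Sum>j\<in>J. g p (q j)))"
  have f[measurable]: "f \<in> borel_measurable (P \<Otimes>\<^sub>M PiM J (\<lambda>_. P))"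
    unfolding f_def split_def using J by measurable
  have sD[measurable_cong]: "sets D = sets (PiM J (\<lambda>_. P))" "sets DA = sets (PiM {i} (\<lambda>_. P))"
    unfolding D_def DA_def by simp_all
  have "(\<integral>\<^sup>+w. \<Phi> (Z i w) (\<Sum>j\<in>J. g (Z i w) (Z j w)) \<partial>M) = (\<integral>\<^sup>+w. (\<lambda>(a, q). f (a i, q)) (?A w, ?R w) \<partial>M)"
    by (simp add: f_def)
  also have "\<dots> = (\<integral>\<^sup>+z. (\<lambda>(a, q). f (a i, q)) z \<partial>(DA \<Otimes>\<^sub>M D))"
    unfolding D[symmetric] by (rule nn_integral_distr[symmetric]) auto
  also have "\<dots> = (\<integral>\<^sup>+a. (\<integral>\<^sup>+q. (\<lambda>(a, q). f (a i, q)) (a, q) \<partial>D) \<partial>DA)"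
    by (rule D.nn_integral_fst[symmetric]) simp
  also have "\<dots> = (\<integral>\<^sup>+v. (\<integral>\<^sup>+q. f (Z i v, q) \<partial>D) \<partial>M)"
    by (simp add: DA_def nn_integral_distr)
  also have "\<dots> = (\<integral>\<^sup>+p. (\<integral>\<^sup>+q. f (p, q) \<partial>D) \<partial>P)"
    by (rule nn_integral_Z) simp
  also have "\<dots> = (\<integral>\<^sup>+p. (\<integral>\<^sup>+w. \<Phi> p (\<Sum>j\<in>J. g p (Z j w)) \<partial>M) \<partial>P)"
    by (intro nn_integral_cong) (simp add: D_def nn_integral_distr f_def)
  finally show ?thesis .
qed

text \<open>
  Integrating out one observation at a time reproduces Pascal's rule, so the number of observations in
  \<open>A\<close> is binomial.
\<close>

lemma nn_integral_count:
  fixes h :: "real \<Rightarrow> real"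
  assumes [measurable]: "A \<in> sets P" "h \<in> borel_measurable borel"
    and h: "\<And>k::nat. 0 \<le> h (real k)" and J: "finite J"
  defines "p \<equiv> measure P A"
  shows "(\<integral>\<^sup>+w. ennreal (h (\<Sum>j\<in>J. indicator A (Z j w))) \<partial>M)
    = ennreal (\<Sum>k\<le>card J. real (card J choose k) * p ^ k * (1 - p) ^ (card J - k) * h (real k))"
  using J assms(2) h
proof (induction J arbitrary: h)
  case empty
  then show ?case by (simp add: emeasure_space_1)
next
  case (insert i J)
  have p: "0 \<le> p" "p \<le> 1" unfolding p_def by simp_all
  note [measurable] = insert.prems(1)
  let ?N = "\<lambda>w. \<Sum>j\<in>J. indicat_real A (Z j w)"
  let ?T = "\<lambda>m h. \<Sum>k\<le>m. real (m choose k) * p ^ k * (1 - p) ^ (m - k) * h (real k)"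
  have T0: "0 \<le> ?T m h" if "\<And>k::nat. 0 \<le> h (real k)" for m and h :: "real \<Rightarrow> real"
    using p that by (intro sum_nonneg mult_nonneg_nonneg) auto
  have "(\<integral>\<^sup>+w. ennreal (h (\<Sum>j\<in>insert i J. indicator A (Z j w))) \<partial>M)
      = (\<integral>\<^sup>+w. ennreal (h (indicator A (Z i w) + ?N w)) \<partial>M)"
    using insert.hyps by simp
  also have "\<dots> = (\<integral>\<^sup>+q. (\<integral>\<^sup>+w. ennreal (h (indicator A q + ?N w)) \<partial>M) \<partial>P)"
    using leave_one_out[of "\<lambda>_ q. indicator A q" "\<lambda>q s. ennreal (h (indicator A q + s))" J i] insert.hyps
    by simp
  also have "\<dots> = (\<integral>\<^sup>+q. indicator A q * (\<integral>\<^sup>+w. ennreal (h (1 + ?N w)) \<partial>M)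
      + indicator (space P - A) q * (\<integral>\<^sup>+w. ennreal (h (?N w)) \<partial>M) \<partial>P)"
    by (intro nn_integral_cong) (auto simp: indicator_def)
  also have "\<dots> = emeasure P A * (\<integral>\<^sup>+w. ennreal (h (1 + ?N w)) \<partial>M)
      + emeasure P (space P - A) * (\<integral>\<^sup>+w. ennreal (h (?N w)) \<partial>M)"
    by (simp add: nn_integral_add nn_integral_multc)
  also have "(\<integral>\<^sup>+w. ennreal (h (1 + ?N w)) \<partial>M) = ennreal (?T (card J) (\<lambda>t. h (1 + t)))"
    using insert.prems(2)[of "Suc _"] by (intro insert.IH) (auto simp: add.commute)
  also have "(\<integral>\<^sup>+w. ennreal (h (?N w)) \<partial>M) = ennreal (?T (card J) h)"
    using insert.prems by (intro insert.IH) auto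
  also have "emeasure P A = ennreal p" unfolding p_def by (simp add: P.emeasure_eq_measure)
  also have "emeasure P (space P - A) = ennreal (1 - p)"
    unfolding p_def by (simp add: P.emeasure_eq_measure P.prob_compl)
  also have "ennreal p * ennreal (?T (card J) (\<lambda>t. h (1 + t))) + ennreal (1 - p) * ennreal (?T (card J) h)
     = ennreal (p * ?T (card J) (\<lambda>t. h (1 + t)) + (1 - p) * ?T (card J) h)"
    using p T0[of h] T0[of "\<lambda>t. h (1 + t)"] insert.prems(2) insert.prems(2)[of "Suc _"]
    by (simp add: ennreal_mult ennreal_plus mult_nonneg_nonneg add.commute)
  also have "p * ?T (card J) (\<lambda>t. h (1 + t)) + (1 - p) * ?T (card J) h = ?T (Suc (card J)) h"
  proof -
    define m where "m = card J"
    have "?T (Suc m) h = (1 - p) ^ Suc m * h 0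
       + (\<Sum>k\<le>m. real (Suc m choose Suc k) * p ^ Suc k * (1 - p) ^ (m - k) * h (real (Suc k)))"
      by (subst sum.atMost_Suc_shift) simp
    also have "(\<Sum>k\<le>m. real (Suc m choose Suc k) * p ^ Suc k * (1 - p) ^ (m - k) * h (real (Suc k)))
       = p * ?T m (\<lambda>t. h (1 + t)) + (\<Sum>k\<le>m. real (m choose Suc k) * p ^ Suc k * (1 - p) ^ (m - k) * h (real (Suc k)))"
      by (simp add: sum_distrib_left sum.distrib[symmetric] algebra_simps)
    also have "(\<Sum>k\<le>m. real (m choose Suc k) * p ^ Suc k * (1 - p) ^ (m - k) * h (real (Suc k)))
       = (\<Sum>k<m. real (m choose Suc k) * p ^ Suc k * (1 - p) ^ (m - k) * h (real (Suc k)))"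
      by (rule sum.mono_neutral_right) (auto simp: not_less)
    also have "\<dots> = (1 - p) * (\<Sum>k<m. real (m choose Suc k) * p ^ Suc k * (1 - p) ^ (m - Suc k) * h (real (Suc k)))"
      unfolding sum_distrib_left
      by (intro sum.cong refl) (simp add: Suc_diff_Suc[symmetric] algebra_simps)
    finally have 1: "?T (Suc m) h = (1 - p) ^ Suc m * h 0 + (p * ?T m (\<lambda>t. h (1 + t))
       + (1 - p) * (\<Sum>k<m. real (m choose Suc k) * p ^ Suc k * (1 - p) ^ (m - Suc k) * h (real (Suc k))))" .
    have "{..m} = insert 0 (Suc ` {..<m})" by (metis lessThan_Suc_atMost lessThan_Suc_eq_insert_0)
    then have 2: "?T m h = (1 - p) ^ m * h 0
       + (\<Sum>k<m. real (m choose Suc k) * p ^ Suc k * (1 - p) ^ (m - Suc k) * h (real (Suc k)))"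
      by (simp add: sum.reindex)
    show ?thesis unfolding m_def[symmetric] 1 2 by (simp add: algebra_simps)
  qed
  also have "Suc (card J) = card (insert i J)" using insert.hyps by simp
  finally show ?case .
qed

end

lemma le_inverse_if_mult_le_one: "c * x \<le> 1 \<Longrightarrow> 0 < c \<Longrightarrow> x \<le> 1 / c" for c x :: real
  by (simp add: field_simps)

text \<open>
  Inverse moments of the binomial law: multiplying numerator and denominator by the missing factors
  turns the sum into part of a binomial expansion of $1$.
\<close>

lemma binomial_inverse_moment:
  fixes p :: real
  assumes "0 < p" "p \<le> 1"
  shows "(\<Sum>k\<le>m. real (m choose k) * p ^ k * (1 - p) ^ (m - k) * (1 / (1 + real k)))
    \<le> 1 / ((real m + 1) * p)"
proof -
  have "(real m + 1) * p * (\<Sum>k\<le>m. real (m choose k) * p ^ k * (1 - p) ^ (m - k) * (1 / (1 + real k)))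
    = (\<Sum>k\<le>m. real (Suc m choose Suc k) * p ^ Suc k * (1 - p) ^ (Suc m - Suc k))"
    unfolding sum_distrib_left
  proof (intro sum.cong refl)
    fix k assume "k \<in> {..m}"
    have "real (Suc k) * real (Suc m choose Suc k) = real (Suc m) * real (m choose k)"
      using Suc_times_binomial[of k m] by (metis of_nat_mult)
    then have "real (Suc m choose Suc k) = (real m + 1) * real (m choose k) * (1 / (1 + real k))"
      by (simp add: field_simps)
    then show "(real m + 1) * p * (real (m choose k) * p ^ k * (1 - p) ^ (m - k) * (1 / (1 + real k)))
       = real (Suc m choose Suc k) * p ^ Suc k * (1 - p) ^ (Suc m - Suc k)" by simp
  qed
  also have "\<dots> \<le> (\<Sum>k\<le>Suc m. real (Suc m choose k) * p ^ k * (1 - p) ^ (Suc m - k))"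
    using assms by (subst sum.atMost_Suc_shift) (simp add: mult_nonneg_nonneg)
  also have "\<dots> = 1" using binomial_ring[of p "1 - p" "Suc m"] by simp
  finally show ?thesis by (rule le_inverse_if_mult_le_one) (use assms in simp)
qed

lemma binomial_inverse_second_moment:
  fixes p :: real
  assumes "0 < p" "p \<le> 1"
  shows "(\<Sum>k\<le>m. real (m choose k) * p ^ k * (1 - p) ^ (m - k) * (1 / ((1 + real k) * (2 + real k))))
    \<le> 1 / ((real m + 1) * (real m + 2) * p\<^sup>2)"
proof -
  have "(real m + 1) * (real m + 2) * p\<^sup>2 * (\<Sum>k\<le>m. real (m choose k) * p ^ k * (1 - p) ^ (m - k) * (1 / ((1 + real k) * (2 + real k))))
    = (\<Sum>k\<le>m. real (Suc (Suc m) choose Suc (Suc k)) * p ^ Suc (Suc k) * (1 - p) ^ (Suc (Suc m) - Suc (Suc k)))"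
    unfolding sum_distrib_left
  proof (intro sum.cong refl)
    fix k assume "k \<in> {..m}"
    have "real (Suc k) * real (Suc m choose Suc k) = real (Suc m) * real (m choose k)"
      using Suc_times_binomial[of k m] by (metis of_nat_mult)
    then have 1: "real (Suc m choose Suc k) = (real m + 1) * real (m choose k) * (1 / (1 + real k))"
      by (simp add: field_simps)
    have "real (Suc (Suc k)) * real (Suc (Suc m) choose Suc (Suc k)) = real (Suc (Suc m)) * real (Suc m choose Suc k)"
      using Suc_times_binomial[of "Suc k" "Suc m"] by (metis of_nat_mult)
    then have 2: "real (Suc (Suc m) choose Suc (Suc k)) = (real m + 2) * real (Suc m choose Suc k) * (1 / (2 + real k))"
      by (simp add: field_simps)
    show "(real m + 1) * (real m + 2) * p\<^sup>2 * (real (m choose k) * p ^ k * (1 - p) ^ (m - k) * (1 / ((1 + real k) * (2 + real k))))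
       = real (Suc (Suc m) choose Suc (Suc k)) * p ^ Suc (Suc k) * (1 - p) ^ (Suc (Suc m) - Suc (Suc k))"
      unfolding 2 1 by (simp add: power2_eq_square)
  qed
  also have "\<dots> \<le> (\<Sum>k\<le>Suc (Suc m). real (Suc (Suc m) choose k) * p ^ k * (1 - p) ^ (Suc (Suc m) - k))"
    using assms by (subst sum.atMost_Suc_shift, subst sum.atMost_Suc_shift)
       (simp add: mult_nonneg_nonneg del: binomial_Suc_Suc)
  also have "\<dots> = 1" using binomial_ring[of p "1 - p" "Suc (Suc m)"] by simp
  finally show ?thesis by (rule le_inverse_if_mult_le_one) (use assms in simp)
qed

section \<open>Events of probability tending to one\<close>

text \<open>
  Outer probability is used because the events of interest are suprema over uncountably many points,
  whose measurability is settled separately.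
\<close>

definition whp :: "'a measure \<Rightarrow> (nat \<Rightarrow> 'a \<Rightarrow> bool) \<Rightarrow> bool" where
  "whp M Q \<longleftrightarrow> (\<forall>\<rho>>0. \<forall>\<^sub>F n in sequentially.
     \<exists>A\<in>sets M. measure M A \<le> \<rho> \<and> (\<forall>w\<in>space M - A. Q n w))"

lemma whpD:
  assumes "whp M Q" "0 < \<rho>"
  shows "\<forall>\<^sub>F n in sequentially. \<exists>A\<in>sets M. measure M A \<le> \<rho> \<and> (\<forall>w\<in>space M - A. Q n w)"
  using assms by (auto simp: whp_def)

lemma whp_mono:
  assumes "whp M Q" "\<forall>\<^sub>F n in sequentially. \<forall>w\<in>space M. Q n w \<longrightarrow> R n w"
  shows "whp M R"
  unfolding whp_def
proof (intro allI impI)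
  fix \<rho> :: real assume "0 < \<rho>"
  from eventually_conj[OF whpD[OF assms(1) this] assms(2)]
  show "\<forall>\<^sub>F n in sequentially. \<exists>A\<in>sets M. measure M A \<le> \<rho> \<and> (\<forall>w\<in>space M - A. R n w)"
    by eventually_elim fast
qed

lemma whp_conj:
  assumes "prob_space M" "whp M Q" "whp M R"
  shows "whp M (\<lambda>n w. Q n w \<and> R n w)"
  unfolding whp_def
proof (intro allI impI)
  interpret prob_space M by fact
  fix \<rho> :: real assume "0 < \<rho>"
  then have "0 < \<rho> / 2" by simp
  from eventually_conj[OF whpD[OF assms(2) this] whpD[OF assms(3) this]]
  show "\<forall>\<^sub>F n in sequentially. \<exists>A\<in>sets M. measure M A \<le> \<rho> \<and> (\<forall>w\<in>space M - A. Q n w \<and> R n w)"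
  proof eventually_elim
    case (elim n)
    then obtain A B where "A \<in> sets M" "B \<in> sets M" "measure M A \<le> \<rho> / 2" "measure M B \<le> \<rho> / 2"
      "\<forall>w\<in>space M - A. Q n w" "\<forall>w\<in>space M - B. R n w" by auto
    moreover from this have "measure M (A \<union> B) \<le> \<rho>"
      using measure_Un_le[of A M B] by simp
    ultimately show ?case by (intro bexI[of _ "A \<union> B"]) auto
  qed
qed

lemma whp_AE:
  assumes "prob_space M" "\<And>n. AE w in M. Q n w"
  shows "whp M Q"
  unfolding whp_def
proof (intro allI impI always_eventually)
  fix \<rho> :: real and n assume "0 < \<rho>"
  from assms(2)[of n] obtain N where "{w \<in> space M. \<not> Q n w} \<subseteq> N" "emeasure M N = 0" "N \<in> sets M"
    by (rule AE_E)
  then show "\<exists>A\<in>sets M. measure M A \<le> \<rho> \<and> (\<forall>w\<in>space M - A. Q n w)"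
    using \<open>0 < \<rho>\<close> by (intro bexI[of _ N]) (auto simp: measure_def)
qed

lemma whp_Ball:
  assumes "prob_space M" "finite T" "\<And>t. t \<in> T \<Longrightarrow> whp M (Q t)"
  shows "whp M (\<lambda>n w. \<forall>t\<in>T. Q t n w)"
  using assms(2,3)
proof (induction T)
  case empty
  show ?case by (rule whp_AE[OF assms(1)]) simp
next
  case (insert t T)
  then show ?case using whp_conj[OF assms(1), of "Q t" "\<lambda>n w. \<forall>t\<in>T. Q t n w"] by auto
qed

lemma Markov_exceptional_set:
  fixes f :: "'a \<Rightarrow> ennreal"
  assumes "prob_space M" and f[measurable]: "f \<in> borel_measurable M"
    and le: "(\<integral>\<^sup>+w. f w \<partial>M) \<le> ennreal (\<delta> * \<rho>)" and pos: "0 < \<delta>" "0 < \<rho>"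
  shows "\<exists>A\<in>sets M. measure M A \<le> \<rho> \<and> (\<forall>w\<in>space M - A. f w \<le> ennreal \<delta>)"
proof -
  interpret prob_space M by fact
  define A where "A = {w \<in> space M. 1 \<le> ennreal (1 / \<delta>) * f w}"
  have A: "A \<in> sets M" unfolding A_def by measurable
  have "emeasure M A \<le> ennreal (1 / \<delta>) * (\<integral>\<^sup>+w. f w * indicator (space M) w \<partial>M)"
    unfolding A_def by (rule nn_integral_Markov_inequality) auto
  also have "(\<integral>\<^sup>+w. f w * indicator (space M) w \<partial>M) = (\<integral>\<^sup>+w. f w \<partial>M)"
    by (intro nn_integral_cong) simp
  also have "ennreal (1 / \<delta>) * \<dots> \<le> ennreal (1 / \<delta>) * ennreal (\<delta> * \<rho>)"
    by (rule mult_left_mono[OF le]) simp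
  also have "\<dots> = ennreal \<rho>" using pos by (simp add: ennreal_mult[symmetric])
  finally have "measure M A \<le> \<rho>" using pos by (simp add: emeasure_eq_measure)
  moreover have "f w \<le> ennreal \<delta>" if "w \<in> space M - A" for w
  proof -
    have "ennreal (1 / \<delta>) * f w \<le> 1" using that unfolding A_def by auto
    then have "ennreal \<delta> * (ennreal (1 / \<delta>) * f w) \<le> ennreal \<delta>"
      using mult_left_mono[of _ 1 "ennreal \<delta>"] by simp
    then show ?thesis using pos by (simp add: mult.assoc[symmetric] ennreal_mult[symmetric])
  qed
  ultimately show ?thesis using A by blast
qed

lemma whp_Markov:
  fixes f :: "nat \<Rightarrow> 'a \<Rightarrow> ennreal"
  assumes "prob_space M" "\<forall>\<^sub>F n in sequentially. f n \<in> borel_measurable M"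
    and "\<forall>\<^sub>F n in sequentially. (\<integral>\<^sup>+w. f n w \<partial>M) \<le> ennreal (r n)" "r \<longlonglongrightarrow> 0" "0 < \<delta>"
  shows "whp M (\<lambda>n w. f n w \<le> ennreal \<delta>)"
  unfolding whp_def
proof (intro allI impI)
  fix \<rho> :: real assume \<rho>: "0 < \<rho>"
  then have "\<forall>\<^sub>F n in sequentially. r n < \<delta> * \<rho>" using assms(4,5) by (intro order_tendstoD(2)) auto
  from assms(2) assms(3) this
  show "\<forall>\<^sub>F n in sequentially. \<exists>A\<in>sets M. measure M A \<le> \<rho> \<and> (\<forall>w\<in>space M - A. f n w \<le> ennreal \<delta>)"
  proof eventually_elim
    case (elim n)
    then have "(\<integral>\<^sup>+w. f n w \<partial>M) \<le> ennreal (\<delta> * \<rho>)"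
      using ennreal_leI[of "r n" "\<delta> * \<rho>"] by (meson less_imp_le order_trans)
    with elim show ?case
      by (intro Markov_exceptional_set[OF assms(1)] \<open>0 < \<delta>\<close> \<rho>) auto
  qed
qed

text \<open>A factor with bounded means is bounded in probability, so a vanishing factor makes the product vanish.\<close>

lemma whp_mult_tight:
  fixes a :: "nat \<Rightarrow> 'a \<Rightarrow> real" and b :: "nat \<Rightarrow> 'a \<Rightarrow> 'c \<Rightarrow> real"
  assumes M: "prob_space M" and [measurable]: "\<And>n. a n \<in> borel_measurable M"
    and K: "\<And>n. (\<integral>\<^sup>+w. ennreal (a n w) \<partial>M) \<le> ennreal K" "0 < K"
    and a0: "\<And>n w. 0 \<le> a n w" and b: "\<And>\<delta>. 0 < \<delta> \<Longrightarrow> whp M (\<lambda>n w. \<forall>x. b n w x \<le> \<delta>)" and "0 < \<delta>"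
  shows "whp M (\<lambda>n w. \<forall>x. a n w * b n w x \<le> \<delta>)"
  unfolding whp_def
proof (intro allI impI)
  interpret prob_space M by fact
  fix \<rho> :: real assume \<rho>: "0 < \<rho>"
  define L where "L = 2 * K / \<rho>"
  have L: "0 < L" "L * (\<rho> / 2) = K" unfolding L_def using K \<rho> by (auto simp: field_simps)
  have "\<forall>\<^sub>F n in sequentially. \<exists>B\<in>sets M. measure M B \<le> \<rho> / 2 \<and> (\<forall>w\<in>space M - B. \<forall>x. b n w x \<le> \<delta> / L)"
    by (rule whpD[OF b]) (use L \<rho> \<open>0 < \<delta>\<close> in auto)
  then show "\<forall>\<^sub>F n in sequentially. \<exists>A\<in>sets M. measure M A \<le> \<rho> \<and> (\<forall>w\<in>space M - A. \<forall>x. a n w * b n w x \<le> \<delta>)"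
  proof eventually_elim
    case (elim n)
    then obtain B where B: "B \<in> sets M" "measure M B \<le> \<rho> / 2" "\<And>w x. w \<in> space M - B \<Longrightarrow> b n w x \<le> \<delta> / L" by auto
    have "\<exists>A\<in>sets M. measure M A \<le> \<rho> / 2 \<and> (\<forall>w\<in>space M - A. ennreal (a n w) \<le> ennreal L)"
      by (rule Markov_exceptional_set[OF M]) (use L \<rho> K in auto)
    then obtain A where A: "A \<in> sets M" "measure M A \<le> \<rho> / 2" "\<And>w. w \<in> space M - A \<Longrightarrow> a n w \<le> L"
      using L by (auto simp: ennreal_le_iff)
    have "a n w * b n w x \<le> \<delta>" if "w \<in> space M - (A \<union> B)" for w x
    proof -
      have "a n w * b n w x \<le> a n w * (\<delta> / L)"
        using a0 B(3) that by (intro mult_left_mono) auto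
      also have "\<dots> \<le> L * (\<delta> / L)"
        using A(3) that L \<open>0 < \<delta>\<close> by (intro mult_right_mono) auto
      finally show ?thesis using L by simp
    qed
    moreover have "measure M (A \<union> B) \<le> \<rho>"
      using measure_Un_le[of A M B] A B by simp
    ultimately show ?case using A B by (intro bexI[of _ "A \<union> B"]) auto
  qed
qed

section \<open>Continuous distribution functions\<close>

text \<open>
  The probability integral transform. The distribution is the image of the uniform one under the
  generalized inverse of its distribution function, and continuity makes that a right inverse.
\<close>

lemma (in real_distribution) nn_integral_cdf:
  fixes h :: "real \<Rightarrow> ennreal"
  assumes ccont: "continuous_on UNIV (cdf M)" and [measurable]: "h \<in> borel_measurable borel"
  shows "(\<integral>\<^sup>+z. h (cdf M z) \<partial>M) = (\<integral>\<^sup>+u. h u * indicator {0<..<1} u \<partial>lborel)"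
proof -
  interpret cdf_distribution M by unfold_locales
  have inv: "cdf M (I u) = u" if u: "0 < u" "u < 1" for u
  proof (rule antisym)
    show "u \<le> cdf M (I u)" using pseudoinverse[OF u, of "I u"] by simp
    have "((cdf M) \<longlongrightarrow> cdf M (I u)) (at_left (I u))"
      using ccont by (simp add: continuous_on_eq_continuous_at isCont_def filterlim_at_split)
    moreover have "cdf M x \<le> u" if "x < I u" for x
      using pseudoinverse[OF u, of x] that by auto
    then have "\<forall>\<^sub>F x in at_left (I u). cdf M x \<le> u"
      by (auto simp: eventually_at_left_real[of "I u - 1" "I u"] intro: eventually_mono[OF eventually_at_left_real[of "I u - 1" "I u"]])
    ultimately show "cdf M (I u) \<le> u"
      by (rule tendsto_upperbound) simp
  qed
  have [measurable]: "cdf M \<in> borel_measurable borel"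
    by (rule borel_measurable_continuous_onI[OF ccont])
  let ?L = "restrict_space lborel {0<..<1::real}"
  have I: "I \<in> measurable ?L borel" by measurable
  have "(\<integral>\<^sup>+z. h (cdf M z) \<partial>M) = (\<integral>\<^sup>+z. h (cdf M z) \<partial>distr ?L borel I)"
    by (simp only: distr_I_eq_M)
  also have "\<dots> = (\<integral>\<^sup>+u. h (cdf M (I u)) \<partial>?L)"
    by (rule nn_integral_distr[OF I]) simp
  also have "\<dots> = (\<integral>\<^sup>+u. h u \<partial>?L)"
    by (intro nn_integral_cong) (simp add: space_restrict_space inv)
  also have "\<dots> = (\<integral>\<^sup>+u. h u * indicator {0<..<1} u \<partial>lborel)"
    by (rule nn_integral_restrict_space) simp
  finally show ?thesis .
qed

lemma (in real_distribution) prob_cdf_between: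
  assumes cont: "continuous_on UNIV (cdf M)" and "u \<le> v"
  shows "measure M {z. u \<le> cdf M z \<and> cdf M z \<le> v} \<le> v - u"
proof -
  have [measurable]: "cdf M \<in> borel_measurable borel"
    by (rule borel_measurable_continuous_onI[OF cont])
  have "emeasure M {z. u \<le> cdf M z \<and> cdf M z \<le> v} = (\<integral>\<^sup>+z. indicator {u..v} (cdf M z) \<partial>M)"
  proof -
    have "indicator {u..v} (cdf M z) = (indicator {z. u \<le> cdf M z \<and> cdf M z \<le> v} z :: ennreal)" for z
      by (simp add: indicator_def)
    then show ?thesis by simp
  qed
  also have "\<dots> = (\<integral>\<^sup>+t. indicator {u..v} t * indicator {0<..<1} t \<partial>lborel)"
    by (rule nn_integral_cdf[OF cont]) simp
  also have "\<dots> \<le> (\<integral>\<^sup>+t. indicator {u..v} t \<partial>lborel)"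
    by (intro nn_integral_mono) (auto simp: indicator_def)
  also have "\<dots> = ennreal (v - u)" using assms by simp
  finally show ?thesis using assms by (simp add: emeasure_eq_measure)
qed

lemma (in real_distribution) integrable_survival_powr:
  assumes cont: "continuous_on UNIV (cdf M)" and a: "-1 < a"
  shows "(\<integral>\<^sup>+z. ennreal ((1 - cdf M z) powr a) \<partial>M) < \<infinity>"
proof -
  have "(\<integral>\<^sup>+z. ennreal ((1 - cdf M z) powr a) \<partial>M)
      = (\<integral>\<^sup>+u. ennreal ((1 - u) powr a) * indicator {0<..<1} u \<partial>lborel)"
    by (rule nn_integral_cdf[OF cont]) simp
  also have "\<dots> = (\<integral>\<^sup>+u. ennreal ((1 - (1 + (-1) * u)) powr a) * indicator {0<..<1} (1 + (-1) * u :: real) \<partial>lborel)"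
    using nn_integral_real_affine[of "\<lambda>u. ennreal ((1 - u) powr a) * indicator {0<..<1} u" "-1" 1] by simp
  also have "\<dots> \<le> (\<integral>\<^sup>+u. ennreal (u powr a) * indicator {0..1} u \<partial>lborel)"
    by (intro nn_integral_mono) (auto simp: indicator_def)
  also have "\<dots> = ennreal (1 powr (a + 1) / (a + 1))"
    using has_integral_powr_from_0[OF a, of 1] by (intro nn_integral_has_integral_lebesgue') auto
  finally show ?thesis by (rule le_less_trans) simp
qed

text \<open>
  The transform reduces this to the integral of \<open>1 / (1 - u)\<close>: up to a null set, \<open>z \<le> x\<close> says that the
  distribution function at \<open>z\<close> is at most its value at \<open>x\<close>.
\<close>

lemma (in real_distribution) nn_integral_hazard:
  assumes cont: "continuous_on UNIV (cdf M)" and x: "cdf M x < 1"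
  shows "(\<integral>\<^sup>+z. ennreal (1 / (1 - cdf M z)) * indicator {..x} z \<partial>M) = ennreal (- ln (1 - cdf M x))"
proof -
  have [measurable]: "cdf M \<in> borel_measurable borel"
    by (rule borel_measurable_continuous_onI[OF cont])
  let ?c = "cdf M x"
  define B where "B = {z. ?c \<le> cdf M z \<and> cdf M z \<le> ?c}"
  have B[measurable]: "B \<in> sets M" unfolding B_def by measurable
  have "measure M B \<le> 0"
    using prob_cdf_between[OF cont, of ?c ?c] unfolding B_def by simp
  then have "B \<in> null_sets M" using B by (simp add: null_sets_def emeasure_eq_measure measure_le_0_iff)
  then have "AE z in M. z \<notin> B" by (rule AE_not_in)
  then have "AE z in M. ennreal (1 / (1 - cdf M z)) * indicator {..x} z = ennreal (1 / (1 - cdf M z)) * indicator {0..?c} (cdf M z)"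
  proof eventually_elim
    case (elim z)
    have "z \<le> x \<longleftrightarrow> cdf M z \<le> ?c"
      using elim cdf_nondecreasing[of z x] cdf_nondecreasing[of x z] unfolding B_def by fastforce
    then show ?case by (auto simp: indicator_def cdf_nonneg)
  qed
  then have "(\<integral>\<^sup>+z. ennreal (1 / (1 - cdf M z)) * indicator {..x} z \<partial>M)
      = (\<integral>\<^sup>+z. ennreal (1 / (1 - cdf M z)) * indicator {0..?c} (cdf M z) \<partial>M)"
    by (rule nn_integral_cong_AE)
  also have "\<dots> = (\<integral>\<^sup>+u. ennreal (1 / (1 - u)) * indicator {0..?c} u * indicator {0<..<1} u \<partial>lborel)"
    by (rule nn_integral_cdf[OF cont]) simp
  also have "\<dots> = (\<integral>\<^sup>+u. ennreal (1 / (1 - u)) * indicator {0..?c} u \<partial>lborel)"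
  proof (rule nn_integral_cong_AE)
    have "AE u in lborel. (u::real) \<noteq> 0" by (rule AE_lborel_singleton)
    then show "AE u in lborel. ennreal (1 / (1 - u)) * indicator {0..?c} u * indicator {0<..<1} u
        = ennreal (1 / (1 - u)) * indicator {0..?c} u"
      using x by (auto elim!: eventually_mono simp: indicator_def)
  qed
  also have "\<dots> = ennreal (- ln (1 - ?c) - (- ln (1 - 0)))"
    using x by (intro nn_integral_FTC_Icc[where F = "\<lambda>u. - ln (1 - u)"])
      (auto intro!: derivative_eq_intros simp: cdf_nonneg)
  finally show ?thesis by simp
qed

text \<open>
  The grid serves to control a monotone approximation of \<open>V\<close> by its values at finitely many points, as
  in \<open>grid_bracketing\<close> below: every point has a grid point close above it, and one close below it
  unless \<open>V\<close> is small there.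
\<close>

lemma finite_grid:
  fixes V :: "real \<Rightarrow> real" and N :: nat and b :: real
  assumes cont: "continuous_on UNIV V" and mono: "mono V" and bot: "(V \<longlongrightarrow> 0) at_bot" and N: "0 < N"
  defines "d \<equiv> V b / N"
  obtains T where "finite T" "card T \<le> N" "T \<subseteq> {..b}"
    "\<And>x. x \<le> b \<Longrightarrow> \<exists>t\<in>T. x \<le> t \<and> V t - V x \<le> d \<and> (V x \<le> d \<or> (\<exists>t'\<in>T. t' \<le> x \<and> V x - V t' \<le> d))"
proof -
  have nonneg: "0 \<le> V x" for x
  proof (rule tendsto_upperbound[OF bot])
    show "\<forall>\<^sub>F y in at_bot. V y \<le> V x"
      unfolding eventually_at_bot_linorder using monoD[OF mono] by blast
  qed simp
  have mono': "x \<le> y \<Longrightarrow> V x \<le> V y" for x y by (rule monoD[OF mono])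
  have d0: "0 \<le> d" unfolding d_def using nonneg by simp
  have "\<exists>t\<le>b. V t = real k * d" if "1 \<le> k" "k \<le> N" for k
  proof (cases "V b = 0")
    case True
    then show ?thesis unfolding d_def by (intro exI[of _ b]) simp
  next
    case False
    then have "0 < d" unfolding d_def using nonneg[of b] N by (intro divide_pos_pos) auto
    from order_tendstoD(2)[OF bot this] obtain a where a: "V a < d"
      using eventually_happens'[OF trivial_limit_at_bot_linorder] by blast
    have kd: "real k * d \<le> V b"
      using that N nonneg[of b] unfolding d_def by (simp add: field_simps mult_right_mono)
    have dk: "d \<le> real k * d" using \<open>0 < d\<close> that by simp
    have "a \<le> b" using a dk kd mono'[of b a] by (cases "a \<le> b") auto
    then have "\<exists>t\<ge>a. t \<le> b \<and> V t = real k * d"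
      using a dk kd by (intro IVT') (auto intro: continuous_on_subset[OF cont])
    then show ?thesis by blast
  qed
  then have "\<forall>k. \<exists>t. 1 \<le> k \<and> k < N \<longrightarrow> t \<le> b \<and> V t = real k * d" by fastforce
  then obtain t where t: "\<And>k. 1 \<le> k \<Longrightarrow> k < N \<Longrightarrow> t k \<le> b \<and> V (t k) = real k * d" by metis
  define s where "s k = (if k = N then b else t k)" for k
  have s: "s k \<le> b" "V (s k) = real k * d" if "1 \<le> k" "k \<le> N" for k
    using t[of k] that N unfolding s_def d_def by auto
  show thesis
  proof
    show "finite (s ` {1..N})" "card (s ` {1..N}) \<le> N" using card_image_le[of "{1..N}" s] by auto
    show "s ` {1..N} \<subseteq> {..b}" using s by auto
    fix x assume "x \<le> b"
    define k where "k = (LEAST k. 1 \<le> k \<and> k \<le> N \<and> x \<le> s k)"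
    have "1 \<le> N \<and> N \<le> N \<and> x \<le> s N" using N \<open>x \<le> b\<close> by (simp add: s_def)
    from LeastI[of "\<lambda>k. 1 \<le> k \<and> k \<le> N \<and> x \<le> s k", OF this]
    have k: "1 \<le> k" "k \<le> N" "x \<le> s k" unfolding k_def by auto
    have below: "s j < x" if "1 \<le> j" "j < k" for j
      using not_less_Least[of j "\<lambda>k. 1 \<le> k \<and> k \<le> N \<and> x \<le> s k"] that k unfolding k_def by auto
    show "\<exists>t\<in>s ` {1..N}. x \<le> t \<and> V t - V x \<le> d \<and> (V x \<le> d \<or> (\<exists>t'\<in>s ` {1..N}. t' \<le> x \<and> V x - V t' \<le> d))"
    proof (cases "k = 1")
      case True
      then show ?thesis using k s[of 1] nonneg[of x] mono'[of x "s k"] N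
        by (intro bexI[of _ "s 1"]) auto
    next
      case False
      define j where "j = k - 1"
      have j: "1 \<le> j" "j < k" "real k * d = real j * d + d" using False k unfolding j_def
        by (auto simp: of_nat_diff algebra_simps)
      have "V (s j) \<le> V x" "V x \<le> V (s k)" "s j < x"
        using below[OF j(1,2)] k by (auto intro!: mono')
      then show ?thesis
        using j k s[of j] s[of k] by (intro bexI[of _ "s k"] conjI disjI2 bexI[of _ "s j"]) auto
    qed
  qed
qed

lemma grid_bracketing:
  fixes V W :: "real \<Rightarrow> real"
  assumes T: "\<exists>t\<in>T. x \<le> t \<and> V t - V x \<le> d \<and> (V x \<le> d \<or> (\<exists>t'\<in>T. t' \<le> x \<and> V x - V t' \<le> d))"
    and W: "mono W" "\<And>x. 0 \<le> W x" and V: "mono V" and d: "0 \<le> d"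
  shows "\<bar>W x - V x\<bar> \<le> d \<or> (\<exists>t\<in>T. \<bar>W x - V x\<bar> \<le> \<bar>W t - V t\<bar> + d \<and> V t - V x \<le> d)"
proof -
  obtain t where t: "t \<in> T" "x \<le> t" "V t - V x \<le> d" "V x \<le> d \<or> (\<exists>t'\<in>T. t' \<le> x \<and> V x - V t' \<le> d)"
    using T by auto
  show ?thesis
  proof (cases "V x \<le> W x")
    case True
    then have "\<bar>W x - V x\<bar> \<le> \<bar>W t - V t\<bar> + d"
      using monoD[OF W(1) t(2)] t(3) by auto
    then show ?thesis using t by blast
  next
    case False
    from t(4) show ?thesis
    proof
      assume "V x \<le> d"
      then show ?thesis using False W(2)[of x] by auto
    next
      assume "\<exists>t'\<in>T. t' \<le> x \<and> V x - V t' \<le> d"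
      then obtain t' where t': "t' \<in> T" "t' \<le> x" "V x - V t' \<le> d" by auto
      then have "\<bar>W x - V x\<bar> \<le> \<bar>W t' - V t'\<bar> + d" "V t' - V x \<le> d"
        using monoD[OF W(1) t'(2)] monoD[OF V t'(2)] False d by auto
      then show ?thesis using t' by blast
    qed
  qed
qed

context iid_sample
begin

section \<open>Empirical averages\<close>

lemma square_integrable_bounded:
  fixes g :: "'b \<Rightarrow> real"
  assumes [measurable]: "g \<in> borel_measurable P" and "\<And>z. \<bar>g z\<bar> \<le> B"
  shows "integrable P (\<lambda>z. (g z)\<^sup>2)" "(\<integral>z. (g z)\<^sup>2 \<partial>P) \<le> B\<^sup>2"
proof -
  have le: "(g z)\<^sup>2 \<le> B\<^sup>2" for z using assms(2)[of z] power_mono[of "\<bar>g z\<bar>" B 2] by simp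
  show i: "integrable P (\<lambda>z. (g z)\<^sup>2)"
    by (rule P.integrable_const_bound[of _ "B\<^sup>2"]) (use le in auto)
  show "(\<integral>z. (g z)\<^sup>2 \<partial>P) \<le> B\<^sup>2"
    using integral_mono[OF i, of "\<lambda>_. B\<^sup>2"] le by (simp add: P.prob_space)
qed

lemma mean_abs_average_le:
  fixes g :: "'b \<Rightarrow> real"
  assumes [measurable]: "g \<in> borel_measurable P" and sq: "integrable P (\<lambda>z. (g z)\<^sup>2)" and n: "0 < n"
  shows "(\<integral>\<^sup>+w. ennreal \<bar>(\<Sum>i<n. g (Z i w)) / n - (\<integral>z. g z \<partial>P)\<bar> \<partial>M)
    \<le> ennreal (sqrt ((\<integral>z. (g z)\<^sup>2 \<partial>P) / n))"
proof -
  have eq: "\<bar>(\<Sum>i<n. g (Z i w)) / n - (\<integral>z. g z \<partial>P)\<bar> = (1 / n) * \<bar>\<Sum>i<n. g (Z i w) - (\<integral>z. g z \<partial>P)\<bar>" for w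
    using n by (simp add: sum_subtractf abs_mult[symmetric] field_simps)
  have "(\<integral>\<^sup>+w. ennreal \<bar>(\<Sum>i<n. g (Z i w)) / n - (\<integral>z. g z \<partial>P)\<bar> \<partial>M)
      = ennreal (1 / n) * (\<integral>\<^sup>+w. ennreal \<bar>\<Sum>i<n. g (Z i w) - (\<integral>z. g z \<partial>P)\<bar> \<partial>M)"
    unfolding eq by (subst nn_integral_cmult[symmetric]) (auto simp: ennreal_mult[symmetric])
  also have "\<dots> \<le> ennreal (1 / n) * ennreal (sqrt (n * (\<integral>z. (g z)\<^sup>2 \<partial>P)))"
    using mean_abs_sum_le[OF assms(1) sq, of "{..<n}"] by (intro mult_left_mono) auto
  also have "\<dots> = ennreal (sqrt ((\<integral>z. (g z)\<^sup>2 \<partial>P) / n))"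
    using n by (simp add: ennreal_mult[symmetric] real_sqrt_mult real_sqrt_divide field_simps)
  finally show ?thesis .
qed

lemma mean_square_average_le:
  fixes g :: "'b \<Rightarrow> real"
  assumes [measurable]: "g \<in> borel_measurable P" and sq: "integrable P (\<lambda>z. (g z)\<^sup>2)" and n: "0 < n"
  shows "(\<integral>\<^sup>+w. ennreal (((\<Sum>i<n. g (Z i w)) / n - (\<integral>z. g z \<partial>P))\<^sup>2) \<partial>M)
    \<le> ennreal ((\<integral>z. (g z)\<^sup>2 \<partial>P) / n)"
proof -
  have eq: "((\<Sum>i<n. g (Z i w)) / n - (\<integral>z. g z \<partial>P))\<^sup>2 = (1 / n\<^sup>2) * (\<Sum>i<n. g (Z i w) - (\<integral>z. g z \<partial>P))\<^sup>2" for w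
    using n by (simp add: sum_subtractf field_simps power2_eq_square)
  have "(\<integral>\<^sup>+w. ennreal (((\<Sum>i<n. g (Z i w)) / n - (\<integral>z. g z \<partial>P))\<^sup>2) \<partial>M)
      = ennreal (1 / n\<^sup>2) * (\<integral>\<^sup>+w. ennreal ((\<Sum>i<n. g (Z i w) - (\<integral>z. g z \<partial>P))\<^sup>2) \<partial>M)"
    unfolding eq by (subst nn_integral_cmult[symmetric]) (auto simp: ennreal_mult[symmetric])
  also have "\<dots> \<le> ennreal (1 / n\<^sup>2) * ennreal (n * (\<integral>z. (g z)\<^sup>2 \<partial>P))"
    using mean_square_sum_le[OF assms(1) sq, of "{..<n}"] by (intro mult_left_mono) auto
  also have "\<dots> = ennreal ((\<integral>z. (g z)\<^sup>2 \<partial>P) / n)"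
    using n by (simp add: ennreal_mult[symmetric] power2_eq_square)
  finally show ?thesis .
qed

text \<open>
  A uniform law of large numbers for weighted empirical distribution functions, in the manner of
  Glivenko and Cantelli: monotonicity reduces the supremum to a finite grid.
\<close>

lemma weighted_Glivenko_Cantelli:
  fixes \<psi> g :: "'b \<Rightarrow> real"
  assumes [measurable]: "\<psi> \<in> borel_measurable P" "g \<in> borel_measurable P"
    and \<psi>: "\<And>z. 0 \<le> \<psi> z" "\<And>z. \<psi> z \<le> B" "\<And>z. b < g z \<Longrightarrow> \<psi> z = 0"
    and cont: "continuous_on UNIV (cdf (distr P borel g))" and \<delta>: "0 < \<delta>"
  shows "whp M (\<lambda>n w. \<forall>x. \<bar>(\<Sum>i<n. \<psi> (Z i w) * indicator {..x} (g (Z i w))) / n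
    - (\<integral>z. \<psi> z * indicator {..x} (g z) \<partial>P)\<bar> \<le> \<delta>)"
proof -
  interpret K: real_distribution "distr P borel g" by (rule P.real_distribution_distr) simp
  define H where "H = cdf (distr P borel g)"
  define V where "V x = (\<integral>z. \<psi> z * indicator {..x} (g z) \<partial>P)" for x
  define W where "W n w x = (\<Sum>i<n. \<psi> (Z i w) * indicator {..x} (g (Z i w))) / real n" for n w x
  have B0: "0 \<le> B" using \<psi>(1,2) by (meson order_trans)
  have \<psi>I: "\<psi> z * indicator A y \<le> B" "0 \<le> \<psi> z * indicator A y" for z and y :: real and A
    using \<psi> B0 by (auto simp: indicator_def)
  have int: "integrable P (\<lambda>z. \<psi> z * indicator {..x} (g z))" for x
    by (rule P.integrable_const_bound[of _ B]) (use \<psi>I in auto)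
  have V_mono: "mono V" unfolding V_def
    by (intro monoI integral_mono int mult_left_mono \<psi>) (auto simp: indicator_def)
  have H_eq: "H x = (\<integral>z. indicator {..x} (g z) \<partial>P)" for x
  proof -
    have "H x = measure P {z \<in> space P. g z \<le> x}"
      unfolding H_def cdf_def by (subst measure_distr) (auto intro!: arg_cong[of _ _ "measure P"])
    also have "\<dots> = (\<integral>z. indicator {z \<in> space P. g z \<le> x} z \<partial>P)" by simp
    also have "\<dots> = (\<integral>z. indicator {..x} (g z) \<partial>P)"
      by (intro Bochner_Integration.integral_cong) (auto simp: indicator_def)
    finally show ?thesis .
  qed
  have intH: "integrable P (\<lambda>z. indicat_real {..x} (g z))" for x
    by (rule P.integrable_const_bound[of _ 1]) auto
  have V_lip: "V y - V x \<le> B * (H y - H x)" if "x \<le> y" for x y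
  proof -
    have "V y - V x = (\<integral>z. \<psi> z * indicator {..y} (g z) - \<psi> z * indicator {..x} (g z) \<partial>P)"
      unfolding V_def using int by simp
    also have "\<dots> \<le> (\<integral>z. B * (indicator {..y} (g z) - indicator {..x} (g z)) \<partial>P)"
      using that \<psi> B0 by (intro integral_mono Bochner_Integration.integrable_diff int integrable_mult_right intH)
         (auto simp: indicator_def)
    also have "\<dots> = B * (H y - H x)" unfolding H_eq using intH by simp
    finally show ?thesis .
  qed
  have V_H: "V x \<le> B * H x" "0 \<le> V x" for x
  proof -
    have "V x \<le> (\<integral>z. B * indicator {..x} (g z) \<partial>P)" unfolding V_def
      using \<psi> by (intro integral_mono int integrable_mult_right intH) (auto simp: indicator_def)
    then show "V x \<le> B * H x" unfolding H_eq by simp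
    show "0 \<le> V x" unfolding V_def by (intro integral_nonneg_AE) (use \<psi>I in auto)
  qed
  have "continuous_on UNIV V"
    unfolding continuous_on_eq_continuous_at[OF open_UNIV] isCont_def
  proof
    fix x
    have "((\<lambda>y. B * \<bar>H y - H x\<bar>) \<longlongrightarrow> B * \<bar>H x - H x\<bar>) (at x)"
      using cont unfolding H_def continuous_on_eq_continuous_at[OF open_UNIV] isCont_def
      by (intro tendsto_intros) auto
    then have lim: "((\<lambda>y. B * \<bar>H y - H x\<bar>) \<longlongrightarrow> 0) (at x)" by simp
    have "\<bar>V y - V x\<bar> \<le> B * \<bar>H y - H x\<bar>" for y
    proof (cases "x \<le> y")
      case True
      then show ?thesis using V_lip[OF True] monoD[OF V_mono True] B0
        by (metis abs_ge_self abs_of_nonneg diff_ge_0_iff_ge mult_left_mono order_trans)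
    next
      case False
      then have "y \<le> x" by simp
      then show ?thesis using V_lip[of y x] monoD[OF V_mono \<open>y \<le> x\<close>] B0
        by (metis abs_ge_self abs_minus_commute abs_of_nonneg diff_ge_0_iff_ge mult_left_mono order_trans)
    qed
    then have "((\<lambda>y. V y - V x) \<longlongrightarrow> 0) (at x)"
      by (intro Lim_null_comparison[OF _ lim]) auto
    then show "V \<midarrow>x\<rightarrow> V x" by (simp add: LIM_zero_iff)
  qed
  moreover have "(V \<longlongrightarrow> 0) at_bot"
  proof (rule Lim_null_comparison)
    show "\<forall>\<^sub>F x in at_bot. norm (V x) \<le> B * H x" using V_H by auto
    show "((\<lambda>x. B * H x) \<longlongrightarrow> 0) at_bot"
      using tendsto_mult_left[OF K.cdf_lim_at_bot, of B] unfolding H_def by simp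
  qed
  moreover obtain N :: nat where N: "0 < N" "V b / N \<le> \<delta> / 2"
  proof -
    obtain N :: nat where "2 * V b / \<delta> < real N" using reals_Archimedean2 by blast
    then have "0 < Suc N" "V b / Suc N \<le> \<delta> / 2" using \<delta> by (auto simp: field_simps)
    then show thesis by (rule that)
  qed
  ultimately obtain T where T: "finite T" "T \<subseteq> {..b}"
    "\<And>x. x \<le> b \<Longrightarrow> \<exists>t\<in>T. x \<le> t \<and> V t - V x \<le> V b / N \<and> (V x \<le> V b / N \<or> (\<exists>t'\<in>T. t' \<le> x \<and> V x - V t' \<le> V b / N))"
    using finite_grid[OF _ V_mono] by metis
  have "whp M (\<lambda>n w. \<forall>t\<in>T. \<bar>W n w t - V t\<bar> \<le> \<delta> / 2)"
  proof (intro whp_Ball prob_space_axioms T)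
    fix t
    have [measurable]: "(\<lambda>w. W n w t) \<in> borel_measurable M" for n
      unfolding W_def by measurable
    have "whp M (\<lambda>n w. ennreal \<bar>W n w t - V t\<bar> \<le> ennreal (\<delta> / 2))"
    proof (rule whp_Markov[OF prob_space_axioms])
      show "\<forall>\<^sub>F n in sequentially. (\<integral>\<^sup>+w. ennreal \<bar>W n w t - V t\<bar> \<partial>M) \<le> ennreal (sqrt (B\<^sup>2 / n))"
        using eventually_gt_at_top[of 0]
      proof eventually_elim
        case (elim n)
        note * = square_integrable_bounded[of "\<lambda>z. \<psi> z * indicator {..t} (g z)" B]
        have "(\<integral>\<^sup>+w. ennreal \<bar>W n w t - V t\<bar> \<partial>M) \<le> ennreal (sqrt ((\<integral>z. (\<psi> z * indicator {..t} (g z))\<^sup>2 \<partial>P) / n))"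
          unfolding W_def V_def using * \<psi>I elim by (intro mean_abs_average_le) auto
        also have "\<dots> \<le> ennreal (sqrt (B\<^sup>2 / n))"
          using * \<psi>I elim by (intro ennreal_leI real_sqrt_le_mono divide_right_mono) auto
        finally show ?case .
      qed
      show "(\<lambda>n. sqrt (B\<^sup>2 / real n)) \<longlonglongrightarrow> 0"
        using tendsto_real_sqrt[OF lim_const_over_n[of "B\<^sup>2"]] by simp
    qed (use \<delta> in auto)
    then show "whp M (\<lambda>n w. \<bar>W n w t - V t\<bar> \<le> \<delta> / 2)"
      using \<delta> by (simp add: ennreal_le_iff)
  qed
  then show ?thesis
  proof (rule whp_mono, intro always_eventually allI ballI impI)
    fix n w x assume w: "\<forall>t\<in>T. \<bar>W n w t - V t\<bar> \<le> \<delta> / 2"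
    have W: "mono (W n w)"
      unfolding W_def by (intro monoI divide_right_mono sum_mono mult_left_mono \<psi>) (auto simp: indicator_def)
    have W0: "0 \<le> W n w y" for y
      unfolding W_def by (intro divide_nonneg_nonneg sum_nonneg) (use \<psi>I in auto)
    have le: "\<bar>W n w x - V x\<bar> \<le> \<delta>" if "x \<le> b" for x
    proof -
      have "\<bar>W n w x - V x\<bar> \<le> V b / N \<or> (\<exists>t\<in>T. \<bar>W n w x - V x\<bar> \<le> \<bar>W n w t - V t\<bar> + V b / N \<and> V t - V x \<le> V b / N)"
        using V_H N by (intro grid_bracketing[OF T(3)[OF that] W W0 V_mono]) auto
      then show ?thesis
      proof
        assume "\<bar>W n w x - V x\<bar> \<le> V b / N"
        then show ?thesis using N \<delta> by linarith
      next
        assume "\<exists>t\<in>T. \<bar>W n w x - V x\<bar> \<le> \<bar>W n w t - V t\<bar> + V b / N \<and> V t - V x \<le> V b / N"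
        then obtain t where "t \<in> T" "\<bar>W n w x - V x\<bar> \<le> \<bar>W n w t - V t\<bar> + V b / N" by blast
        moreover have "\<bar>W n w t - V t\<bar> \<le> \<delta> / 2" using w \<open>t \<in> T\<close> by blast
        ultimately show ?thesis using N by linarith
      qed
    qed
    have "\<bar>W n w x - V x\<bar> \<le> \<delta>"
    proof (cases "x \<le> b")
      case True then show ?thesis by (rule le)
    next
      case False
      have *: "\<psi> z * indicator {..x} (g z) = \<psi> z * indicator {..b} (g z)" for z
        using \<psi>(3)[of z] False by (auto simp: indicator_def)
      have "W n w x = W n w b" "V x = V b" unfolding W_def V_def * by auto
      then show ?thesis using le[of b] by simp
    qed
    then show "\<bar>(\<Sum>i<n. \<psi> (Z i w) * indicator {..x} (g (Z i w))) / n
      - (\<integral>z. \<psi> z * indicator {..x} (g z) \<partial>P)\<bar> \<le> \<delta>" unfolding W_def V_def .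
  qed
qed

text \<open>
  At a fixed \<open>p\<close> this is the Cauchy-Schwarz inequality. At a point \<open>p\<close> that is itself an observation,
  only one summand is not independent of \<open>p\<close>, and that costs a further \<open>2 / n\<close>.
\<close>

lemma
  fixes f :: "'b \<Rightarrow> 'b \<Rightarrow> real" and \<phi> :: "'b \<Rightarrow> real"
  assumes f[measurable]: "(\<lambda>(p, q). f p q) \<in> borel_measurable (P \<Otimes>\<^sub>M P)" and f1: "\<And>p q. \<bar>f p q\<bar> \<le> 1"
    and [measurable]: "\<phi> \<in> borel_measurable P" and \<phi>: "\<And>p. 0 \<le> \<phi> p" and n: "0 < n"
  defines "q \<equiv> \<lambda>p. (\<integral>z. (f p z)\<^sup>2 \<partial>P)"
    and "D \<equiv> \<lambda>w p. (\<Sum>j<n. f p (Z j w)) / real n - (\<integral>z. f p z \<partial>P)"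
  shows mean_abs_average_at_fixed_points:
    "(\<integral>\<^sup>+w. (\<integral>\<^sup>+p. ennreal (\<phi> p * \<bar>D w p\<bar>) \<partial>P) \<partial>M) \<le> (\<integral>\<^sup>+p. ennreal (\<phi> p * sqrt (q p / n)) \<partial>P)"
    and mean_abs_average_at_observations:
    "(\<integral>\<^sup>+w. ennreal ((\<Sum>i<n. \<phi> (Z i w) * \<bar>D w (Z i w)\<bar>) / n) \<partial>M)
      \<le> (\<integral>\<^sup>+p. ennreal (\<phi> p * (2 / n + sqrt (q p / n))) \<partial>P)"
proof -
  interpret MP: pair_sigma_finite M P by unfold_locales
  have fp[measurable]: "p \<in> space P \<Longrightarrow> f p \<in> borel_measurable P" for p
    using measurable_Pair2[OF f, of p] by simp
  have fbar[measurable]: "(\<lambda>p. \<integral>z. f p z \<partial>P) \<in> borel_measurable P" by measurable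
  have qm[measurable]: "q \<in> borel_measurable P" unfolding q_def by measurable
  have Dm: "(\<lambda>(w, p). D w p) \<in> borel_measurable (M \<Otimes>\<^sub>M P)"
    unfolding D_def by measurable
  have "(\<integral>\<^sup>+w. (\<integral>\<^sup>+p. ennreal (\<phi> p * \<bar>D w p\<bar>) \<partial>P) \<partial>M) = (\<integral>\<^sup>+p. (\<integral>\<^sup>+w. ennreal (\<phi> p * \<bar>D w p\<bar>) \<partial>M) \<partial>P)"
    using MP.Fubini'[of "\<lambda>w p. ennreal (\<phi> p * \<bar>D w p\<bar>)"] Dm by simp
  also have "\<dots> \<le> (\<integral>\<^sup>+p. ennreal (\<phi> p * sqrt (q p / n)) \<partial>P)"
  proof (rule nn_integral_mono)
    fix p assume p[simp]: "p \<in> space P"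
    have [measurable]: "(\<lambda>w. D w p) \<in> borel_measurable M" unfolding D_def by measurable
    have "(\<integral>\<^sup>+w. ennreal (\<phi> p * \<bar>D w p\<bar>) \<partial>M) = ennreal (\<phi> p) * (\<integral>\<^sup>+w. ennreal \<bar>D w p\<bar> \<partial>M)"
      using \<phi> by (subst nn_integral_cmult[symmetric]) (auto simp: ennreal_mult)
    also have "\<dots> \<le> ennreal (\<phi> p) * ennreal (sqrt (q p / n))"
      unfolding D_def q_def using n f1 by (intro mult_left_mono mean_abs_average_le square_integrable_bounded[of _ 1]) auto
    finally show "(\<integral>\<^sup>+w. ennreal (\<phi> p * \<bar>D w p\<bar>) \<partial>M) \<le> ennreal (\<phi> p * sqrt (q p / n))"
      using \<phi> by (simp add: ennreal_mult q_def)
  qed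
  finally show "(\<integral>\<^sup>+w. (\<integral>\<^sup>+p. ennreal (\<phi> p * \<bar>D w p\<bar>) \<partial>P) \<partial>M) \<le> (\<integral>\<^sup>+p. ennreal (\<phi> p * sqrt (q p / n)) \<partial>P)" .

  define g where "g p z = f p z - (\<integral>z. f p z \<partial>P)" for p z
  have gm[measurable]: "(\<lambda>(p, z). g p z) \<in> borel_measurable (P \<Otimes>\<^sub>M P)" unfolding g_def by measurable
  have g2: "\<bar>g p z\<bar> \<le> 2" if "p \<in> space P" for p z
  proof -
    have i: "integrable P (f p)" by (rule P.integrable_const_bound[of _ 1]) (use f1 that in auto)
    have "\<bar>\<integral>z. f p z \<partial>P\<bar> \<le> (\<integral>z. \<bar>f p z\<bar> \<partial>P)" by (rule integral_abs_bound)
    also have "\<dots> \<le> (\<integral>z. 1 \<partial>P)" using i f1 by (intro integral_mono) auto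
    also have "\<dots> = 1" by (simp add: P.prob_space)
    finally show ?thesis unfolding g_def using f1[of p z] by linarith
  qed
  have one: "(\<integral>\<^sup>+w. ennreal (\<phi> (Z i w) * \<bar>D w (Z i w)\<bar>) \<partial>M) \<le> (\<integral>\<^sup>+p. ennreal (\<phi> p * (2 / n + sqrt (q p / n))) \<partial>P)"
    if i: "i < n" for i
  proof -
    define J where "J = {..<n} - {i}"
    have J: "finite J" "i \<notin> J" "card J = n - 1" "{..<n} = insert i J" unfolding J_def using i by auto
    have "(\<integral>\<^sup>+w. ennreal (\<phi> (Z i w) * \<bar>D w (Z i w)\<bar>) \<partial>M)
        \<le> (\<integral>\<^sup>+w. ennreal (\<phi> (Z i w) * (2 / n + \<bar>\<Sum>j\<in>J. g (Z i w) (Z j w)\<bar> / n)) \<partial>M)"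
    proof (intro nn_integral_mono ennreal_leI mult_left_mono \<phi>)
      fix w assume w: "w \<in> space M"
      have "D w (Z i w) = (\<Sum>j<n. g (Z i w) (Z j w)) / n"
        unfolding D_def g_def using n by (simp add: sum_subtractf field_simps)
      also have "\<dots> = g (Z i w) (Z i w) / n + (\<Sum>j\<in>J. g (Z i w) (Z j w)) / n"
        unfolding J(4) using J(1,2) by (simp add: add_divide_distrib)
      also have "\<bar>\<dots>\<bar> \<le> \<bar>g (Z i w) (Z i w)\<bar> / n + \<bar>\<Sum>j\<in>J. g (Z i w) (Z j w)\<bar> / n"
        by (metis abs_triangle_ineq abs_divide abs_of_nat)
      also have "\<dots> \<le> 2 / n + \<bar>\<Sum>j\<in>J. g (Z i w) (Z j w)\<bar> / n"
        using g2[OF measurable_space[OF Z_measurable w]] by (intro add_right_mono divide_right_mono) auto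
      finally show "\<bar>D w (Z i w)\<bar> \<le> 2 / n + \<bar>\<Sum>j\<in>J. g (Z i w) (Z j w)\<bar> / n" .
    qed
    also have "\<dots> = (\<integral>\<^sup>+p. (\<integral>\<^sup>+w. ennreal (\<phi> p * (2 / n + \<bar>\<Sum>j\<in>J. g p (Z j w)\<bar> / n)) \<partial>M) \<partial>P)"
      using J by (intro leave_one_out) auto
    also have "\<dots> \<le> (\<integral>\<^sup>+p. ennreal (\<phi> p * (2 / n + sqrt (q p / n))) \<partial>P)"
    proof (rule nn_integral_mono)
      fix p assume p[simp]: "p \<in> space P"
      have q0: "0 \<le> q p" unfolding q_def by simp
      have gp[measurable]: "g p \<in> borel_measurable P" unfolding g_def by measurable
      have "(\<integral>\<^sup>+w. ennreal (\<phi> p * (2 / n + \<bar>\<Sum>j\<in>J. g p (Z j w)\<bar> / n)) \<partial>M)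
          = ennreal (\<phi> p) * (ennreal (2 / n) + ennreal (1 / n) * (\<integral>\<^sup>+w. ennreal \<bar>\<Sum>j\<in>J. g p (Z j w)\<bar> \<partial>M))"
      proof -
        have "(\<integral>\<^sup>+w. ennreal (\<phi> p * (2 / n + \<bar>\<Sum>j\<in>J. g p (Z j w)\<bar> / n)) \<partial>M)
           = (\<integral>\<^sup>+w. ennreal (\<phi> p) * (ennreal (2 / n) + ennreal (1 / n) * ennreal \<bar>\<Sum>j\<in>J. g p (Z j w)\<bar>) \<partial>M)"
          using \<phi> by (intro nn_integral_cong) (simp add: ennreal_mult[symmetric] ennreal_plus[symmetric] del: ennreal_plus)
        also have "\<dots> = ennreal (\<phi> p) * (ennreal (2 / n) + ennreal (1 / n) * (\<integral>\<^sup>+w. ennreal \<bar>\<Sum>j\<in>J. g p (Z j w)\<bar> \<partial>M))"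
          by (simp add: nn_integral_cmult nn_integral_add emeasure_space_1)
        finally show ?thesis .
      qed
      also have "\<dots> \<le> ennreal (\<phi> p) * (ennreal (2 / n) + ennreal (1 / n) * ennreal (sqrt (card J * q p)))"
        unfolding q_def g_def using J f1
        by (intro mult_left_mono add_left_mono mean_abs_sum_le square_integrable_bounded[of _ 1]) auto
      also have "\<dots> \<le> ennreal (\<phi> p) * (ennreal (2 / n) + ennreal (1 / n) * ennreal (sqrt (n * q p)))"
        using J q0 by (intro mult_left_mono add_left_mono ennreal_leI real_sqrt_le_mono mult_right_mono) auto
      also have "\<dots> = ennreal (\<phi> p * (2 / n + (1 / n) * sqrt (n * q p)))"
        using \<phi> q0 by (simp add: ennreal_mult[symmetric] ennreal_plus[symmetric] del: ennreal_plus)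
      also have "(1 / n) * sqrt (n * q p) = sqrt (q p / n)"
        using n by (simp add: real_sqrt_mult real_sqrt_divide field_simps)
      finally show "(\<integral>\<^sup>+w. ennreal (\<phi> p * (2 / n + \<bar>\<Sum>j\<in>J. g p (Z j w)\<bar> / n)) \<partial>M)
        \<le> ennreal (\<phi> p * (2 / n + sqrt (q p / n)))" .
    qed
    finally show ?thesis .
  qed
  have [measurable]: "(\<lambda>w. D w (Z i w)) \<in> borel_measurable M" for i
    unfolding D_def by measurable
  have "(\<integral>\<^sup>+w. ennreal ((\<Sum>i<n. \<phi> (Z i w) * \<bar>D w (Z i w)\<bar>) / n) \<partial>M)
      = (\<integral>\<^sup>+w. ennreal (1 / n) * (\<Sum>i<n. ennreal (\<phi> (Z i w) * \<bar>D w (Z i w)\<bar>)) \<partial>M)"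
    using \<phi> by (intro nn_integral_cong) (simp add: sum_ennreal ennreal_mult[symmetric] sum_nonneg)
  also have "\<dots> = ennreal (1 / n) * (\<Sum>i<n. \<integral>\<^sup>+w. ennreal (\<phi> (Z i w) * \<bar>D w (Z i w)\<bar>) \<partial>M)"
    by (simp add: nn_integral_cmult nn_integral_sum)
  also have "\<dots> \<le> ennreal (1 / n) * (\<Sum>i<n. \<integral>\<^sup>+p. ennreal (\<phi> p * (2 / n + sqrt (q p / n))) \<partial>P)"
    by (intro mult_left_mono sum_mono one) auto
  also have "\<dots> = (\<integral>\<^sup>+p. ennreal (\<phi> p * (2 / n + sqrt (q p / n))) \<partial>P)"
    using n by (simp add: mult.assoc[symmetric] ennreal_mult[symmetric] ennreal_of_nat_eq_real_of_nat)
  finally show "(\<integral>\<^sup>+w. ennreal ((\<Sum>i<n. \<phi> (Z i w) * \<bar>D w (Z i w)\<bar>) / n) \<partial>M)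
      \<le> (\<integral>\<^sup>+p. ennreal (\<phi> p * (2 / n + sqrt (q p / n))) \<partial>P)" .
qed

end

section \<open>Risk sets and the degenerate term for bounded weights\<close>

definition risk :: "real \<Rightarrow> real \<times> real \<Rightarrow> real" where
  "risk z q = of_bool (snd q \<le> z \<and> z \<le> fst q)"

lemma risk_bounds: "0 \<le> risk z q" "risk z q \<le> 1"
  by (auto simp: risk_def)

lemma risk_measurable [measurable]:
  "(\<lambda>(z, q). risk z q) \<in> borel_measurable (borel \<Otimes>\<^sub>M (borel \<Otimes>\<^sub>M borel))"
  unfolding risk_def of_bool_def split_def by measurable

text \<open>
  Grid points to the left of \<open>z\<close> are replaced by \<open>b\<close>, so that the minimum is over a fixed index set and
  measurable in \<open>z\<close>.
\<close>

definition next_grid_point :: "real set \<Rightarrow> real \<Rightarrow> real \<Rightarrow> real" where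
  "next_grid_point T b z = Min ((\<lambda>t. if z \<le> t then t else b) ` T)"

locale pair_sample = iid_sample M P Z for M :: "'a measure" and P :: "(real \<times> real) measure" and Z +
  assumes sets_P [measurable_cong]: "sets P = sets (borel \<Otimes>\<^sub>M borel)"
    and cont_H: "continuous_on UNIV (cdf (distr P borel fst))"
begin

lemma space_P [simp]: "space P = UNIV"
  using sets_eq_imp_space_eq[OF sets_P] by (simp add: space_pair_measure)

lemma Z_measurable_pair [measurable]: "Z i \<in> measurable M (borel \<Otimes>\<^sub>M borel)"
  using Z_measurable[of i] measurable_cong_sets[OF refl sets_P, of M] by simp

definition risk_prob :: "real \<Rightarrow> real" where "risk_prob z = (\<integral>q. risk z q \<partial>P)"
definition risk_freq :: "nat \<Rightarrow> 'a \<Rightarrow> real \<Rightarrow> real" where "risk_freq n w z = (\<Sum>i<n. risk z (Z i w)) / n"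

lemma risk_integrable: "integrable P (risk z)"
proof -
  show ?thesis by (rule P.integrable_const_bound[of _ 1]) (auto simp: risk_def)
qed

lemma risk_prob_bounds: "0 \<le> risk_prob z" "risk_prob z \<le> 1"
proof -
  show "0 \<le> risk_prob z" unfolding risk_prob_def by (simp add: risk_bounds)
  have "risk_prob z \<le> (\<integral>q. 1 \<partial>P)"
    unfolding risk_prob_def by (intro integral_mono risk_integrable) (auto simp: risk_bounds)
  then show "risk_prob z \<le> 1" using P.prob_space by simp
qed

lemma risk_freq_bounds: "0 \<le> risk_freq n w z" "risk_freq n w z \<le> 1"
proof -
  show "0 \<le> risk_freq n w z" unfolding risk_freq_def by (simp add: sum_nonneg risk_bounds)
  have "(\<Sum>i<n. risk z (Z i w)) \<le> (\<Sum>i<n. 1)" by (intro sum_mono) (simp add: risk_bounds)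
  then show "risk_freq n w z \<le> 1" unfolding risk_freq_def by (cases "n = 0") (auto simp: divide_simps)
qed

lemma risk_prob_measurable [measurable]: "risk_prob \<in> borel_measurable borel"
proof -
  show ?thesis unfolding risk_prob_def[abs_def] by measurable
qed

lemma risk_freq_measurable [measurable]: "(\<lambda>(w, z). risk_freq n w z) \<in> borel_measurable (M \<Otimes>\<^sub>M borel)"
  unfolding risk_freq_def by measurable

lemma risk_freq_measurable' [measurable]: "w \<in> space M \<Longrightarrow> risk_freq n w \<in> borel_measurable borel"
  unfolding risk_freq_def by measurable

end

lemma next_grid_point:
  assumes T: "finite T" "T \<subseteq> {..b}" and z: "\<exists>t\<in>T. z \<le> t"
  shows "next_grid_point T b z \<in> insert b T" "z \<le> next_grid_point T b z"
    and "t \<in> T \<Longrightarrow> z \<le> t \<Longrightarrow> next_grid_point T b z \<le> t"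
proof -
  let ?A = "(\<lambda>t. if z \<le> t then t else b) ` T"
  have fin: "finite ?A" "?A \<noteq> {}" using T z by auto
  have "next_grid_point T b z \<in> ?A" unfolding next_grid_point_def by (rule Min_in[OF fin])
  then show "next_grid_point T b z \<in> insert b T" "z \<le> next_grid_point T b z"
    using T z by (auto split: if_splits)
  show "t \<in> T \<Longrightarrow> z \<le> t \<Longrightarrow> next_grid_point T b z \<le> t"
    unfolding next_grid_point_def using fin by (auto intro!: Min_le)
qed

lemma next_grid_point_measurable [measurable]:
  "finite T \<Longrightarrow> next_grid_point T b \<in> borel_measurable borel"
  unfolding next_grid_point_def[abs_def] by (rule borel_measurable_Min) auto

context pair_sample
begin

text \<open>
  In the degenerate term below, the process \<open>risk_freq n w - risk_prob\<close> of order \<open>n powr (-1/2)\<close> is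
  integrated against the centred empirical distribution, so it should be of smaller order. Replace the
  process by its value at the next point of a fixed grid. The error is small in mean absolute value,
  uniformly in \<open>x\<close>, by the continuity of the distribution of the first coordinate; what remains is a
  finite sum of terms of order \<open>n powr (-1/2)\<close> times weighted empirical errors, which vanish uniformly.
\<close>

lemma degenerate_term_bounded_weight:
  fixes \<phi> :: "real \<Rightarrow> real"
  assumes [measurable]: "\<phi> \<in> borel_measurable borel"
    and \<phi>: "\<And>z. 0 \<le> \<phi> z" "\<And>z. \<phi> z \<le> B" "\<And>z. b < z \<Longrightarrow> \<phi> z = 0" and \<delta>: "0 < \<delta>"
  defines "D \<equiv> \<lambda>n w z. risk_freq n w z - risk_prob z"
  shows "whp M (\<lambda>n w. \<forall>x. sqrt n *
    \<bar>(\<Sum>i<n. \<phi> (fst (Z i w)) * indicator {..x} (fst (Z i w)) * D n w (fst (Z i w))) / n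
      - (\<integral>p. \<phi> (fst p) * indicator {..x} (fst p) * D n w (fst p) \<partial>P)\<bar> \<le> \<delta>)"
  unfolding whp_def
proof (intro allI impI)
  interpret PP: pair_sigma_finite P P by unfold_locales
  interpret K: real_distribution "distr P borel fst" by (rule P.real_distribution_distr) simp
  define H where "H = cdf (distr P borel fst)"
  have H_meas[measurable]: "H \<in> borel_measurable borel"
    unfolding H_def by (rule borel_measurable_continuous_onI[OF cont_H])
  have H_mono: "mono H" unfolding H_def by (intro monoI K.cdf_nondecreasing)
  have H01: "0 \<le> H x" "H x \<le> 1" for x unfolding H_def by (rule K.cdf_nonneg K.cdf_bounded_prob)+
  have H_between: "(\<integral>\<^sup>+p. indicator {p. u \<le> H (fst p) \<and> H (fst p) \<le> v} p \<partial>P) \<le> ennreal (v - u)" if "u \<le> v" for u v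
  proof -
    have "measure (distr P borel fst) {z. u \<le> H z \<and> H z \<le> v} \<le> v - u"
      unfolding H_def by (rule K.prob_cdf_between[OF cont_H that])
    moreover have "measure (distr P borel fst) {z. u \<le> H z \<and> H z \<le> v} = measure P {p. u \<le> H (fst p) \<and> H (fst p) \<le> v}"
      by (subst measure_distr) (auto intro!: arg_cong[of _ _ "measure P"])
    moreover have "{p \<in> space P. u \<le> H (fst p) \<and> H (fst p) \<le> v} \<in> sets P" by measurable
    ultimately show ?thesis by (simp add: P.emeasure_eq_measure ennreal_leI)
  qed
  have B0: "0 \<le> B" using \<phi>(1,2) by (meson order_trans)
  fix \<rho> :: real assume \<rho>: "0 < \<rho>"

  \<comment> \<open>The mean of the discretization error is at most \<open>B * (2 / sqrt n + 2 * sqrt (2 / N))\<close>, so \<open>N\<close> is chosen to make its second part half of what Markov's inequality tolerates.\<close>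
  obtain N :: nat where N: "0 < N" "B * (2 * sqrt (2 / N)) \<le> \<delta> / 2 * (\<rho> / 2) / 2"
  proof -
    have "(\<lambda>N. B * (2 * sqrt (2 / real N))) \<longlonglongrightarrow> B * (2 * sqrt 0)"
      by (intro tendsto_intros lim_const_over_n)
    then have "\<forall>\<^sub>F N in sequentially. B * (2 * sqrt (2 / real N)) < \<delta> / 2 * (\<rho> / 2) / 2"
      using \<delta> \<rho> by (intro order_tendstoD(2)) auto
    then have "\<forall>\<^sub>F N in sequentially. 0 < N \<and> B * (2 * sqrt (2 / real N)) < \<delta> / 2 * (\<rho> / 2) / 2"
      using eventually_gt_at_top[of 0] by eventually_elim simp
    then obtain N where "0 < N" "B * (2 * sqrt (2 / real N)) < \<delta> / 2 * (\<rho> / 2) / 2"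
      by (auto dest: eventually_happens)
    then show thesis by (intro that) auto
  qed
  define d where "d = H b / N"
  have d: "0 \<le> d" "d \<le> 1 / N" unfolding d_def using H01[of b] N by (auto simp: divide_right_mono)
  obtain T where T: "finite T" "T \<subseteq> {..b}"
    and grid: "\<And>x. x \<le> b \<Longrightarrow> \<exists>t\<in>T. x \<le> t \<and> H t - H x \<le> d \<and> (H x \<le> d \<or> (\<exists>t'\<in>T. t' \<le> x \<and> H x - H t' \<le> d))"
    using finite_grid[OF _ H_mono _ N(1), of b] cont_H K.cdf_lim_at_bot unfolding H_def[symmetric] d_def by metis
  have "b \<in> T" using grid[of b] T by force
  define \<tau> where "\<tau> = next_grid_point T b"
  have [measurable]: "\<tau> \<in> borel_measurable borel" unfolding \<tau>_def using T by simp
  have \<tau>: "\<tau> z \<in> T" "z \<le> \<tau> z" "H (\<tau> z) - H z \<le> d" if "z \<le> b" for z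
  proof -
    obtain t where t: "t \<in> T" "z \<le> t" "H t - H z \<le> d" using grid[OF \<open>z \<le> b\<close>] by auto
    show "\<tau> z \<in> T" "z \<le> \<tau> z"
      using next_grid_point(1,2)[OF T bexI[of "\<lambda>t. z \<le> t", OF t(2,1)]] \<open>b \<in> T\<close> unfolding \<tau>_def by auto
    have "\<tau> z \<le> t" using next_grid_point(3)[OF T bexI[of "\<lambda>t. z \<le> t", OF t(2,1)] t(1,2)] unfolding \<tau>_def .
    then show "H (\<tau> z) - H z \<le> d" using monoD[OF H_mono, of "\<tau> z" t] t by simp
  qed

  define f where "f p q = risk (fst p) q - risk (\<tau> (fst p)) q" for p q :: "real \<times> real"
  have f[measurable]: "(\<lambda>(p, q). f p q) \<in> borel_measurable (P \<Otimes>\<^sub>M P)" unfolding f_def by measurable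
  have f1: "\<bar>f p q\<bar> \<le> 1" for p q unfolding f_def risk_def by auto
  define Q where "Q p = (\<integral>q. (f p q)\<^sup>2 \<partial>P)" for p
  have fp[measurable]: "f p \<in> borel_measurable P" for p
    using measurable_Pair2[OF f, of p] by simp
  have Qm[measurable]: "Q \<in> borel_measurable P" unfolding Q_def by measurable
  have Q0: "0 \<le> Q p" for p unfolding Q_def by simp
  have Q_nn: "ennreal (Q p) = (\<integral>\<^sup>+q. ennreal ((f p q)\<^sup>2) \<partial>P)" for p
    unfolding Q_def using f1 by (intro nn_integral_eq_integral[symmetric] square_integrable_bounded[of _ 1]) auto

  have Q_int: "(\<integral>\<^sup>+p. ennreal ((indicator {..b} (fst p) * sqrt (Q p))\<^sup>2) \<partial>P) \<le> ennreal (2 / N)"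
  proof -
    define A where "A = {(p, q :: real \<times> real). fst p \<le> b \<and> fst p < snd q \<and> snd q \<le> \<tau> (fst (p :: real \<times> real))}"
    define A' where "A' = {(p, q :: real \<times> real). fst p \<le> b \<and> fst p \<le> fst q \<and> fst q \<le> \<tau> (fst (p :: real \<times> real))}"
    have "{x \<in> space (P \<Otimes>\<^sub>M P). fst (fst x) \<le> b \<and> fst (fst x) < snd (snd x) \<and> snd (snd x) \<le> \<tau> (fst (fst x))} \<in> sets (P \<Otimes>\<^sub>M P)"
      by measurable
    moreover have "{x \<in> space (P \<Otimes>\<^sub>M P). fst (fst x) \<le> b \<and> fst (fst x) \<le> fst (snd x) \<and> fst (snd x) \<le> \<tau> (fst (fst x))} \<in> sets (P \<Otimes>\<^sub>M P)"
      by measurable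
    ultimately have [measurable]: "A \<in> sets (P \<Otimes>\<^sub>M P)" "A' \<in> sets (P \<Otimes>\<^sub>M P)"
      unfolding A_def A'_def split_def by (simp_all add: space_pair_measure)
    have Am: "(\<lambda>q. indicator A (p, q) :: ennreal) \<in> borel_measurable P"
       "(\<lambda>q. indicator A' (p, q) :: ennreal) \<in> borel_measurable P" for p
      by measurable
    have "(\<integral>\<^sup>+p. ennreal ((indicator {..b} (fst p) * sqrt (Q p))\<^sup>2) \<partial>P)
       = (\<integral>\<^sup>+p. (\<integral>\<^sup>+q. ennreal (indicator {..b} (fst p) * (f p q)\<^sup>2) \<partial>P) \<partial>P)"
      using Q0 by (intro nn_integral_cong) (auto simp: indicator_def Q_nn)
    also have "\<dots> \<le> (\<integral>\<^sup>+p. (\<integral>\<^sup>+q. indicator A (p, q) + indicator A' (p, q) \<partial>P) \<partial>P)"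
    proof (intro nn_integral_mono)
      fix p q :: "real \<times> real"
      show "ennreal (indicator {..b} (fst p) * (f p q)\<^sup>2) \<le> indicator A (p, q) + indicator A' (p, q)"
        using \<tau>(2)[of "fst p"] by (auto simp: f_def risk_def indicator_def A_def A'_def)
    qed
    also have "\<dots> = (\<integral>\<^sup>+p. (\<integral>\<^sup>+q. indicator A (p, q) \<partial>P) \<partial>P) + (\<integral>\<^sup>+p. (\<integral>\<^sup>+q. indicator A' (p, q) \<partial>P) \<partial>P)"
      by (simp add: nn_integral_add Am)
    also have "(\<integral>\<^sup>+p. (\<integral>\<^sup>+q. indicator A (p, q) \<partial>P) \<partial>P) = (\<integral>\<^sup>+q. (\<integral>\<^sup>+p. indicator A (p, q) \<partial>P) \<partial>P)"
      by (rule PP.Fubini') simp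
    also have "\<dots> \<le> (\<integral>\<^sup>+q. ennreal d \<partial>P)"
    proof (rule nn_integral_mono)
      fix q :: "real \<times> real"
      have "(\<integral>\<^sup>+p. indicator A (p, q) \<partial>P) \<le> (\<integral>\<^sup>+p. indicator {p. H (snd q) - d \<le> H (fst p) \<and> H (fst p) \<le> H (snd q)} p \<partial>P)"
      proof (rule nn_integral_mono)
        fix p :: "real \<times> real"
        show "(indicator A (p, q) :: ennreal) \<le> indicator {p. H (snd q) - d \<le> H (fst p) \<and> H (fst p) \<le> H (snd q)} p"
          using \<tau>(3)[of "fst p"] monoD[OF H_mono, of "snd q" "\<tau> (fst p)"] monoD[OF H_mono, of "fst p" "snd q"]
          by (auto simp: indicator_def A_def)
      qed
      also have "\<dots> \<le> ennreal d" using H_between[of "H (snd q) - d" "H (snd q)"] d by simp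
      finally show "(\<integral>\<^sup>+p. indicator A (p, q) \<partial>P) \<le> ennreal d" .
    qed
    also have "(\<integral>\<^sup>+p. (\<integral>\<^sup>+q. indicator A' (p, q) \<partial>P) \<partial>P) \<le> (\<integral>\<^sup>+p. ennreal d \<partial>P)"
    proof (rule nn_integral_mono)
      fix p :: "real \<times> real"
      have "(\<integral>\<^sup>+q. indicator A' (p, q) \<partial>P) \<le> (\<integral>\<^sup>+q. indicator {q. H (fst p) \<le> H (fst q) \<and> H (fst q) \<le> H (fst p) + d} q \<partial>P)"
      proof (rule nn_integral_mono)
        fix q :: "real \<times> real"
        show "(indicator A' (p, q) :: ennreal) \<le> indicator {q. H (fst p) \<le> H (fst q) \<and> H (fst q) \<le> H (fst p) + d} q"
          using \<tau>(3)[of "fst p"] monoD[OF H_mono, of "fst q" "\<tau> (fst p)"] monoD[OF H_mono, of "fst p" "fst q"]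
          by (auto simp: indicator_def A'_def)
      qed
      also have "\<dots> \<le> ennreal d" using H_between[of "H (fst p)" "H (fst p) + d"] d by simp
      finally show "(\<integral>\<^sup>+q. indicator A' (p, q) \<partial>P) \<le> ennreal d" .
    qed
    finally have "(\<integral>\<^sup>+p. ennreal ((indicator {..b} (fst p) * sqrt (Q p))\<^sup>2) \<partial>P) \<le> ennreal d + ennreal d"
      using P.emeasure_space_1 by (simp add: add_mono)
    also have "\<dots> \<le> ennreal (2 / N)" using d by (simp add: ennreal_plus[symmetric] ennreal_leI del: ennreal_plus)
    finally show ?thesis .
  qed
  have sqQ: "(\<integral>\<^sup>+p. ennreal (indicator {..b} (fst p) * sqrt (Q p)) \<partial>P) \<le> ennreal (sqrt (2 / N))"
  proof -
    have "(\<integral>\<^sup>+p. ennreal \<bar>indicator {..b} (fst p) * sqrt (Q p)\<bar> \<partial>P) \<le> ennreal (sqrt (2 / N))"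
      by (rule P.nn_integral_le_sqrt[OF _ Q_int]) auto
    then show ?thesis using Q0 by simp
  qed
  have \<phi>Q: "(\<integral>\<^sup>+p. ennreal (\<phi> (fst p) * (c + sqrt (Q p / n))) \<partial>P) \<le> ennreal (B * (c + sqrt (2 / N) / sqrt n))"
    if "0 \<le> c" for c and n :: nat
  proof -
    have "(\<integral>\<^sup>+p. ennreal (\<phi> (fst p) * (c + sqrt (Q p / n))) \<partial>P)
        \<le> (\<integral>\<^sup>+p. ennreal (B * c) + ennreal (B / sqrt n) * ennreal (indicator {..b} (fst p) * sqrt (Q p)) \<partial>P)"
    proof (rule nn_integral_mono)
      fix p :: "real \<times> real"
      have "\<phi> (fst p) * (c + sqrt (Q p / n)) \<le> B * c + B / sqrt n * (indicator {..b} (fst p) * sqrt (Q p))"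
      proof (cases "fst p \<le> b")
        case True
        have "\<phi> (fst p) * (c + sqrt (Q p / n)) \<le> B * (c + sqrt (Q p / n))"
          using \<phi> Q0 that by (intro mult_right_mono) auto
        then show ?thesis using True by (simp add: real_sqrt_divide algebra_simps)
      next
        case False
        then show ?thesis using \<phi>(3)[of "fst p"] B0 that by simp
      qed
      then show "ennreal (\<phi> (fst p) * (c + sqrt (Q p / n)))
        \<le> ennreal (B * c) + ennreal (B / sqrt n) * ennreal (indicator {..b} (fst p) * sqrt (Q p))"
        using B0 Q0 that by (simp add: ennreal_mult[symmetric] ennreal_plus[symmetric] ennreal_leI del: ennreal_plus)
    qed
    also have "\<dots> = ennreal (B * c) + ennreal (B / sqrt n) * (\<integral>\<^sup>+p. ennreal (indicator {..b} (fst p) * sqrt (Q p)) \<partial>P)"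
      using P.emeasure_space_1 by (simp add: nn_integral_add nn_integral_cmult)
    also have "\<dots> \<le> ennreal (B * c) + ennreal (B / sqrt n) * ennreal (sqrt (2 / N))"
      by (intro add_left_mono mult_left_mono sqQ) auto
    also have "\<dots> = ennreal (B * (c + sqrt (2 / N) / sqrt n))"
      using B0 that by (simp add: ennreal_mult[symmetric] ennreal_plus[symmetric] algebra_simps del: ennreal_plus)
    finally show ?thesis .
  qed

  define E where "E n w p = (\<Sum>j<n. f p (Z j w)) / real n - (\<integral>q. f p q \<partial>P)" for n w p
  have E_eq: "E n w p = D n w (fst p) - D n w (\<tau> (fst p))" for n w p
    unfolding E_def f_def D_def risk_freq_def risk_prob_def
    using risk_integrable by (simp add: sum_subtractf diff_divide_distrib)
  have D1: "\<bar>D n w z\<bar> \<le> 1" for n w z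
    unfolding D_def using risk_prob_bounds[of z] risk_freq_bounds[of n w z] by linarith
  have Dm[measurable]: "w \<in> space M \<Longrightarrow> D n w \<in> borel_measurable borel" for n w unfolding D_def by measurable
  have Dm'[measurable]: "(\<lambda>(w, z). D n w z) \<in> borel_measurable (M \<Otimes>\<^sub>M borel)" for n unfolding D_def by measurable
  have Dm''[measurable]: "(\<lambda>w. D n w z) \<in> borel_measurable M" for n z unfolding D_def risk_freq_def by measurable
  have Em[measurable]: "w \<in> space M \<Longrightarrow> E n w \<in> borel_measurable P" for n w unfolding E_eq[abs_def] by measurable
  have Em'[measurable]: "(\<lambda>(w, p). E n w p) \<in> borel_measurable (M \<Otimes>\<^sub>M P)" for n unfolding E_eq by measurable
  define S where "S n w = ennreal (sqrt n) * (ennreal ((\<Sum>i<n. \<phi> (fst (Z i w)) * \<bar>E n w (Z i w)\<bar>) / n)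
     + (\<integral>\<^sup>+p. ennreal (\<phi> (fst p) * \<bar>E n w p\<bar>) \<partial>P))" for n w
  have Sm: "S n \<in> borel_measurable M" for n unfolding S_def by measurable
  have S_mean: "(\<integral>\<^sup>+w. S n w \<partial>M) \<le> ennreal (B * (2 / sqrt n + 2 * sqrt (2 / N)))" if n: "0 < n" for n
  proof -
    have "(\<integral>\<^sup>+w. S n w \<partial>M) = ennreal (sqrt n) * ((\<integral>\<^sup>+w. ennreal ((\<Sum>i<n. \<phi> (fst (Z i w)) * \<bar>E n w (Z i w)\<bar>) / n) \<partial>M)
     + (\<integral>\<^sup>+w. (\<integral>\<^sup>+p. ennreal (\<phi> (fst p) * \<bar>E n w p\<bar>) \<partial>P) \<partial>M))"
      unfolding S_def by (simp add: nn_integral_cmult nn_integral_add)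
    also have "\<dots> \<le> ennreal (sqrt n) * (ennreal (B * (2 / n + sqrt (2 / N) / sqrt n)) + ennreal (B * (0 + sqrt (2 / N) / sqrt n)))"
    proof (intro mult_left_mono add_mono)
      show "(\<integral>\<^sup>+w. ennreal ((\<Sum>i<n. \<phi> (fst (Z i w)) * \<bar>E n w (Z i w)\<bar>) / n) \<partial>M) \<le> ennreal (B * (2 / n + sqrt (2 / N) / sqrt n))"
        unfolding E_def using \<phi> f1 n
        by (intro order_trans[OF mean_abs_average_at_observations \<phi>Q[of "2 / n" n, unfolded Q_def]]) auto
      show "(\<integral>\<^sup>+w. (\<integral>\<^sup>+p. ennreal (\<phi> (fst p) * \<bar>E n w p\<bar>) \<partial>P) \<partial>M) \<le> ennreal (B * (0 + sqrt (2 / N) / sqrt n))"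
        unfolding E_def using \<phi> f1 n \<phi>Q[of 0 n, unfolded Q_def]
        by (intro order_trans[OF mean_abs_average_at_fixed_points]) auto
    qed auto
    also have "\<dots> = ennreal (sqrt n * (B * (2 / n + sqrt (2 / N) / sqrt n) + B * (sqrt (2 / N) / sqrt n)))"
      using B0 by (simp add: ennreal_mult[symmetric] ennreal_plus[symmetric] del: ennreal_plus)
    also have "sqrt n * (B * (2 / n + sqrt (2 / N) / sqrt n) + B * (sqrt (2 / N) / sqrt n)) = B * (2 / sqrt n + 2 * sqrt (2 / N))"
    proof -
      have "r * (B * (2 / (r * r) + c / r) + B * (c / r)) = B * (2 / r + 2 * c)" if "0 < r" for r c :: real
        using that by (simp add: field_simps)
      from this[of "sqrt n"] show ?thesis using n by simp
    qed
    finally show ?thesis .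
  qed
  have ev1: "\<forall>\<^sub>F n in sequentially. \<exists>A\<in>sets M. measure M A \<le> \<rho> / 2 \<and> (\<forall>w\<in>space M - A. S n w \<le> ennreal (\<delta> / 2))"
  proof -
    have "(\<lambda>n. B * (2 / sqrt (real n))) \<longlonglongrightarrow> B * 0"
      by (intro tendsto_intros real_tendsto_divide_at_top[OF tendsto_const]
           filterlim_compose[OF sqrt_at_top filterlim_real_sequentially])
    then have "\<forall>\<^sub>F n in sequentially. B * (2 / sqrt (real n)) < \<delta> / 2 * (\<rho> / 2) / 2"
      using \<delta> \<rho> by (intro order_tendstoD(2)) auto
    with eventually_gt_at_top[of 0] show ?thesis
    proof eventually_elim
      case (elim n)
      have "(\<integral>\<^sup>+w. S n w \<partial>M) \<le> ennreal (\<delta> / 2 * (\<rho> / 2))"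
      proof (rule order_trans[OF S_mean[OF elim(1)]], rule ennreal_leI)
        have "B * (2 / sqrt n + 2 * sqrt (2 / N)) = B * (2 / sqrt n) + B * (2 * sqrt (2 / N))"
          by (rule distrib_left)
        then show "B * (2 / sqrt n + 2 * sqrt (2 / N)) \<le> \<delta> / 2 * (\<rho> / 2)"
          using elim(2) N(2) by linarith
      qed
      then show ?case using \<delta> \<rho> by (intro Markov_exceptional_set Sm prob_space_axioms) auto
    qed
  qed

  define g where "g t n w x = (\<Sum>i<n. (\<phi> (fst (Z i w)) * of_bool (\<tau> (fst (Z i w)) = t)) * indicator {..x} (fst (Z i w))) / n
    - (\<integral>p. (\<phi> (fst p) * of_bool (\<tau> (fst p) = t)) * indicator {..x} (fst p) \<partial>P)" for t n w x
  have g: "whp M (\<lambda>n w. \<forall>x. \<bar>g t n w x\<bar> \<le> \<epsilon>)" if "0 < \<epsilon>" for t \<epsilon>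
    unfolding g_def
    using \<phi> B0 that by (intro weighted_Glivenko_Cantelli[where B = B and b = b] cont_H) auto
  have Dt: "(\<integral>\<^sup>+w. ennreal (sqrt n * \<bar>D n w t\<bar>) \<partial>M) \<le> ennreal 1" for n t
  proof (cases "n = 0")
    case False
    have *: "integrable P (\<lambda>q. (risk t q)\<^sup>2)" "(\<integral>q. (risk t q)\<^sup>2 \<partial>P) \<le> 1\<^sup>2"
      using square_integrable_bounded[of "risk t" 1] risk_bounds by (auto simp: abs_of_nonneg)
    have "(\<integral>\<^sup>+w. ennreal (sqrt n * \<bar>D n w t\<bar>) \<partial>M) = ennreal (sqrt n) * (\<integral>\<^sup>+w. ennreal \<bar>D n w t\<bar> \<partial>M)"
      by (subst nn_integral_cmult[symmetric]) (auto simp: ennreal_mult)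
    also have "\<dots> \<le> ennreal (sqrt n) * ennreal (sqrt ((\<integral>q. (risk t q)\<^sup>2 \<partial>P) / n))"
      unfolding D_def risk_freq_def risk_prob_def
      using False by (intro mult_left_mono mean_abs_average_le *) auto
    also have "\<dots> \<le> ennreal (sqrt n) * ennreal (sqrt (1 / n))"
      using * by (intro mult_left_mono ennreal_leI real_sqrt_le_mono divide_right_mono) auto
    also have "\<dots> = ennreal 1" using False by (simp add: ennreal_mult[symmetric] real_sqrt_divide)
    finally show ?thesis .
  qed simp
  have whp2: "whp M (\<lambda>n w. \<forall>t\<in>T. \<forall>x. (sqrt n * \<bar>D n w t\<bar>) * \<bar>g t n w x\<bar> \<le> \<delta> / (2 * (card T + 1)))"
    using g \<delta> by (intro whp_Ball prob_space_axioms T(1) whp_mult_tight[where K = 1] Dt) auto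
  have "\<forall>\<^sub>F n in sequentially. \<exists>A\<in>sets M. measure M A \<le> \<rho> / 2 \<and>
     (\<forall>w\<in>space M - A. \<forall>t\<in>T. \<forall>x. (sqrt n * \<bar>D n w t\<bar>) * \<bar>g t n w x\<bar> \<le> \<delta> / (2 * (card T + 1)))"
    by (rule whpD[OF whp2]) (use \<rho> in simp)
  with ev1 show "\<forall>\<^sub>F n in sequentially. \<exists>A\<in>sets M. measure M A \<le> \<rho> \<and> (\<forall>w\<in>space M - A. \<forall>x. sqrt n *
    \<bar>(\<Sum>i<n. \<phi> (fst (Z i w)) * indicator {..x} (fst (Z i w)) * D n w (fst (Z i w))) / n
      - (\<integral>p. \<phi> (fst p) * indicator {..x} (fst p) * D n w (fst p) \<partial>P)\<bar> \<le> \<delta>)"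
  proof eventually_elim
    case (elim n)
    then obtain A A' where A: "A \<in> sets M" "measure M A \<le> \<rho> / 2" "\<And>w. w \<in> space M - A \<Longrightarrow> S n w \<le> ennreal (\<delta> / 2)"
      and A': "A' \<in> sets M" "measure M A' \<le> \<rho> / 2"
      "\<And>w t x. w \<in> space M - A' \<Longrightarrow> t \<in> T \<Longrightarrow> (sqrt n * \<bar>D n w t\<bar>) * \<bar>g t n w x\<bar> \<le> \<delta> / (2 * (card T + 1))"
      by blast
    have "sqrt n * \<bar>(\<Sum>i<n. \<phi> (fst (Z i w)) * indicator {..x} (fst (Z i w)) * D n w (fst (Z i w))) / n
      - (\<integral>p. \<phi> (fst p) * indicator {..x} (fst p) * D n w (fst p) \<partial>P)\<bar> \<le> \<delta>" if w: "w \<in> space M - (A \<union> A')" for w x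
    proof -
      have w': "w \<in> space M" using w by simp
      note [measurable] = Dm[OF w'] Em[OF w']
      define \<theta> where "\<theta> z = \<phi> z * indicator {..x} z" for z :: real
      have [measurable]: "\<theta> \<in> borel_measurable borel" unfolding \<theta>_def by measurable
      have \<theta>: "0 \<le> \<theta> z" "\<theta> z \<le> \<phi> z" "\<theta> z \<le> B" for z
        using \<phi>(1,2)[of z] B0 unfolding \<theta>_def by (auto simp: indicator_def)
      have split: "\<theta> (fst p) * D n w (fst p) = \<theta> (fst p) * E n w p
        + (\<Sum>t\<in>T. D n w t * ((\<phi> (fst p) * of_bool (\<tau> (fst p) = t)) * indicator {..x} (fst p)))" for p
      proof (cases "fst p \<le> b")
        case True
        have "(\<Sum>t\<in>T. D n w t * ((\<phi> (fst p) * of_bool (\<tau> (fst p) = t)) * indicator {..x} (fst p)))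
          = (\<Sum>t\<in>T. if \<tau> (fst p) = t then D n w t * \<theta> (fst p) else 0)"
          by (intro sum.cong) (auto simp: \<theta>_def)
        also have "\<dots> = D n w (\<tau> (fst p)) * \<theta> (fst p)" using T(1) \<tau>(1)[OF True] by simp
        finally show ?thesis by (simp add: E_eq algebra_simps)
      next
        case False
        then show ?thesis using \<phi>(3)[of "fst p"] by (simp add: \<theta>_def)
      qed
      have E2: "\<bar>E n w p\<bar> \<le> 2" for p unfolding E_eq using D1[of n w "fst p"] D1[of n w "\<tau> (fst p)"] by linarith
      have i1: "integrable P (\<lambda>p. \<theta> (fst p) * E n w p)"
        using \<theta> E2 B0 by (intro P.integrable_const_bound[of _ "B * 2"]) (auto simp: abs_mult intro!: mult_mono)
      have i1': "integrable P (\<lambda>p. \<phi> (fst p) * \<bar>E n w p\<bar>)"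
        using \<phi> E2 B0 by (intro P.integrable_const_bound[of _ "B * 2"]) (auto simp: abs_mult intro!: mult_mono)
      have i2: "integrable P (\<lambda>p. (\<phi> (fst p) * of_bool (\<tau> (fst p) = t)) * indicator {..x} (fst p))" for t
        using \<phi> B0 by (intro P.integrable_const_bound[of _ B]) (auto simp: indicator_def)
      have swap: "(\<Sum>i<n. \<Sum>t\<in>T. c t * a t i) / real n = (\<Sum>t\<in>T. c t * ((\<Sum>i<n. a t i) / real n))"
        for c :: "real \<Rightarrow> real" and a :: "real \<Rightarrow> nat \<Rightarrow> real"
        by (subst sum.swap) (simp add: sum_distrib_left sum_divide_distrib)
      let ?avg = "(\<Sum>i<n. \<theta> (fst (Z i w)) * E n w (Z i w)) / n" and ?int = "\<integral>p. \<theta> (fst p) * E n w p \<partial>P"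
      have "(\<Sum>i<n. \<phi> (fst (Z i w)) * indicator {..x} (fst (Z i w)) * D n w (fst (Z i w))) / n
         = ?avg + (\<Sum>t\<in>T. D n w t * ((\<Sum>i<n. (\<phi> (fst (Z i w)) * of_bool (\<tau> (fst (Z i w)) = t)) * indicator {..x} (fst (Z i w))) / n))"
        unfolding \<theta>_def[symmetric] split sum.distrib add_divide_distrib swap ..
      moreover have "(\<integral>p. \<phi> (fst p) * indicator {..x} (fst p) * D n w (fst p) \<partial>P)
         = ?int + (\<Sum>t\<in>T. D n w t * (\<integral>p. (\<phi> (fst p) * of_bool (\<tau> (fst p) = t)) * indicator {..x} (fst p) \<partial>P))"
        unfolding \<theta>_def[symmetric] split using i1 i2 by simp
      ultimately have eq: "(\<Sum>i<n. \<phi> (fst (Z i w)) * indicator {..x} (fst (Z i w)) * D n w (fst (Z i w))) / n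
         - (\<integral>p. \<phi> (fst p) * indicator {..x} (fst p) * D n w (fst p) \<partial>P)
         = (?avg - ?int) + (\<Sum>t\<in>T. D n w t * g t n w x)"
        unfolding g_def by (simp add: sum_subtractf right_diff_distrib)
      have "\<bar>?avg\<bar> \<le> (\<Sum>i<n. \<bar>\<theta> (fst (Z i w)) * E n w (Z i w)\<bar>) / n"
        by (simp add: divide_right_mono)
      also have "\<dots> \<le> (\<Sum>i<n. \<phi> (fst (Z i w)) * \<bar>E n w (Z i w)\<bar>) / n"
        using \<theta> by (intro divide_right_mono sum_mono) (auto simp: abs_mult intro!: mult_right_mono)
      finally have b1: "\<bar>?avg\<bar> \<le> (\<Sum>i<n. \<phi> (fst (Z i w)) * \<bar>E n w (Z i w)\<bar>) / n" .
      have "\<bar>?int\<bar> \<le> (\<integral>p. \<bar>\<theta> (fst p) * E n w p\<bar> \<partial>P)" by (rule integral_abs_bound)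
      also have "\<dots> \<le> (\<integral>p. \<phi> (fst p) * \<bar>E n w p\<bar> \<partial>P)"
        using \<theta> by (intro integral_mono i1' integrable_abs i1) (auto simp: abs_mult intro!: mult_right_mono)
      finally have b2: "\<bar>?int\<bar> \<le> (\<integral>p. \<phi> (fst p) * \<bar>E n w p\<bar> \<partial>P)" .
      have "S n w = ennreal (sqrt n * ((\<Sum>i<n. \<phi> (fst (Z i w)) * \<bar>E n w (Z i w)\<bar>) / n + (\<integral>p. \<phi> (fst p) * \<bar>E n w p\<bar> \<partial>P)))"
        unfolding S_def using i1' \<phi>
        by (subst nn_integral_eq_integral)
           (auto simp: ennreal_mult[symmetric] ennreal_plus[symmetric] sum_nonneg simp del: ennreal_plus)
      then have b3: "sqrt n * ((\<Sum>i<n. \<phi> (fst (Z i w)) * \<bar>E n w (Z i w)\<bar>) / n + (\<integral>p. \<phi> (fst p) * \<bar>E n w p\<bar> \<partial>P)) \<le> \<delta> / 2"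
        using A(3)[of w] w \<delta> by (simp add: ennreal_le_iff)
      have b4: "sqrt n * \<bar>?avg - ?int\<bar> \<le> \<delta> / 2"
      proof (rule order_trans[OF mult_left_mono b3])
        show "\<bar>?avg - ?int\<bar> \<le> (\<Sum>i<n. \<phi> (fst (Z i w)) * \<bar>E n w (Z i w)\<bar>) / n + (\<integral>p. \<phi> (fst p) * \<bar>E n w p\<bar> \<partial>P)"
          using b1 b2 by linarith
      qed simp
      have "sqrt n * \<bar>\<Sum>t\<in>T. D n w t * g t n w x\<bar> \<le> sqrt n * (\<Sum>t\<in>T. \<bar>D n w t * g t n w x\<bar>)"
        by (intro mult_left_mono) auto
      also have "\<dots> = (\<Sum>t\<in>T. (sqrt n * \<bar>D n w t\<bar>) * \<bar>g t n w x\<bar>)"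
        by (simp add: sum_distrib_left abs_mult mult.assoc)
      also have "\<dots> \<le> (\<Sum>t\<in>T. \<delta> / (2 * (card T + 1)))" using w by (intro sum_mono A'(3)) auto
      also have "\<dots> \<le> \<delta> / 2" using \<delta> by (simp add: field_simps)
      finally have b5: "sqrt n * \<bar>\<Sum>t\<in>T. D n w t * g t n w x\<bar> \<le> \<delta> / 2" .
      have "sqrt n * \<bar>(?avg - ?int) + (\<Sum>t\<in>T. D n w t * g t n w x)\<bar>
         \<le> sqrt n * (\<bar>?avg - ?int\<bar> + \<bar>\<Sum>t\<in>T. D n w t * g t n w x\<bar>)"
        by (intro mult_left_mono) auto
      then show ?thesis unfolding eq using b4 b5 by (simp add: distrib_left)
    qed
    moreover have "measure M (A \<union> A') \<le> \<rho>"
      using measure_Un_le[of A M A'] A A' by simp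
    ultimately show ?case using A A' by (intro bexI[of _ "A \<union> A'"]) auto
  qed
qed

end

section \<open>The left-truncation model\<close>

locale truncation_model = X: real_distribution \<mu> + Y: real_distribution \<nu> for \<mu> \<nu> :: "real measure" +
  fixes \<alpha> :: real
  assumes cont_F: "continuous_on UNIV (cdf \<mu>)"
    and \<alpha>_def: "\<alpha> = measure (\<mu> \<Otimes>\<^sub>M \<nu>) {p. snd p \<le> fst p}" and \<alpha>_pos: "0 < \<alpha>"
    and finite_int: "(\<integral>\<^sup>+z. 1 / ennreal (cdf \<nu> z) \<partial>\<mu>) < \<infinity>"
begin

abbreviation F :: "real \<Rightarrow> real" where "F \<equiv> cdf \<mu>"
abbreviation G :: "real \<Rightarrow> real" where "G \<equiv> cdf \<nu>"
definition S :: "real \<Rightarrow> real" where "S z = 1 - F z"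
definition observed :: "(real \<times> real) measure" where
  "observed = uniform_measure (\<mu> \<Otimes>\<^sub>M \<nu>) {p. snd p \<le> fst p}"
definition C :: "real \<Rightarrow> real" where "C z = G z * S z / \<alpha>"

sublocale XY: pair_prob_space \<mu> \<nu> ..

lemma F_measurable [measurable]: "F \<in> borel_measurable borel"
  by (rule borel_measurable_continuous_onI[OF cont_F])

lemma G_measurable [measurable]: "G \<in> borel_measurable borel"
  by (intro borel_measurable_mono monoI Y.cdf_nondecreasing)

lemma S_measurable [measurable]: "S \<in> borel_measurable borel"
  unfolding S_def[abs_def] by measurable

lemma C_measurable [measurable]: "C \<in> borel_measurable borel"
  unfolding C_def[abs_def] by measurable

lemma S_bounds: "0 \<le> S z" "S z \<le> 1"
  unfolding S_def using X.cdf_bounded_prob[of z] X.cdf_nonneg[of z] by auto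

lemma G_bounds: "0 \<le> G z" "G z \<le> 1"
  using Y.cdf_bounded_prob[of z] Y.cdf_nonneg[of z] by auto

lemma S_antimono: "z \<le> z' \<Longrightarrow> S z' \<le> S z"
  unfolding S_def using X.cdf_nondecreasing[of z z'] by simp

lemma C_nonneg: "0 \<le> C z"
  unfolding C_def using S_bounds G_bounds \<alpha>_pos by simp

lemma X_no_atom: "measure \<mu> {z} = 0"
  using cont_F X.isCont_cdf[of z] by (simp add: continuous_on_eq_continuous_at)

lemma order_set [measurable, simp]:
  "{p. snd p \<le> fst p} \<in> sets (borel \<Otimes>\<^sub>M borel :: (real \<times> real) measure)"
proof -
  have "{p \<in> space (borel \<Otimes>\<^sub>M borel :: (real \<times> real) measure). snd p \<le> fst p} \<in> sets (borel \<Otimes>\<^sub>M borel)"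
    by measurable
  then show ?thesis by (simp add: space_pair_measure)
qed

lemma sets_XY [measurable_cong, simp]: "sets (\<mu> \<Otimes>\<^sub>M \<nu>) = sets (borel \<Otimes>\<^sub>M borel)"
  by (rule sets_pair_measure_cong) simp_all

lemma emeasure_order_set: "emeasure (\<mu> \<Otimes>\<^sub>M \<nu>) {p. snd p \<le> fst p} = ennreal \<alpha>"
  unfolding \<alpha>_def by (simp add: XY.P.emeasure_eq_measure)

lemma sets_observed [measurable_cong, simp]: "sets observed = sets (borel \<Otimes>\<^sub>M borel)"
  unfolding observed_def by (simp cong: sets_pair_measure_cong)

lemma space_observed [simp]: "space observed = UNIV"
  unfolding observed_def by (simp add: space_pair_measure)

lemma nn_integral_observed:
  assumes [measurable]: "f \<in> borel_measurable (borel \<Otimes>\<^sub>M borel)"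
  shows "(\<integral>\<^sup>+p. f p \<partial>observed) = (\<integral>\<^sup>+x. (\<integral>\<^sup>+y. f (x, y) * indicator {..x} y \<partial>\<nu>) \<partial>\<mu>) / ennreal \<alpha>"
proof -
  have f: "f \<in> borel_measurable (\<mu> \<Otimes>\<^sub>M \<nu>)" by (simp cong: measurable_cong_sets sets_pair_measure_cong)
  have "(\<integral>\<^sup>+p. f p \<partial>observed) = (\<integral>\<^sup>+p. f p * indicator {p. snd p \<le> fst p} p \<partial>(\<mu> \<Otimes>\<^sub>M \<nu>)) / ennreal \<alpha>"
    unfolding observed_def using f by (subst nn_integral_uniform_measure) (auto simp: emeasure_order_set)
  also have "(\<integral>\<^sup>+p. f p * indicator {p. snd p \<le> fst p} p \<partial>(\<mu> \<Otimes>\<^sub>M \<nu>))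
     = (\<integral>\<^sup>+x. (\<integral>\<^sup>+y. f (x, y) * indicator {p. snd p \<le> fst p} (x, y) \<partial>\<nu>) \<partial>\<mu>)"
    using f by (intro Y.nn_integral_fst[symmetric]) simp
  also have "\<dots> = (\<integral>\<^sup>+x. (\<integral>\<^sup>+y. f (x, y) * indicator {..x} y \<partial>\<nu>) \<partial>\<mu>)"
    by (intro nn_integral_cong) (auto simp: indicator_def)
  finally show ?thesis .
qed

lemma prob_space_observed: "prob_space observed"
  unfolding observed_def
  by (rule prob_space_uniform_measure) (auto simp: emeasure_order_set \<alpha>_pos ennreal_eq_0_iff not_le)

sublocale P: prob_space observed
  by (rule prob_space_observed)

text \<open>
  A lifetime \<open>z\<close> is observed with probability \<open>G z\<close>, which makes \<open>G / \<alpha>\<close> the density of the observed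
  lifetimes.
\<close>

lemma nn_integral_observed_fst:
  assumes [measurable]: "h \<in> borel_measurable borel"
  shows "(\<integral>\<^sup>+p. h (fst p) \<partial>observed) = (\<integral>\<^sup>+z. h z * ennreal (G z / \<alpha>) \<partial>\<mu>)"
proof -
  have "(\<integral>\<^sup>+p. h (fst p) \<partial>observed) = (\<integral>\<^sup>+x. (\<integral>\<^sup>+y. h x * indicator {..x} y \<partial>\<nu>) \<partial>\<mu>) / ennreal \<alpha>"
    by (subst nn_integral_observed) auto
  also have "\<dots> = (\<integral>\<^sup>+x. h x * ennreal (G x) \<partial>\<mu>) / ennreal \<alpha>"
    by (simp add: nn_integral_cmult Y.emeasure_eq_measure cdf_def)
  also have "\<dots> = (\<integral>\<^sup>+x. h x * ennreal (G x) / ennreal \<alpha> \<partial>\<mu>)"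
    by (subst nn_integral_divide) auto
  also have "\<dots> = (\<integral>\<^sup>+z. h z * ennreal (G z / \<alpha>) \<partial>\<mu>)"
    using \<alpha>_pos G_bounds by (intro nn_integral_cong) (simp add: divide_ennreal[symmetric] ennreal_times_divide)
  finally show ?thesis .
qed

lemma AE_G_pos: "AE z in \<mu>. 0 < G z"
proof -
  have "AE z in \<mu>. 1 / ennreal (G z) \<noteq> \<infinity>"
    using finite_int by (intro nn_integral_PInf_AE) auto
  then show ?thesis
    by eventually_elim (use G_bounds in \<open>auto simp: ennreal_divide_eq_top_iff less_le\<close>)
qed

lemma AE_S_pos: "AE z in \<mu>. 0 < S z"
proof -
  define B where "B = {z. 1 \<le> F z \<and> F z \<le> 1}"
  have "measure \<mu> B \<le> 0" using X.prob_cdf_between[OF cont_F, of 1 1] unfolding B_def by simp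
  moreover have "B \<in> sets borel" unfolding B_def by measurable
  ultimately have "B \<in> null_sets \<mu>" by (simp add: null_sets_def X.emeasure_eq_measure measure_le_0_iff)
  from AE_not_in[OF this] show ?thesis
    by eventually_elim (use X.cdf_bounded_prob in \<open>force simp: B_def S_def less_le\<close>)
qed

lemma AE_observed_fst:
  assumes "AE z in \<mu>. Q z" and [measurable]: "{z. Q z} \<in> sets borel"
  shows "AE p in observed. Q (fst p)"
proof -
  have [measurable]: "{z. \<not> Q z} \<in> sets borel"
    using borel_comp[OF assms(2)] by (simp add: Compl_eq)
  have "(\<integral>\<^sup>+p. indicator {z. \<not> Q z} (fst p) \<partial>observed) = (\<integral>\<^sup>+z. indicator {z. \<not> Q z} z * ennreal (G z / \<alpha>) \<partial>\<mu>)"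
    by (rule nn_integral_observed_fst) simp
  also have "\<dots> = (\<integral>\<^sup>+z. 0 \<partial>\<mu>)"
    using assms(1) by (intro nn_integral_cong_AE) (auto elim!: eventually_mono simp: indicator_def)
  finally have "(\<integral>\<^sup>+p. indicator {z. \<not> Q z} (fst p) \<partial>observed) = 0" by simp
  then have "AE p in observed. (indicator {z. \<not> Q z} (fst p) :: ennreal) = 0"
    by (subst (asm) nn_integral_0_iff_AE) auto
  then show ?thesis by eventually_elim (auto simp: indicator_def split: if_splits)
qed

lemma AE_observed_C_pos: "AE p in observed. 0 < C (fst p)"
proof -
  have "AE z in \<mu>. 0 < C z"
    using AE_G_pos AE_S_pos by eventually_elim (simp add: C_def \<alpha>_pos)
  then show ?thesis by (rule AE_observed_fst) measurable
qed

lemma AE_observed_ordered: "AE p in observed. snd p \<le> fst p"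
  unfolding observed_def
  by (subst AE_uniform_measure) (auto simp: emeasure_order_set \<alpha>_pos ennreal_eq_0_iff not_le)

lemma continuous_cdf_observed: "continuous_on UNIV (cdf (distr observed borel fst))"
proof -
  interpret K: real_distribution "distr observed borel fst" by (rule P.real_distribution_distr) simp
  have "isCont (cdf (distr observed borel fst)) x" for x
  proof -
    have "AE z in \<mu>. z \<noteq> x"
      by (rule AE_I'[of "{x}"]) (auto simp: null_sets_def X.emeasure_eq_measure X_no_atom)
    then have "AE p in observed. fst p \<noteq> x" by (rule AE_observed_fst) measurable
    then have "measure observed {p \<in> space observed. fst p = x} = 0"
    proof (subst P.prob_eq_0)
      show "{p \<in> space observed. fst p = x} \<in> sets observed" by measurable
    qed auto
    moreover have "measure (distr observed borel fst) {x} = measure observed {p \<in> space observed. fst p = x}"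
      by (subst measure_distr) (auto intro!: arg_cong[of _ _ "measure observed"])
    ultimately show ?thesis by (simp add: K.isCont_cdf)
  qed
  then show ?thesis by (simp add: continuous_on_eq_continuous_at)
qed

lemma integral_risk_observed: "(\<integral>q. risk z q \<partial>observed) = C z"
proof -
  have "(\<integral>\<^sup>+q. ennreal (risk z q) \<partial>observed) = (\<integral>\<^sup>+x. (\<integral>\<^sup>+y. ennreal (risk z (x, y)) * indicator {..x} y \<partial>\<nu>) \<partial>\<mu>) / ennreal \<alpha>"
    by (rule nn_integral_observed) simp
  also have "\<dots> = (\<integral>\<^sup>+x. (\<integral>\<^sup>+y. indicator {z..} x * indicator {..z} y \<partial>\<nu>) \<partial>\<mu>) / ennreal \<alpha>"
    by (intro arg_cong2[of _ _ _ _ divide] nn_integral_cong) (auto simp: indicator_def risk_def)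
  also have "\<dots> = (\<integral>\<^sup>+x. indicator {z..} x * ennreal (G z) \<partial>\<mu>) / ennreal \<alpha>"
    by (simp add: nn_integral_cmult Y.emeasure_eq_measure cdf_def)
  also have "\<dots> = ennreal (measure \<mu> {z..}) * ennreal (G z) / ennreal \<alpha>"
    by (simp add: nn_integral_multc X.emeasure_eq_measure)
  also have "measure \<mu> {z..} = S z"
  proof -
    have "measure \<mu> {z..} = measure \<mu> (insert z (space \<mu> - {..z}))"
      by (rule arg_cong[of _ _ "measure \<mu>"]) auto
    also have "\<dots> = measure \<mu> {z} + measure \<mu> (space \<mu> - {..z})"
      using X.finite_measure_Union[of "{z}" "space \<mu> - {..z}"] by simp
    also have "\<dots> = S z"
      using X.prob_compl[of "{..z}"] by (simp add: X_no_atom S_def cdf_def)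
    finally show ?thesis .
  qed
  also have "ennreal (S z) * ennreal (G z) / ennreal \<alpha> = ennreal (C z)"
    using S_bounds G_bounds \<alpha>_pos by (simp add: C_def ennreal_mult[symmetric] divide_ennreal mult.commute)
  finally have "(\<integral>\<^sup>+q. ennreal (risk z q) \<partial>observed) = ennreal (C z)" .
  then show ?thesis
    using C_nonneg by (subst integral_eq_nn_integral) (auto simp: risk_bounds)
qed

subsection \<open>Integrals of inverse powers\<close>

text \<open>
  All moment bounds go back to the integral of \<open>1 / (G * S powr (3/4))\<close>, which is finite: to the left
  of a point where \<open>G\<close> and \<open>S\<close> are positive, \<open>S\<close> is bounded away from \<open>0\<close> and \<open>1 / G\<close> is integrable;
  to its right \<open>G\<close> is bounded away from \<open>0\<close>, and \<open>S powr (-3/4)\<close> is integrable because \<open>S\<close> is uniformly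
  distributed.
\<close>

definition K :: real where "K = (\<integral>z. 1 / (G z * S z powr (3/4)) \<partial>\<mu>)"

lemma K_finite: "(\<integral>\<^sup>+z. ennreal (1 / (G z * S z powr (3/4))) \<partial>\<mu>) = ennreal K" "0 \<le> K"
proof -
  obtain m where m: "0 < G m" "0 < S m"
  proof -
    have AE: "AE z in \<mu>. 0 < G z \<and> 0 < S z" using AE_G_pos AE_S_pos by eventually_elim simp
    have "\<exists>z. 0 < G z \<and> 0 < S z"
    proof (rule ccontr)
      assume no: "\<nexists>z. 0 < G z \<and> 0 < S z"
      from AE have "AE z in \<mu>. False" by eventually_elim (use no in blast)
      then show False using X.AE_False by blast
    qed
    then show thesis using that by blast
  qed
  define c1 c2 where "c1 = 1 / (S m powr (3/4))" and "c2 = 1 / G m"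
  have c: "0 \<le> c1" "0 \<le> c2" unfolding c1_def c2_def using m by auto
  have le: "ennreal (1 / (G z * S z powr (3/4))) \<le> ennreal c1 * (1 / ennreal (G z)) + ennreal c2 * ennreal (S z powr - (3/4))"
    if z: "0 < G z" "0 < S z" for z
  proof (cases "z \<le> m")
    case True
    have "S m powr (3/4) \<le> S z powr (3/4)"
      using S_antimono[OF True] m by (intro powr_mono2) auto
    then have "1 / (G z * S z powr (3/4)) \<le> c1 * (1 / G z)"
      unfolding c1_def using z m by (auto intro!: divide_left_mono mult_left_mono mult_pos_pos simp: mult.commute)
    then have "ennreal (1 / (G z * S z powr (3/4))) \<le> ennreal (c1 * (1 / G z))" by (rule ennreal_leI)
    also have "\<dots> = ennreal c1 * (1 / ennreal (G z))"
      using c z by (simp add: ennreal_mult divide_ennreal[symmetric] ennreal_times_divide)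
    finally show ?thesis by (meson add_increasing2 zero_le order_trans le_iff_add)
  next
    case False
    then have "G m \<le> G z" using Y.cdf_nondecreasing[of m z] by simp
    then have "1 / (G z * S z powr (3/4)) \<le> c2 * (1 / S z powr (3/4))"
      unfolding c2_def using z m by (auto intro!: divide_left_mono mult_right_mono mult_pos_pos)
    also have "1 / S z powr (3/4) = S z powr - (3/4)" by (simp add: powr_minus_divide)
    finally have "ennreal (1 / (G z * S z powr (3/4))) \<le> ennreal (c2 * S z powr - (3/4))" by (rule ennreal_leI)
    also have "\<dots> = ennreal c2 * ennreal (S z powr - (3/4))" using c by (simp add: ennreal_mult)
    finally show ?thesis by (meson add_increasing zero_le order_trans le_iff_add)
  qed
  have "(\<integral>\<^sup>+z. ennreal (1 / (G z * S z powr (3/4))) \<partial>\<mu>)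
     \<le> (\<integral>\<^sup>+z. ennreal c1 * (1 / ennreal (G z)) + ennreal c2 * ennreal (S z powr - (3/4)) \<partial>\<mu>)"
  proof (rule nn_integral_mono_AE)
    show "AE z in \<mu>. ennreal (1 / (G z * S z powr (3/4)))
        \<le> ennreal c1 * (1 / ennreal (G z)) + ennreal c2 * ennreal (S z powr - (3/4))"
      using AE_G_pos AE_S_pos by eventually_elim (rule le)
  qed
  also have "\<dots> = ennreal c1 * (\<integral>\<^sup>+z. 1 / ennreal (G z) \<partial>\<mu>) + ennreal c2 * (\<integral>\<^sup>+z. ennreal (S z powr - (3/4)) \<partial>\<mu>)"
    by (simp add: nn_integral_add nn_integral_cmult)
  also have "\<dots> < \<infinity>"
    using finite_int X.integrable_survival_powr[OF cont_F, of "- (3/4)"]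
    unfolding S_def by (simp add: ennreal_mult_less_top)
  finally have fin: "(\<integral>\<^sup>+z. ennreal (1 / (G z * S z powr (3/4))) \<partial>\<mu>) < \<infinity>" .
  then have "integrable \<mu> (\<lambda>z. 1 / (G z * S z powr (3/4)))"
    using G_bounds by (intro integrableI_nonneg) auto
  then show "(\<integral>\<^sup>+z. ennreal (1 / (G z * S z powr (3/4))) \<partial>\<mu>) = ennreal K"
    unfolding K_def using G_bounds by (intro nn_integral_eq_integral) auto
  show "0 \<le> K" unfolding K_def using G_bounds by (intro integral_nonneg_AE) auto
qed

text \<open>The factor \<open>G / \<alpha>\<close> in the hypothesis comes from passing to the distribution of \<open>X\<close>.\<close>

lemma observed_integral_le_K:
  assumes [measurable]: "h \<in> borel_measurable borel" and c: "0 \<le> c"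
    and le: "\<And>z. 0 < G z \<Longrightarrow> 0 < S z \<Longrightarrow> h z * (G z / \<alpha>) \<le> c / (G z * S z powr (3/4))"
  shows "(\<integral>\<^sup>+p. ennreal (h (fst p)) \<partial>observed) \<le> ennreal (c * K)"
proof -
  have "(\<integral>\<^sup>+p. ennreal (h (fst p)) \<partial>observed) = (\<integral>\<^sup>+z. ennreal (h z) * ennreal (G z / \<alpha>) \<partial>\<mu>)"
    by (rule nn_integral_observed_fst) simp
  also have "\<dots> \<le> (\<integral>\<^sup>+z. ennreal c * ennreal (1 / (G z * S z powr (3/4))) \<partial>\<mu>)"
  proof (rule nn_integral_mono_AE)
    show "AE z in \<mu>. ennreal (h z) * ennreal (G z / \<alpha>) \<le> ennreal c * ennreal (1 / (G z * S z powr (3/4)))"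
      using AE_G_pos AE_S_pos
    proof eventually_elim
      case (elim z)
      have "ennreal (h z) * ennreal (G z / \<alpha>) = ennreal (h z * (G z / \<alpha>))"
        using elim \<alpha>_pos by (intro ennreal_mult''[symmetric]) auto
      also have "\<dots> \<le> ennreal (c / (G z * S z powr (3/4)))" by (rule ennreal_leI[OF le[OF elim]])
      also have "\<dots> = ennreal c * ennreal (1 / (G z * S z powr (3/4)))"
        using c elim by (simp add: ennreal_mult[symmetric])
      finally show ?case .
    qed
  qed
  also have "\<dots> = ennreal (c * K)"
    using c K_finite by (simp add: nn_integral_cmult ennreal_mult)
  finally show ?thesis .
qed

text \<open>
  Up to \<open>b\<close> the survival function is at least \<open>s\<close>, so every power of \<open>1 / S\<close> beyond \<open>3/4\<close> costs the
  same power of \<open>1 / s\<close>.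
\<close>

lemma
  assumes b: "S b = s" and s: "0 < s"
  shows integral_S_div_C2: "(\<integral>\<^sup>+p. ennreal (indicator {..b} (fst p) * S (fst p) / (C (fst p))\<^sup>2) \<partial>observed)
      \<le> ennreal (\<alpha> * s powr (- 1/4) * K)"
    and integral_inverse_C2: "(\<integral>\<^sup>+p. ennreal (indicator {..b} (fst p) / (C (fst p))\<^sup>2) \<partial>observed)
      \<le> ennreal (\<alpha> * s powr (- 5/4) * K)"
    and integral_sqrt_S_div_C: "(\<integral>\<^sup>+p. ennreal (indicator {..b} (fst p) * sqrt (S (fst p)) / (C (fst p))\<^sup>2 * sqrt (C (fst p))) \<partial>observed)
      \<le> ennreal (sqrt \<alpha> * s powr (- 1/4) * K)"
proof -
  have mono: "S z powr (-a) \<le> s powr (-a)" if "z \<le> b" "0 \<le> a" for z a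
    using S_antimono[OF that(1)] s that unfolding b by (intro powr_mono2') auto
  have S34: "S z powr (3/4) \<noteq> 0" if "0 < S z" for z using that by simp
  show "(\<integral>\<^sup>+p. ennreal (indicator {..b} (fst p) * S (fst p) / (C (fst p))\<^sup>2) \<partial>observed)
      \<le> ennreal (\<alpha> * s powr (- 1/4) * K)"
  proof (rule observed_integral_le_K)
    fix z assume z: "0 < G z" "0 < S z"
    show "indicator {..b} z * S z / (C z)\<^sup>2 * (G z / \<alpha>) \<le> \<alpha> * s powr (- 1/4) / (G z * S z powr (3/4))"
    proof (cases "z \<le> b")
      case True
      have "S z powr (3/4) * S z powr (1/4) = S z" using z by (simp flip: powr_add)
      then have "1 / S z = S z powr (- (1/4)) / S z powr (3/4)" using z by (simp add: powr_minus field_simps)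
      also have "\<dots> \<le> s powr (- (1/4)) / S z powr (3/4)" using mono[OF True, of "1/4"] by (intro divide_right_mono) auto
      finally have le: "1 / S z \<le> s powr (- 1/4) / S z powr (3/4)" by simp
      have "indicator {..b} z * S z / (C z)\<^sup>2 * (G z / \<alpha>) = \<alpha> / G z * (1 / S z)"
        using z \<alpha>_pos True by (simp add: C_def power2_eq_square field_simps)
      also have "\<dots> \<le> \<alpha> / G z * (s powr (- 1/4) / S z powr (3/4))"
        using z \<alpha>_pos by (intro mult_left_mono le) auto
      finally show ?thesis by simp
    next
      case False
      then show ?thesis using z \<alpha>_pos by simp
    qed
  qed (use \<alpha>_pos s in auto)
  show "(\<integral>\<^sup>+p. ennreal (indicator {..b} (fst p) / (C (fst p))\<^sup>2) \<partial>observed)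
      \<le> ennreal (\<alpha> * s powr (- 5/4) * K)"
  proof (rule observed_integral_le_K)
    fix z assume z: "0 < G z" "0 < S z"
    show "indicator {..b} z / (C z)\<^sup>2 * (G z / \<alpha>) \<le> \<alpha> * s powr (- 5/4) / (G z * S z powr (3/4))"
    proof (cases "z \<le> b")
      case True
      have "S z powr (3/4) * S z powr (5/4) = S z powr 2" by (simp flip: powr_add)
      also have "\<dots> = (S z)\<^sup>2" using z by simp
      finally have "1 / (S z)\<^sup>2 = S z powr (- (5/4)) / S z powr (3/4)" using z by (simp add: powr_minus field_simps)
      also have "\<dots> \<le> s powr (- (5/4)) / S z powr (3/4)" using mono[OF True, of "5/4"] by (intro divide_right_mono) auto
      finally have le: "1 / (S z)\<^sup>2 \<le> s powr (- 5/4) / S z powr (3/4)" by simp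
      have "indicator {..b} z / (C z)\<^sup>2 * (G z / \<alpha>) = \<alpha> / G z * (1 / (S z)\<^sup>2)"
        using z \<alpha>_pos True by (simp add: C_def power2_eq_square field_simps)
      also have "\<dots> \<le> \<alpha> / G z * (s powr (- 5/4) / S z powr (3/4))"
        using z \<alpha>_pos by (intro mult_left_mono le) auto
      finally show ?thesis by simp
    next
      case False
      then show ?thesis using z \<alpha>_pos by simp
    qed
  qed (use \<alpha>_pos s in auto)
  show "(\<integral>\<^sup>+p. ennreal (indicator {..b} (fst p) * sqrt (S (fst p)) / (C (fst p))\<^sup>2 * sqrt (C (fst p))) \<partial>observed)
      \<le> ennreal (sqrt \<alpha> * s powr (- 1/4) * K)"
  proof (rule observed_integral_le_K)
    fix z assume z: "0 < G z" "0 < S z"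
    show "indicator {..b} z * sqrt (S z) / (C z)\<^sup>2 * sqrt (C z) * (G z / \<alpha>) \<le> sqrt \<alpha> * s powr (- 1/4) / (G z * S z powr (3/4))"
    proof (cases "z \<le> b")
      case True
      have "S z powr (3/4) * S z powr (1/4) = S z" using z by (simp flip: powr_add)
      then have "1 / S z = S z powr (- (1/4)) / S z powr (3/4)" using z by (simp add: powr_minus field_simps)
      also have "\<dots> \<le> s powr (- (1/4)) / S z powr (3/4)" using mono[OF True, of "1/4"] by (intro divide_right_mono) auto
      finally have le: "1 / S z \<le> s powr (- 1/4) / S z powr (3/4)" by simp
      define g r a where "g = sqrt (G z)" and "r = sqrt (S z)" and "a = sqrt \<alpha>"
      have gra: "0 < g" "0 < r" "0 < a" "G z = g * g" "S z = r * r" "\<alpha> = a * a"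
        unfolding g_def r_def a_def using z \<alpha>_pos by auto
      have g1: "g \<le> 1" unfolding g_def using G_bounds by simp
      have Cz: "C z = (g * g) * (r * r) / (a * a)" unfolding C_def unfolding gra(4-6) ..
    have sC: "sqrt (C z) = g * r / a"
        unfolding C_def g_def r_def a_def by (simp add: real_sqrt_mult real_sqrt_divide)
      have "indicator {..b} z * sqrt (S z) / (C z)\<^sup>2 * sqrt (C z) * (G z / \<alpha>) = a / g * (1 / (r * r))"
        unfolding sC unfolding Cz unfolding r_def[symmetric] gra(4,6) using gra(1-3) True
        by (simp add: power2_eq_square field_simps)
      also have "\<dots> \<le> a / (g * g) * (1 / (r * r))"
        using gra(1-3) g1 by (intro mult_right_mono divide_left_mono) auto
      also have "\<dots> = sqrt \<alpha> / G z * (1 / S z)" using gra(4,5) a_def by simp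
      also have "\<dots> \<le> sqrt \<alpha> / G z * (s powr (- 1/4) / S z powr (3/4))"
        using z \<alpha>_pos by (intro mult_left_mono le) auto
      finally show ?thesis by simp
    next
      case False
      then show ?thesis using z \<alpha>_pos by simp
    qed
  qed (use \<alpha>_pos s in auto)
qed

text \<open>
  The integrand \<open>S * C powr (-3/2)\<close> is the order of \<open>sqrt n * S * \<bar>C\<^sub>n - C\<bar> / C\<^sup>2\<close>. It is integrable and
  \<open>C\<close> is positive almost surely, so dominated convergence applies.
\<close>

lemma integral_small_C:
  assumes \<epsilon>: "0 < \<epsilon>"
  shows "\<exists>c>0. (\<integral>\<^sup>+p. ennreal (of_bool (C (fst p) < c) * S (fst p) / (C (fst p))\<^sup>2 * sqrt (C (fst p))) \<partial>observed) \<le> ennreal \<epsilon>"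
proof -
  define f where "f k z = of_bool (C z < 1 / real (Suc k)) * S z / (C z)\<^sup>2 * sqrt (C z)" for k z
  have [measurable]: "f k \<in> borel_measurable borel" for k unfolding f_def by measurable
  have f0: "0 \<le> f k z" for k z unfolding f_def using S_bounds C_nonneg by auto
  have bound: "S z / (C z)\<^sup>2 * sqrt (C z) * (G z / \<alpha>) \<le> sqrt \<alpha> / (G z * S z powr (3/4))"
    if z: "0 < G z" "0 < S z" for z
  proof -
    define g r a where "g = sqrt (G z)" and "r = sqrt (S z)" and "a = sqrt \<alpha>"
    have gra: "0 < g" "0 < r" "0 < a" "G z = g * g" "S z = r * r" "\<alpha> = a * a"
      unfolding g_def r_def a_def using z \<alpha>_pos by auto
    have g1: "g \<le> 1" unfolding g_def using G_bounds by simp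
    have Cz: "C z = (g * g) * (r * r) / (a * a)" unfolding C_def unfolding gra(4-6) ..
    have sC: "sqrt (C z) = g * r / a"
      unfolding C_def g_def r_def a_def by (simp add: real_sqrt_mult real_sqrt_divide)
    have r: "r = S z powr (1/2)" unfolding r_def using z by (simp add: powr_half_sqrt)
    have "S z powr (3/4) \<le> S z powr (1/2)" using z S_bounds by (intro powr_mono') auto
    then have r1: "1 / r \<le> 1 / S z powr (3/4)" unfolding r using z by (intro divide_left_mono) auto
    have "S z / (C z)\<^sup>2 * sqrt (C z) * (G z / \<alpha>) = a / g * (1 / r)"
      unfolding sC unfolding Cz unfolding gra(4-6) using gra(1-3)
      by (simp add: power2_eq_square field_simps)
    also have "\<dots> \<le> a / (g * g) * (1 / S z powr (3/4))"
      using gra(1-3) g1 z by (intro mult_mono divide_left_mono r1) auto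
    finally show ?thesis using gra(4) a_def by simp
  qed
  have "(\<lambda>k. \<integral>\<^sup>+p. ennreal (f k (fst p)) \<partial>observed) \<longlonglongrightarrow> (\<integral>\<^sup>+p. 0 \<partial>observed)"
  proof (rule nn_integral_dominated_convergence)
    show "(\<integral>\<^sup>+p. ennreal (S (fst p) / (C (fst p))\<^sup>2 * sqrt (C (fst p))) \<partial>observed) < \<infinity>"
      by (rule le_less_trans[OF observed_integral_le_K[of _ "sqrt \<alpha>"]]) (use bound \<alpha>_pos in auto)
    show "AE p in observed. ennreal (f k (fst p)) \<le> ennreal (S (fst p) / (C (fst p))\<^sup>2 * sqrt (C (fst p)))" for k
      using S_bounds C_nonneg by (intro AE_I2 ennreal_leI) (auto simp: f_def)
    show "AE p in observed. (\<lambda>k. ennreal (f k (fst p))) \<longlonglongrightarrow> 0"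
      using AE_observed_C_pos
    proof eventually_elim
      case (elim p)
      have "\<forall>\<^sub>F k in sequentially. 1 / real (Suc k) < C (fst p)"
        using LIMSEQ_inverse_real_of_nat elim by (intro order_tendstoD(2)[of _ 0]) (auto simp: inverse_eq_divide)
      then have "\<forall>\<^sub>F k in sequentially. ennreal (f k (fst p)) = 0"
        by eventually_elim (simp add: f_def)
      then show ?case by (rule tendsto_eventually)
    qed
  qed auto
  then have "\<forall>\<^sub>F k in sequentially. (\<integral>\<^sup>+p. ennreal (f k (fst p)) \<partial>observed) < ennreal \<epsilon>"
    using \<epsilon> by (intro order_tendstoD(2)) auto
  then obtain k where "(\<integral>\<^sup>+p. ennreal (f k (fst p)) \<partial>observed) < ennreal \<epsilon>"
    by (auto dest: eventually_happens)
  then show ?thesis unfolding f_def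
    by (intro exI[of _ "1 / real (Suc k)"]) auto
qed

lemma integral_S_div_C_beyond:
  "(\<integral>\<^sup>+p. ennreal (indicator {b<..} (fst p) * S (fst p) / C (fst p)) \<partial>observed) = ennreal (S b)"
proof -
  have "(\<integral>\<^sup>+p. ennreal (indicator {b<..} (fst p) * S (fst p) / C (fst p)) \<partial>observed)
     = (\<integral>\<^sup>+z. ennreal (indicator {b<..} z * S z / C z) * ennreal (G z / \<alpha>) \<partial>\<mu>)"
    by (rule nn_integral_observed_fst) simp
  also have "\<dots> = (\<integral>\<^sup>+z. indicator {b<..} z \<partial>\<mu>)"
  proof (rule nn_integral_cong_AE)
    show "AE z in \<mu>. ennreal (indicator {b<..} z * S z / C z) * ennreal (G z / \<alpha>) = indicator {b<..} z"
      using AE_G_pos AE_S_pos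
    proof eventually_elim
      case (elim z)
      have "ennreal (indicator {b<..} z * S z / C z) * ennreal (G z / \<alpha>) = ennreal (indicator {b<..} z * S z / C z * (G z / \<alpha>))"
        using elim \<alpha>_pos by (intro ennreal_mult''[symmetric]) auto
      also have "indicator {b<..} z * S z / C z * (G z / \<alpha>) = indicator {b<..} z"
        using elim \<alpha>_pos by (simp add: C_def)
      finally show ?case by (simp add: ennreal_indicator)
    qed
  qed
  also have "\<dots> = ennreal (measure \<mu> (space \<mu> - {..b}))"
  proof -
    have "{b<..} = space \<mu> - {..b}" by auto
    then show ?thesis by (simp add: X.emeasure_eq_measure)
  qed
  also have "measure \<mu> (space \<mu> - {..b}) = S b"
    using X.prob_compl[of "{..b}"] by (simp add: S_def cdf_def)
  finally show ?thesis .
qed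

lemma integral_hazard:
  assumes "0 < S x"
  shows "(\<integral>\<^sup>+p. ennreal (indicator {..x} (fst p) / C (fst p)) \<partial>observed) = ennreal (- ln (S x))"
proof -
  have "(\<integral>\<^sup>+p. ennreal (indicator {..x} (fst p) / C (fst p)) \<partial>observed)
     = (\<integral>\<^sup>+z. ennreal (indicator {..x} z / C z) * ennreal (G z / \<alpha>) \<partial>\<mu>)"
    by (rule nn_integral_observed_fst) simp
  also have "\<dots> = (\<integral>\<^sup>+z. ennreal (1 / (1 - F z)) * indicator {..x} z \<partial>\<mu>)"
  proof (rule nn_integral_cong_AE)
    show "AE z in \<mu>. ennreal (indicator {..x} z / C z) * ennreal (G z / \<alpha>) = ennreal (1 / (1 - F z)) * indicator {..x} z"
      using AE_G_pos AE_S_pos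
    proof eventually_elim
      case (elim z)
      have "ennreal (indicator {..x} z / C z) * ennreal (G z / \<alpha>) = ennreal (indicator {..x} z / C z * (G z / \<alpha>))"
        using elim \<alpha>_pos by (intro ennreal_mult''[symmetric]) auto
      also have "indicator {..x} z / C z * (G z / \<alpha>) = indicator {..x} z / S z"
        using elim \<alpha>_pos by (simp add: C_def)
      finally show ?case by (auto simp: S_def indicator_def)
    qed
  qed
  also have "\<dots> = ennreal (- ln (1 - F x))"
    using assms by (intro X.nn_integral_hazard cont_F) (simp add: S_def)
  finally show ?thesis by (simp add: S_def)
qed

end

section \<open>Samples from the left-truncation model\<close>

lemma sum_binomial_weights:
  fixes p :: real
  assumes "0 \<le> p" "p \<le> 1"
  shows "(\<Sum>k\<le>m. real (m choose k) * p ^ k * (1 - p) ^ (m - k)) = 1"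
    and "(\<Sum>k\<le>m. real (m choose k) * p ^ k * (1 - p) ^ (m - k) * real k) = m * p"
  using sum_Bernstein[of m p] sum_k_Bernstein[of m p]
  by (simp_all add: Bernstein_def mult_ac)

text \<open>All rates below are of this form, with \<open>\<eta> * n powr (-1/2)\<close> the survival probability at \<open>b n\<close>.\<close>

lemma rate_tendsto_0:
  fixes c a q \<eta> :: real
  assumes "0 < \<eta>" "a + q / 2 < 0"
  shows "(\<lambda>n. c * real n powr a * (\<eta> * real n powr (-1/2)) powr (-q)) \<longlonglongrightarrow> 0"
proof -
  have "(\<lambda>n. c * \<eta> powr (-q) * real n powr (a + q / 2)) \<longlonglongrightarrow> c * \<eta> powr (-q) * 0"
    using assms by (intro tendsto_mult tendsto_const tendsto_neg_powr filterlim_real_sequentially)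
  moreover have "c * \<eta> powr (-q) * real n powr (a + q / 2) = c * real n powr a * (\<eta> * real n powr (-1/2)) powr (-q)" for n
    using assms by (simp add: powr_mult powr_powr powr_add mult_ac)
  ultimately show ?thesis by simp
qed

lemma sqrt_div_eq_powr:
  assumes "0 < n"
  shows "sqrt (real n) / real n = real n powr (-1/2)"
proof -
  have "sqrt (real n) / real n = 1 / sqrt (real n)"
  proof -
    have "r / (r * r) = 1 / r" for r :: real by simp
    from this[of "sqrt (real n)"] show ?thesis by simp
  qed
  also have "\<dots> = real n powr (-1/2)"
    using powr_minus_divide[of "real n" "1/2"] by (simp add: powr_half_sqrt)
  finally show ?thesis .
qed

locale truncated_sample = truncation_model \<mu> \<nu> \<alpha> + iid_sample M observed Z
  for \<mu> \<nu> :: "real measure" and \<alpha> :: real and M :: "'a measure" and Z :: "nat \<Rightarrow> 'a \<Rightarrow> real \<times> real"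
begin

sublocale pair_sample M observed Z
  by unfold_locales (simp_all add: continuous_cdf_observed)

lemma risk_prob_eq [simp]: "risk_prob z = C z"
  by (simp add: risk_prob_def integral_risk_observed)

abbreviation X :: "nat \<Rightarrow> 'a \<Rightarrow> real" where "X i w \<equiv> fst (Z i w)"
abbreviation Cn :: "nat \<Rightarrow> 'a \<Rightarrow> real \<Rightarrow> real" where "Cn \<equiv> risk_freq"

lemma C_le_1: "C z \<le> 1"
  using risk_prob_bounds(2)[of z] by simp

lemma n_times_Cn: "0 < n \<Longrightarrow> real n * Cn n w z = (\<Sum>j<n. risk z (Z j w))"
  by (simp add: risk_freq_def)

lemma Cn_X_measurable [measurable]: "(\<lambda>w. Cn n w (X i w)) \<in> borel_measurable M"
  unfolding risk_freq_def by measurable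

lemma Cn_at_measurable [measurable]: "(\<lambda>w. Cn n w z) \<in> borel_measurable M"
  unfolding risk_freq_def by measurable

lemma Cn_fst_measurable [measurable]:
  "(\<lambda>(w, p). Cn n w (fst p)) \<in> borel_measurable (M \<Otimes>\<^sub>M observed)"
  unfolding risk_freq_def by measurable

text \<open>
  An observation belongs to its own risk set, as \<open>Y \<le> X\<close>, and each of the \<open>n - 1\<close> others belongs to the
  risk set at \<open>z\<close> with probability \<open>C z\<close>, independently.
\<close>

lemma nn_integral_risk_set:
  fixes \<phi> :: "real \<Rightarrow> real" and h :: "real \<Rightarrow> real \<Rightarrow> real"
  assumes [measurable]: "\<phi> \<in> borel_measurable borel" "(\<lambda>(c, t). h c t) \<in> borel_measurable (borel \<Otimes>\<^sub>M borel)"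
    and \<phi>: "\<And>z. 0 \<le> \<phi> z" and h: "\<And>c (k::nat). 0 \<le> h c (1 + real k)" and i: "i < n"
  shows "(\<integral>\<^sup>+w. ennreal (\<phi> (X i w) * h (C (X i w)) (n * Cn n w (X i w))) \<partial>M)
    = (\<integral>\<^sup>+p. ennreal (\<phi> (fst p) * (\<Sum>k\<le>n - 1. real (n - 1 choose k) * C (fst p) ^ k
        * (1 - C (fst p)) ^ (n - 1 - k) * h (C (fst p)) (1 + real k))) \<partial>observed)"
proof -
  define J where "J = {..<n} - {i}"
  have J: "finite J" "i \<notin> J" "card J = n - 1" "{..<n} = insert i J" unfolding J_def using i by auto
  have "(\<integral>\<^sup>+w. ennreal (\<phi> (X i w) * h (C (X i w)) (n * Cn n w (X i w))) \<partial>M)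
    = (\<integral>\<^sup>+w. ennreal (\<phi> (X i w) * h (C (X i w)) (1 + (\<Sum>j\<in>J. risk (X i w) (Z j w)))) \<partial>M)"
  proof (rule nn_integral_cong_AE)
    show "AE w in M. ennreal (\<phi> (X i w) * h (C (X i w)) (n * Cn n w (X i w)))
      = ennreal (\<phi> (X i w) * h (C (X i w)) (1 + (\<Sum>j\<in>J. risk (X i w) (Z j w))))"
      using AE_Z[OF AE_observed_ordered, of i]
    proof eventually_elim
      case (elim w)
      have "n * Cn n w (X i w) = (\<Sum>j<n. risk (X i w) (Z j w))"
        using i by (intro n_times_Cn) simp
      also have "\<dots> = 1 + (\<Sum>j\<in>J. risk (X i w) (Z j w))"
        unfolding J(4) using J(1,2) elim by (simp add: risk_def)
      finally show ?case by simp
    qed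
  qed
  also have "\<dots> = (\<integral>\<^sup>+p. (\<integral>\<^sup>+w. ennreal (\<phi> (fst p) * h (C (fst p)) (1 + (\<Sum>j\<in>J. risk (fst p) (Z j w)))) \<partial>M) \<partial>observed)"
    using J by (intro leave_one_out[of "\<lambda>p q. risk (fst p) q" "\<lambda>p t. ennreal (\<phi> (fst p) * h (C (fst p)) (1 + t))"]) auto
  also have "\<dots> = (\<integral>\<^sup>+p. ennreal (\<phi> (fst p) * (\<Sum>k\<le>n - 1. real (n - 1 choose k) * C (fst p) ^ k
        * (1 - C (fst p)) ^ (n - 1 - k) * h (C (fst p)) (1 + real k))) \<partial>observed)"
  proof (rule nn_integral_cong)
    fix p :: "real \<times> real"
    define z where "z = fst p"
    define A where "A = {q :: real \<times> real. snd q \<le> z \<and> z \<le> fst q}"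
    have "{q \<in> space observed. snd q \<le> z \<and> z \<le> fst q} \<in> sets observed" by measurable
    then have A[measurable]: "A \<in> sets observed" unfolding A_def by simp
    have risk_A: "risk z q = indicator A q" for q by (simp add: risk_def A_def indicator_def)
    have "measure observed A = (\<integral>q. risk z q \<partial>observed)" unfolding risk_A using A by simp
    then have mA: "measure observed A = C z" by (simp add: integral_risk_observed)
    have [measurable]: "(\<lambda>t. h (C z) (1 + t)) \<in> borel_measurable borel" by measurable
    have "(\<integral>\<^sup>+w. ennreal (\<phi> z * h (C z) (1 + (\<Sum>j\<in>J. risk z (Z j w)))) \<partial>M)
       = ennreal (\<phi> z) * (\<integral>\<^sup>+w. ennreal (h (C z) (1 + (\<Sum>j\<in>J. indicator A (Z j w)))) \<partial>M)"
      unfolding risk_A using \<phi> by (subst nn_integral_cmult[symmetric]) (auto simp: ennreal_mult')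
    also have "(\<integral>\<^sup>+w. ennreal (h (C z) (1 + (\<Sum>j\<in>J. indicator A (Z j w)))) \<partial>M)
       = ennreal (\<Sum>k\<le>n - 1. real (n - 1 choose k) * C z ^ k * (1 - C z) ^ (n - 1 - k) * h (C z) (1 + real k))"
      using nn_integral_count[OF A, of "\<lambda>t. h (C z) (1 + t)" J] h J by (simp add: mA)
    finally show "(\<integral>\<^sup>+w. ennreal (\<phi> (fst p) * h (C (fst p)) (1 + (\<Sum>j\<in>J. risk (fst p) (Z j w)))) \<partial>M)
      = ennreal (\<phi> (fst p) * (\<Sum>k\<le>n - 1. real (n - 1 choose k) * C (fst p) ^ k
        * (1 - C (fst p)) ^ (n - 1 - k) * h (C (fst p)) (1 + real k)))"
      using \<phi> by (simp add: z_def ennreal_mult')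
  qed
  finally show ?thesis .
qed

text \<open>Since \<open>1 / (1 + k)\<^sup>2 \<le> 2 / ((1 + k) * (2 + k))\<close>, the second inverse moment of the binomial law suffices.\<close>

lemma mean_inverse_risk_set_squared:
  fixes \<phi> :: "real \<Rightarrow> real"
  assumes [measurable]: "\<phi> \<in> borel_measurable borel" and \<phi>: "\<And>z. 0 \<le> \<phi> z" and i: "i < n"
  shows "(\<integral>\<^sup>+w. ennreal (\<phi> (X i w) / (n * Cn n w (X i w))\<^sup>2) \<partial>M)
    \<le> ennreal (2 / (real n)\<^sup>2) * (\<integral>\<^sup>+p. ennreal (\<phi> (fst p) / (C (fst p))\<^sup>2) \<partial>observed)"
proof -
  have "(\<integral>\<^sup>+w. ennreal (\<phi> (X i w) / (n * Cn n w (X i w))\<^sup>2) \<partial>M)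
    = (\<integral>\<^sup>+p. ennreal (\<phi> (fst p) * (\<Sum>k\<le>n - 1. real (n - 1 choose k) * C (fst p) ^ k
        * (1 - C (fst p)) ^ (n - 1 - k) * (1 / (1 + real k)\<^sup>2))) \<partial>observed)"
    using nn_integral_risk_set[of \<phi> "\<lambda>c t. 1 / t\<^sup>2", OF _ _ \<phi> _ i] by simp
  also have "\<dots> \<le> (\<integral>\<^sup>+p. ennreal (2 / (real n)\<^sup>2) * ennreal (\<phi> (fst p) / (C (fst p))\<^sup>2) \<partial>observed)"
  proof (rule nn_integral_mono_AE)
    show "AE p in observed. ennreal (\<phi> (fst p) * (\<Sum>k\<le>n - 1. real (n - 1 choose k) * C (fst p) ^ k
        * (1 - C (fst p)) ^ (n - 1 - k) * (1 / (1 + real k)\<^sup>2))) \<le> ennreal (2 / (real n)\<^sup>2) * ennreal (\<phi> (fst p) / (C (fst p))\<^sup>2)"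
      using AE_observed_C_pos
    proof eventually_elim
      case (elim p)
      define c m where "c = C (fst p)" and "m = n - 1"
      have c: "0 < c" "c \<le> 1" using elim C_le_1 unfolding c_def by auto
      have "(\<Sum>k\<le>m. real (m choose k) * c ^ k * (1 - c) ^ (m - k) * (1 / (1 + real k)\<^sup>2))
        \<le> (\<Sum>k\<le>m. 2 * (real (m choose k) * c ^ k * (1 - c) ^ (m - k) * (1 / ((1 + real k) * (2 + real k)))))"
      proof (intro sum_mono)
        fix k
        have "1 / (1 + real k)\<^sup>2 \<le> 2 * (1 / ((1 + real k) * (2 + real k)))"
        proof -
          have "1 / a\<^sup>2 \<le> 2 * (1 / (a * b))" if "0 < a" "0 < b" "b \<le> 2 * a" for a b :: real
            using that by (simp add: field_simps power2_eq_square)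
          then show ?thesis by simp
        qed
        then have "real (m choose k) * c ^ k * (1 - c) ^ (m - k) * (1 / (1 + real k)\<^sup>2)
          \<le> real (m choose k) * c ^ k * (1 - c) ^ (m - k) * (2 * (1 / ((1 + real k) * (2 + real k))))"
          using c by (intro mult_left_mono) auto
        then show "real (m choose k) * c ^ k * (1 - c) ^ (m - k) * (1 / (1 + real k)\<^sup>2)
          \<le> 2 * (real (m choose k) * c ^ k * (1 - c) ^ (m - k) * (1 / ((1 + real k) * (2 + real k))))"
          by (simp only: mult_ac)
      qed
      also have "\<dots> \<le> 2 * (1 / ((real m + 1) * (real m + 2) * c\<^sup>2))"
        unfolding sum_distrib_left[symmetric] by (intro mult_left_mono binomial_inverse_second_moment c) simp
      also have "\<dots> \<le> 2 * (1 / (real n ^ 2 * c\<^sup>2))"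
      proof -
        have "real n ^ 2 \<le> (real m + 1) * (real m + 2)"
          unfolding m_def using i by (simp add: of_nat_diff power2_eq_square algebra_simps)
        then show ?thesis using i c by (intro mult_left_mono divide_left_mono mult_right_mono) auto
      qed
      finally have "\<phi> (fst p) * (\<Sum>k\<le>m. real (m choose k) * c ^ k * (1 - c) ^ (m - k) * (1 / (1 + real k)\<^sup>2))
        \<le> \<phi> (fst p) * (2 * (1 / (real n ^ 2 * c\<^sup>2)))"
        using \<phi> by (intro mult_left_mono) auto
      also have "\<dots> = 2 / (real n)\<^sup>2 * (\<phi> (fst p) / c\<^sup>2)" by simp
      finally show ?case unfolding c_def m_def using \<phi> by (simp add: ennreal_mult[symmetric] ennreal_leI)
    qed
  qed
  also have "\<dots> = ennreal (2 / (real n)\<^sup>2) * (\<integral>\<^sup>+p. ennreal (\<phi> (fst p) / (C (fst p))\<^sup>2) \<partial>observed)"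
    by (rule nn_integral_cmult) simp
  finally show ?thesis .
qed

text \<open>
  Expanding the square, \<open>(c - c\<^sub>n)\<^sup>2 / c\<^sub>n = c\<^sub>n - 2 * c + c\<^sup>2 / c\<^sub>n\<close>, and the binomial inverse moment
  cancels everything but the contribution of the observation itself. This bound does not
  deteriorate where \<open>C\<close> is small, which is why integrability of \<open>1 / G\<close> suffices.
\<close>

lemma mean_relative_square_error:
  fixes \<phi> :: "real \<Rightarrow> real"
  assumes [measurable]: "\<phi> \<in> borel_measurable borel" and \<phi>: "\<And>z. 0 \<le> \<phi> z" and i: "i < n"
  shows "(\<integral>\<^sup>+w. ennreal (\<phi> (X i w) * ((C (X i w) - Cn n w (X i w))\<^sup>2 / Cn n w (X i w))) \<partial>M)
    \<le> ennreal (1 / n) * (\<integral>\<^sup>+p. ennreal (\<phi> (fst p)) \<partial>observed)"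
proof -
  define h where "h c t = (c - t / n)\<^sup>2 / (t / n)" for c t :: real
  have [measurable]: "(\<lambda>(c, t). h c t) \<in> borel_measurable (borel \<Otimes>\<^sub>M borel)" unfolding h_def by measurable
  have "(\<integral>\<^sup>+w. ennreal (\<phi> (X i w) * ((C (X i w) - Cn n w (X i w))\<^sup>2 / Cn n w (X i w))) \<partial>M)
     = (\<integral>\<^sup>+w. ennreal (\<phi> (X i w) * h (C (X i w)) (n * Cn n w (X i w))) \<partial>M)"
    using i by (simp add: h_def)
  also have "\<dots> = (\<integral>\<^sup>+p. ennreal (\<phi> (fst p) * (\<Sum>k\<le>n - 1. real (n - 1 choose k) * C (fst p) ^ k
        * (1 - C (fst p)) ^ (n - 1 - k) * h (C (fst p)) (1 + real k))) \<partial>observed)"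
    using \<phi> i by (intro nn_integral_risk_set) (auto simp: h_def)
  also have "\<dots> \<le> (\<integral>\<^sup>+p. ennreal (1 / n) * ennreal (\<phi> (fst p)) \<partial>observed)"
  proof (rule nn_integral_mono_AE)
    show "AE p in observed. ennreal (\<phi> (fst p) * (\<Sum>k\<le>n - 1. real (n - 1 choose k) * C (fst p) ^ k
        * (1 - C (fst p)) ^ (n - 1 - k) * h (C (fst p)) (1 + real k))) \<le> ennreal (1 / n) * ennreal (\<phi> (fst p))"
      using AE_observed_C_pos
    proof eventually_elim
      case (elim p)
      define c m where "c = C (fst p)" and "m = n - 1"
      define B where "B k = real (m choose k) * c ^ k * (1 - c) ^ (m - k)" for k
      have c: "0 < c" "c \<le> 1" using elim C_le_1 unfolding c_def by auto
      have n: "real n = real m + 1" unfolding m_def using i by auto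
      have B: "(\<Sum>k\<le>m. B k) = 1" "(\<Sum>k\<le>m. B k * real k) = m * c"
        "(\<Sum>k\<le>m. B k * (1 / (1 + real k))) \<le> 1 / (n * c)"
        using sum_binomial_weights[of c m] binomial_inverse_moment[of c m] c n unfolding B_def by auto
      have heq: "h c (1 + real k) = 1 / n - 2 * c + real k / n + c\<^sup>2 * n * (1 / (1 + real k))" for k
      proof -
        have "(c - t / N)\<^sup>2 / (t / N) = t / N - 2 * c + c\<^sup>2 * N * (1 / t)" if "0 < t" "0 < N" for t N :: real
          using that by (simp add: field_simps power2_eq_square)
        from this[of "1 + real k" "real n"] show ?thesis using i by (simp add: h_def add_divide_distrib)
      qed
      have "(\<Sum>k\<le>m. B k * h c (1 + real k)) = (\<Sum>k\<le>m. (1 / n - 2 * c) * B k + (1 / n) * (B k * real k)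
          + c\<^sup>2 * n * (B k * (1 / (1 + real k))))"
        unfolding heq by (intro sum.cong refl) (simp add: algebra_simps)
      also have "\<dots> = (1 / n - 2 * c) + (1 / n) * (m * c) + c\<^sup>2 * n * (\<Sum>k\<le>m. B k * (1 / (1 + real k)))"
        by (simp only: sum.distrib sum_distrib_left[symmetric] B mult_1_right)
      also have "\<dots> \<le> (1 / n - 2 * c) + (1 / n) * (m * c) + c\<^sup>2 * n * (1 / (n * c))"
        using B(3) c by (intro add_left_mono mult_left_mono) auto
      also have "\<dots> = (1 / n) * (1 - c)"
      proof -
        have "1 / N - 2 * c + 1 / N * ((N - 1) * c) + c\<^sup>2 * N * (1 / (N * c)) = 1 / N * (1 - c)" if "0 < N" for N :: real
          using c that by (simp add: field_simps power2_eq_square)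
        from this[of "real n"] show ?thesis using n i by simp
      qed
      also have "\<dots> \<le> 1 / n" using c by (simp add: divide_right_mono)
      finally have "\<phi> (fst p) * (\<Sum>k\<le>m. B k * h c (1 + real k)) \<le> \<phi> (fst p) * (1 / n)"
        using \<phi> by (intro mult_left_mono) auto
      then show ?case unfolding B_def c_def m_def using \<phi>
        by (simp add: ennreal_mult[symmetric] ennreal_leI)
    qed
  qed
  also have "\<dots> = ennreal (1 / n) * (\<integral>\<^sup>+p. ennreal (\<phi> (fst p)) \<partial>observed)"
    by (rule nn_integral_cmult) simp
  finally show ?thesis .
qed

lemma integral_risk_squared: "(\<integral>q. (risk z q)\<^sup>2 \<partial>observed) = C z"
proof -
  have "(risk z q)\<^sup>2 = risk z q" for q by (simp add: risk_def)
  then show ?thesis by (simp add: integral_risk_observed)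
qed

lemma
  fixes \<phi> :: "real \<Rightarrow> real"
  assumes [measurable]: "\<phi> \<in> borel_measurable borel" and \<phi>: "\<And>z. 0 \<le> \<phi> z" and n: "0 < n"
  shows mean_error_at_fixed_points:
    "(\<integral>\<^sup>+w. (\<integral>\<^sup>+p. ennreal (\<phi> (fst p) * \<bar>Cn n w (fst p) - C (fst p)\<bar>) \<partial>observed) \<partial>M)
      \<le> ennreal (1 / sqrt n) * (\<integral>\<^sup>+p. ennreal (\<phi> (fst p) * sqrt (C (fst p))) \<partial>observed)"
    and mean_error_at_observations:
    "(\<integral>\<^sup>+w. ennreal ((\<Sum>i<n. \<phi> (X i w) * \<bar>Cn n w (X i w) - C (X i w)\<bar>) / n) \<partial>M)
      \<le> ennreal (2 / n) * (\<integral>\<^sup>+p. ennreal (\<phi> (fst p)) \<partial>observed)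
        + ennreal (1 / sqrt n) * (\<integral>\<^sup>+p. ennreal (\<phi> (fst p) * sqrt (C (fst p))) \<partial>observed)"
proof -
  have m: "(\<lambda>(p, q). risk (fst p) q) \<in> borel_measurable (observed \<Otimes>\<^sub>M observed)" by measurable
  have r: "\<bar>risk z q\<bar> \<le> 1" for z q using risk_bounds[of z q] by auto
  have "(\<integral>\<^sup>+w. (\<integral>\<^sup>+p. ennreal (\<phi> (fst p) * \<bar>Cn n w (fst p) - C (fst p)\<bar>) \<partial>observed) \<partial>M)
     \<le> (\<integral>\<^sup>+p. ennreal (\<phi> (fst p) * sqrt (C (fst p) / n)) \<partial>observed)"
    using mean_abs_average_at_fixed_points[OF m r, of "\<lambda>p. \<phi> (fst p)" n] \<phi> n
    by (simp add: risk_freq_def integral_risk_observed integral_risk_squared)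
  also have "\<dots> = (\<integral>\<^sup>+p. ennreal (1 / sqrt n) * ennreal (\<phi> (fst p) * sqrt (C (fst p))) \<partial>observed)"
    using \<phi> C_nonneg by (intro nn_integral_cong) (simp add: ennreal_mult[symmetric] real_sqrt_divide)
  also have "\<dots> = ennreal (1 / sqrt n) * (\<integral>\<^sup>+p. ennreal (\<phi> (fst p) * sqrt (C (fst p))) \<partial>observed)"
    by (rule nn_integral_cmult) simp
  finally show "(\<integral>\<^sup>+w. (\<integral>\<^sup>+p. ennreal (\<phi> (fst p) * \<bar>Cn n w (fst p) - C (fst p)\<bar>) \<partial>observed) \<partial>M)
      \<le> ennreal (1 / sqrt n) * (\<integral>\<^sup>+p. ennreal (\<phi> (fst p) * sqrt (C (fst p))) \<partial>observed)" .
  have "(\<integral>\<^sup>+w. ennreal ((\<Sum>i<n. \<phi> (X i w) * \<bar>Cn n w (X i w) - C (X i w)\<bar>) / n) \<partial>M)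
     \<le> (\<integral>\<^sup>+p. ennreal (\<phi> (fst p) * (2 / n + sqrt (C (fst p) / n))) \<partial>observed)"
    using mean_abs_average_at_observations[OF m r, of "\<lambda>p. \<phi> (fst p)" n] \<phi> n
    by (simp add: risk_freq_def integral_risk_observed integral_risk_squared)
  also have "\<dots> = (\<integral>\<^sup>+p. ennreal (2 / n) * ennreal (\<phi> (fst p)) + ennreal (1 / sqrt n) * ennreal (\<phi> (fst p) * sqrt (C (fst p))) \<partial>observed)"
    using \<phi> C_nonneg by (intro nn_integral_cong)
      (simp add: ennreal_mult[symmetric] ennreal_plus[symmetric] real_sqrt_divide algebra_simps del: ennreal_plus)
  also have "\<dots> = ennreal (2 / n) * (\<integral>\<^sup>+p. ennreal (\<phi> (fst p)) \<partial>observed)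
        + ennreal (1 / sqrt n) * (\<integral>\<^sup>+p. ennreal (\<phi> (fst p) * sqrt (C (fst p))) \<partial>observed)"
    by (simp add: nn_integral_add nn_integral_cmult)
  finally show "(\<integral>\<^sup>+w. ennreal ((\<Sum>i<n. \<phi> (X i w) * \<bar>Cn n w (X i w) - C (X i w)\<bar>) / n) \<partial>M)
      \<le> ennreal (2 / n) * (\<integral>\<^sup>+p. ennreal (\<phi> (fst p)) \<partial>observed)
        + ennreal (1 / sqrt n) * (\<integral>\<^sup>+p. ennreal (\<phi> (fst p) * sqrt (C (fst p))) \<partial>observed)" .
qed

lemma mean_average_at_observations:
  assumes [measurable]: "\<phi> \<in> borel_measurable borel" and \<phi>: "\<And>z. 0 \<le> \<phi> z" and n: "0 < n"
  shows "(\<integral>\<^sup>+w. ennreal ((\<Sum>i<n. \<phi> (X i w)) / n) \<partial>M) = (\<integral>\<^sup>+p. ennreal (\<phi> (fst p)) \<partial>observed)"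
proof -
  have "(\<integral>\<^sup>+w. ennreal ((\<Sum>i<n. \<phi> (X i w)) / n) \<partial>M) = (\<integral>\<^sup>+w. ennreal (1 / n) * (\<Sum>i<n. ennreal (\<phi> (X i w))) \<partial>M)"
    using \<phi> by (intro nn_integral_cong) (simp add: sum_ennreal ennreal_mult[symmetric] sum_nonneg)
  also have "\<dots> = ennreal (1 / n) * (\<Sum>i<n. \<integral>\<^sup>+w. ennreal (\<phi> (X i w)) \<partial>M)"
    by (simp add: nn_integral_cmult nn_integral_sum)
  also have "\<dots> = ennreal (1 / n) * (\<Sum>i<n. \<integral>\<^sup>+p. ennreal (\<phi> (fst p)) \<partial>observed)"
    using nn_integral_Z[of "\<lambda>p. ennreal (\<phi> (fst p))"] by simp
  also have "\<dots> = (\<integral>\<^sup>+p. ennreal (\<phi> (fst p)) \<partial>observed)"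
    using n by (simp add: mult.assoc[symmetric] ennreal_mult[symmetric] ennreal_of_nat_eq_real_of_nat)
  finally show ?thesis .
qed

lemma mean_Cn_integral:
  assumes [measurable]: "\<phi> \<in> borel_measurable borel" and \<phi>: "\<And>z. 0 \<le> \<phi> z" and n: "0 < n"
  shows "(\<integral>\<^sup>+w. (\<integral>\<^sup>+p. ennreal (\<phi> (fst p) * Cn n w (fst p)) \<partial>observed) \<partial>M)
    = (\<integral>\<^sup>+p. ennreal (\<phi> (fst p) * C (fst p)) \<partial>observed)"
proof -
  interpret MP: pair_sigma_finite M observed by unfold_locales
  have "(\<integral>\<^sup>+w. (\<integral>\<^sup>+p. ennreal (\<phi> (fst p) * Cn n w (fst p)) \<partial>observed) \<partial>M)
    = (\<integral>\<^sup>+p. (\<integral>\<^sup>+w. ennreal (\<phi> (fst p) * Cn n w (fst p)) \<partial>M) \<partial>observed)"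
    using MP.Fubini'[of "\<lambda>w p. ennreal (\<phi> (fst p) * Cn n w (fst p))"] by simp
  also have "\<dots> = (\<integral>\<^sup>+p. ennreal (\<phi> (fst p) * C (fst p)) \<partial>observed)"
  proof (rule nn_integral_cong)
    fix p :: "real \<times> real"
    have r: "(\<integral>\<^sup>+w. ennreal (risk (fst p) (Z i w)) \<partial>M) = ennreal (C (fst p))" for i
    proof -
      have "(\<integral>\<^sup>+w. ennreal (risk (fst p) (Z i w)) \<partial>M) = (\<integral>\<^sup>+q. ennreal (risk (fst p) q) \<partial>observed)"
        by (rule nn_integral_Z) simp
      also have "\<dots> = ennreal (C (fst p))"
        using nn_integral_eq_integral[OF risk_integrable[of "fst p"]] by (simp add: risk_bounds integral_risk_observed)
      finally show ?thesis .
    qed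
    have "(\<integral>\<^sup>+w. ennreal (\<phi> (fst p) * Cn n w (fst p)) \<partial>M)
       = (\<integral>\<^sup>+w. ennreal (\<phi> (fst p) / n) * (\<Sum>i<n. ennreal (risk (fst p) (Z i w))) \<partial>M)"
      using \<phi> by (intro nn_integral_cong) (simp add: sum_ennreal ennreal_mult[symmetric] sum_nonneg risk_bounds risk_freq_def)
    also have "\<dots> = ennreal (\<phi> (fst p) / n) * (\<Sum>i<n. ennreal (C (fst p)))"
      by (simp add: nn_integral_cmult nn_integral_sum r)
    also have "\<dots> = ennreal (\<phi> (fst p) * C (fst p))"
      using n \<phi> C_nonneg by (simp add: ennreal_mult[symmetric] ennreal_of_nat_eq_real_of_nat)
    finally show "(\<integral>\<^sup>+w. ennreal (\<phi> (fst p) * Cn n w (fst p)) \<partial>M) = ennreal (\<phi> (fst p) * C (fst p))" .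
  qed
  finally show ?thesis .
qed

text \<open>The two parts of the linear term; \<open>- ln (S x)\<close> is the cumulative hazard.\<close>

definition linear_A :: "nat \<Rightarrow> 'a \<Rightarrow> real \<Rightarrow> real" where
  "linear_A n w x = (\<Sum>i<n. indicator {..x} (X i w) / C (X i w)) / n - (- ln (S x))"

definition linear_E :: "nat \<Rightarrow> 'a \<Rightarrow> real \<Rightarrow> real" where
  "linear_E n w x = (\<integral>p. indicator {..x} (fst p) * (Cn n w (fst p) - C (fst p)) / (C (fst p))\<^sup>2 \<partial>observed)"

text \<open>The error of first order in \<open>C\<^sub>n - C\<close>, integrated against the centred empirical distribution.\<close>

definition degenerate :: "nat \<Rightarrow> 'a \<Rightarrow> real \<Rightarrow> real" where
  "degenerate n w x = (\<Sum>i<n. indicator {..x} (X i w) * (C (X i w) - Cn n w (X i w)) / (C (X i w))\<^sup>2) / n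
     - (\<integral>p. indicator {..x} (fst p) * (C (fst p) - Cn n w (fst p)) / (C (fst p))\<^sup>2 \<partial>observed)"

lemma integrable_inverse_C2:
  assumes "0 < S x"
  shows "integrable observed (\<lambda>p. indicator {..x} (fst p) / (C (fst p))\<^sup>2)"
proof (rule integrableI_nonneg)
  show "(\<integral>\<^sup>+p. ennreal (indicator {..x} (fst p) / (C (fst p))\<^sup>2) \<partial>observed) < \<infinity>"
    using integral_inverse_C2[OF refl assms] by (rule le_less_trans) simp
qed auto

lemma integrable_error_div_C2:
  assumes x: "0 < S x" and [measurable]: "w \<in> space M"
    and [measurable]: "\<phi> \<in> borel_measurable borel" and \<phi>: "\<And>z. \<bar>\<phi> z\<bar> \<le> 1"
  shows "integrable observed (\<lambda>p. indicator {..x} (fst p) * \<phi> (fst p) * (Cn n w (fst p) - C (fst p)) / (C (fst p))\<^sup>2)"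
proof (rule Bochner_Integration.integrable_bound[OF integrable_inverse_C2[OF x]])
  show "AE p in observed. norm (indicator {..x} (fst p) * \<phi> (fst p) * (Cn n w (fst p) - C (fst p)) / (C (fst p))\<^sup>2)
      \<le> norm (indicator {..x} (fst p) / (C (fst p))\<^sup>2)"
  proof (rule AE_I2)
    fix p :: "real \<times> real"
    have "\<bar>Cn n w (fst p) - C (fst p)\<bar> \<le> 1"
      using risk_freq_bounds[of n w "fst p"] C_nonneg[of "fst p"] C_le_1[of "fst p"] by linarith
    then have "\<bar>\<phi> (fst p) * (Cn n w (fst p) - C (fst p))\<bar> \<le> 1 * 1"
      unfolding abs_mult using \<phi> by (intro mult_mono) auto
    then show "norm (indicator {..x} (fst p) * \<phi> (fst p) * (Cn n w (fst p) - C (fst p)) / (C (fst p))\<^sup>2)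
      \<le> norm (indicator {..x} (fst p) / (C (fst p))\<^sup>2)"
      by (auto simp: indicator_def abs_mult intro!: divide_right_mono)
  qed
qed measurable

end

section \<open>Remainder terms to the left of a high quantile\<close>

text \<open>
  The survival probability at \<open>b n\<close> is \<open>\<eta> / sqrt n\<close>. This is large enough for the moment bounds to the
  left of \<open>b n\<close> and, for small \<open>\<eta>\<close>, small enough for the distribution beyond \<open>b n\<close> to be ignored.
\<close>

locale high_quantile = truncated_sample \<mu> \<nu> \<alpha> M Z
  for \<mu> \<nu> :: "real measure" and \<alpha> :: real and M :: "'a measure" and Z :: "nat \<Rightarrow> 'a \<Rightarrow> real \<times> real" +
  fixes \<eta> :: real and b :: "nat \<Rightarrow> real" and s :: "nat \<Rightarrow> real"
  assumes \<eta>: "0 < \<eta>" and s_def: "\<And>n. s n = \<eta> * real n powr (-1/2)"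
    and b: "\<forall>\<^sub>F n in sequentially. S (b n) = s n"
begin

lemma eventually_b: "\<forall>\<^sub>F n in sequentially. 0 < n \<and> 0 < s n \<and> S (b n) = s n"
  using eventually_gt_at_top[of 0] b
  by eventually_elim (use \<eta> in \<open>auto simp: s_def\<close>)

lemma sum_mean_inverse_risk_set_squared:
  assumes [measurable]: "\<phi> \<in> borel_measurable borel" and \<phi>: "\<And>z. 0 \<le> \<phi> z" and n: "0 < n"
    and le: "(\<integral>\<^sup>+p. ennreal (\<phi> (fst p) / (C (fst p))\<^sup>2) \<partial>observed) \<le> ennreal I"
  shows "(\<integral>\<^sup>+w. ennreal (\<Sum>i<n. \<phi> (X i w) / (n * Cn n w (X i w))\<^sup>2) \<partial>M) \<le> ennreal (2 / n * I)"
proof -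
  have "(\<integral>\<^sup>+w. ennreal (\<Sum>i<n. \<phi> (X i w) / (n * Cn n w (X i w))\<^sup>2) \<partial>M)
     = (\<Sum>i<n. \<integral>\<^sup>+w. ennreal (\<phi> (X i w) / (n * Cn n w (X i w))\<^sup>2) \<partial>M)"
    using \<phi> by (subst nn_integral_sum[symmetric]) (auto simp: sum_ennreal)
  also have "\<dots> \<le> (\<Sum>i<n. ennreal (2 / (real n)\<^sup>2) * ennreal I)"
    using \<phi> by (intro sum_mono order_trans[OF mean_inverse_risk_set_squared] mult_left_mono le) auto
  also have "\<dots> = ennreal (real n * (2 / (real n)\<^sup>2)) * ennreal I"
    by (simp add: ennreal_mult'[symmetric] mult.assoc[symmetric] ennreal_of_nat_eq_real_of_nat)
  also have "\<dots> = ennreal (2 / n * I)"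
    using n by (simp add: ennreal_mult'[symmetric] power2_eq_square)
  finally show ?thesis .
qed

text \<open>
  If the risk set of an observed lifetime is a singleton, the estimator jumps to \<open>1\<close> there. Each such
  lifetime up to \<open>b n\<close> contributes \<open>1\<close> to the sum of \<open>1 / (n * C\<^sub>n)\<^sup>2\<close>, whose mean vanishes.
\<close>

lemma whp_risk_sets_not_singletons:
  "whp M (\<lambda>n w. \<forall>i<n. X i w \<le> b n \<longrightarrow> 2 \<le> n * Cn n w (X i w))"
proof -
  define f where "f n w = (\<Sum>i<n. indicator {..b n} (X i w) / (n * Cn n w (X i w))\<^sup>2)" for n w
  have [measurable]: "f n \<in> borel_measurable M" for n unfolding f_def by measurable
  have "whp M (\<lambda>n w. ennreal (f n w) \<le> ennreal (1/2))"
  proof (rule whp_Markov[OF prob_space_axioms])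
    show "(\<lambda>n. 2 * \<alpha> * K * real n powr (-1) * (\<eta> * real n powr (-1/2)) powr (- (5/4))) \<longlonglongrightarrow> 0"
      using \<eta> by (intro rate_tendsto_0) auto
    show "\<forall>\<^sub>F n in sequentially. (\<integral>\<^sup>+w. ennreal (f n w) \<partial>M) \<le> ennreal (2 * \<alpha> * K * real n powr (-1) * (\<eta> * real n powr (-1/2)) powr (- (5/4)))"
      using eventually_b
    proof eventually_elim
      case (elim n)
      have "(\<integral>\<^sup>+w. ennreal (f n w) \<partial>M) \<le> ennreal (2 / n * (\<alpha> * s n powr (- 5/4) * K))"
        unfolding f_def using elim integral_inverse_C2[of "b n" "s n"]
        by (intro sum_mean_inverse_risk_set_squared) auto
      also have "2 / n * (\<alpha> * s n powr (- 5/4) * K) = 2 * \<alpha> * K * real n powr (-1) * (\<eta> * real n powr (-1/2)) powr (- (5/4))"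
        using elim by (simp add: s_def powr_minus_divide)
      finally show ?case .
    qed
  qed auto
  moreover have "whp M (\<lambda>n w. \<forall>i. snd (Z i w) \<le> fst (Z i w))"
    using AE_Z[OF AE_observed_ordered] by (intro whp_AE prob_space_axioms) (simp add: AE_all_countable)
  ultimately have "whp M (\<lambda>n w. ennreal (f n w) \<le> ennreal (1/2) \<and> (\<forall>i. snd (Z i w) \<le> fst (Z i w)))"
    by (rule whp_conj[OF prob_space_axioms])
  then show ?thesis
  proof (rule whp_mono, intro always_eventually allI ballI impI)
    fix n w i assume w: "ennreal (f n w) \<le> ennreal (1/2) \<and> (\<forall>i. snd (Z i w) \<le> fst (Z i w))"
      and i: "i < n" "X i w \<le> b n"
    have half: "ennreal (f n w) \<le> ennreal (1/2) \<longleftrightarrow> f n w \<le> 1/2" by (rule ennreal_le_iff) simp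
    define N where "N = card {j. j < n \<and> snd (Z j w) \<le> X i w \<and> X i w \<le> fst (Z j w)}"
    have "n * Cn n w (X i w) = (\<Sum>j<n. risk (X i w) (Z j w))" using i by (intro n_times_Cn) simp
    also have "\<dots> = real N" by (simp add: risk_def N_def lessThan_def Int_def)
    finally have N: "n * Cn n w (X i w) = real N" .
    have "i \<in> {j. j < n \<and> snd (Z j w) \<le> X i w \<and> X i w \<le> fst (Z j w)}" using i w by auto
    then have "N \<noteq> 0" unfolding N_def by (auto simp: card_eq_0_iff)
    moreover have "N \<noteq> 1"
    proof
      assume "N = 1"
      then have "1 = indicator {..b n} (X i w) / (n * Cn n w (X i w))\<^sup>2" using N i by simp
      also have "\<dots> \<le> f n w"
        unfolding f_def using i by (intro member_le_sum) auto
      finally show False using conjunct1[OF w] unfolding half by simp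
    qed
    ultimately show "2 \<le> n * Cn n w (X i w)" unfolding N by simp
  qed
qed

text \<open>This bounds the error of replacing \<open>- ln (1 - u)\<close> by \<open>u\<close> in the factors \<open>1 - u\<close> of the estimator.\<close>

lemma whp_logarithm_error:
  assumes \<delta>: "0 < \<delta>"
  shows "whp M (\<lambda>n w. sqrt n * (\<Sum>i<n. indicator {..b n} (X i w) * S (X i w) / (n * Cn n w (X i w))\<^sup>2) \<le> \<delta>)"
proof -
  define f where "f n w = sqrt n * (\<Sum>i<n. indicator {..b n} (X i w) * S (X i w) / (n * Cn n w (X i w))\<^sup>2)" for n w
  have "whp M (\<lambda>n w. ennreal (f n w) \<le> ennreal \<delta>)"
  proof (rule whp_Markov[OF prob_space_axioms])
    show "\<forall>\<^sub>F n in sequentially. (\<lambda>w. ennreal (f n w)) \<in> borel_measurable M" unfolding f_def by measurable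
    show "(\<lambda>n. 2 * \<alpha> * K * real n powr (-1/2) * (\<eta> * real n powr (-1/2)) powr (- (1/4))) \<longlonglongrightarrow> 0"
      using \<eta> by (intro rate_tendsto_0) auto
    show "\<forall>\<^sub>F n in sequentially. (\<integral>\<^sup>+w. ennreal (f n w) \<partial>M) \<le> ennreal (2 * \<alpha> * K * real n powr (-1/2) * (\<eta> * real n powr (-1/2)) powr (- (1/4)))"
      using eventually_b
    proof eventually_elim
      case (elim n)
      have "(\<integral>\<^sup>+w. ennreal (f n w) \<partial>M) = ennreal (sqrt n) * (\<integral>\<^sup>+w. ennreal (\<Sum>i<n. indicator {..b n} (X i w) * S (X i w) / (n * Cn n w (X i w))\<^sup>2) \<partial>M)"
        unfolding f_def by (subst nn_integral_cmult[symmetric]) (auto simp: ennreal_mult')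
      also have "\<dots> \<le> ennreal (sqrt n) * ennreal (2 / n * (\<alpha> * s n powr (- 1/4) * K))"
        using elim integral_S_div_C2[of "b n" "s n"] S_bounds
        by (intro mult_left_mono sum_mean_inverse_risk_set_squared) auto
      also have "\<dots> = ennreal (sqrt n * (2 / n) * (\<alpha> * s n powr (- 1/4) * K))"
        using \<alpha>_pos K_finite(2) by (simp add: ennreal_mult'[symmetric] mult.assoc)
      also have "sqrt n * (2 / n) = 2 * (sqrt n / n)" by simp
      also have "sqrt n / n = real n powr (-1/2)"
        using elim by (intro sqrt_div_eq_powr) auto
      also have "2 * real n powr (-1/2) * (\<alpha> * s n powr (- 1/4) * K) = 2 * \<alpha> * K * real n powr (-1/2) * (\<eta> * real n powr (-1/2)) powr (- (1/4))"
        by (simp add: s_def)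
      finally show ?case .
    qed
  qed (use \<delta> in auto)
  then show ?thesis unfolding f_def using \<delta> by (simp add: ennreal_le_iff)
qed

lemma whp_relative_square_error:
  assumes \<delta>: "0 < \<delta>"
  shows "whp M (\<lambda>n w. sqrt n * ((\<Sum>i<n. indicator {..b n} (X i w) * S (X i w) / (C (X i w))\<^sup>2
      * ((C (X i w) - Cn n w (X i w))\<^sup>2 / Cn n w (X i w))) / n) \<le> \<delta>)"
proof -
  define \<phi> where "\<phi> n z = indicator {..b n} z * S z / (C z)\<^sup>2" for n z
  have [measurable]: "\<phi> n \<in> borel_measurable borel" for n unfolding \<phi>_def by measurable
  have \<phi>: "0 \<le> \<phi> n z" for n z unfolding \<phi>_def using S_bounds by simp
  define f where "f n w = (\<Sum>i<n. \<phi> n (X i w) * ((C (X i w) - Cn n w (X i w))\<^sup>2 / Cn n w (X i w)))" for n w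
  have f0: "0 \<le> f n w" for n w unfolding f_def using \<phi> risk_freq_bounds by (intro sum_nonneg) auto
  have [measurable]: "f n \<in> borel_measurable M" for n unfolding f_def by measurable
  have "whp M (\<lambda>n w. ennreal (sqrt n * (f n w / n)) \<le> ennreal \<delta>)"
  proof (rule whp_Markov[OF prob_space_axioms])
    show "(\<lambda>n. \<alpha> * K * real n powr (-1/2) * (\<eta> * real n powr (-1/2)) powr (- (1/4))) \<longlonglongrightarrow> 0"
      using \<eta> by (intro rate_tendsto_0) auto
    show "\<forall>\<^sub>F n in sequentially. (\<integral>\<^sup>+w. ennreal (sqrt n * (f n w / n)) \<partial>M) \<le> ennreal (\<alpha> * K * real n powr (-1/2) * (\<eta> * real n powr (-1/2)) powr (- (1/4)))"
      using eventually_b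
    proof eventually_elim
      case (elim n)
      have "(\<integral>\<^sup>+w. ennreal (sqrt n * (f n w / n)) \<partial>M) = ennreal (sqrt n / n) * (\<integral>\<^sup>+w. ennreal (f n w) \<partial>M)"
        by (subst nn_integral_cmult[symmetric]) (auto simp: ennreal_mult'[symmetric])
      also have "(\<integral>\<^sup>+w. ennreal (f n w) \<partial>M) = (\<Sum>i<n. \<integral>\<^sup>+w. ennreal (\<phi> n (X i w) * ((C (X i w) - Cn n w (X i w))\<^sup>2 / Cn n w (X i w))) \<partial>M)"
        unfolding f_def using \<phi> risk_freq_bounds by (subst nn_integral_sum[symmetric]) (auto simp: sum_ennreal)
      also have "ennreal (sqrt n / n) * \<dots> \<le> ennreal (sqrt n / n) * (\<Sum>i<n. ennreal (1 / n) * ennreal (\<alpha> * s n powr (- 1/4) * K))"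
      proof (intro mult_left_mono sum_mono)
        fix i assume "i \<in> {..<n}"
        then have "(\<integral>\<^sup>+w. ennreal (\<phi> n (X i w) * ((C (X i w) - Cn n w (X i w))\<^sup>2 / Cn n w (X i w))) \<partial>M)
          \<le> ennreal (1 / n) * (\<integral>\<^sup>+p. ennreal (\<phi> n (fst p)) \<partial>observed)"
          using \<phi> by (intro mean_relative_square_error) auto
        also have "\<dots> \<le> ennreal (1 / n) * ennreal (\<alpha> * s n powr (- 1/4) * K)"
          unfolding \<phi>_def using elim integral_S_div_C2[of "b n" "s n"] by (intro mult_left_mono) auto
        finally show "(\<integral>\<^sup>+w. ennreal (\<phi> n (X i w) * ((C (X i w) - Cn n w (X i w))\<^sup>2 / Cn n w (X i w))) \<partial>M)
          \<le> ennreal (1 / n) * ennreal (\<alpha> * s n powr (- 1/4) * K)" .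
      qed auto
      also have "\<dots> = ennreal (sqrt n / n * (\<alpha> * s n powr (- 1/4) * K))"
        using elim \<alpha>_pos K_finite(2) by (simp add: mult.assoc[symmetric] ennreal_mult'[symmetric] ennreal_of_nat_eq_real_of_nat)
      also have "sqrt n / n = real n powr (-1/2)"
        using elim by (intro sqrt_div_eq_powr) auto
      also have "real n powr (-1/2) * (\<alpha> * s n powr (- 1/4) * K) = \<alpha> * K * real n powr (-1/2) * (\<eta> * real n powr (-1/2)) powr (- (1/4))"
        by (simp add: s_def)
      finally show ?case .
    qed
  qed (use \<delta> in auto)
  then show ?thesis unfolding f_def \<phi>_def using \<delta> by (simp add: ennreal_le_iff)
qed

text \<open>
  This part of the linear term is small in mean absolute value already; no supremum is involved,
  because \<open>sqrt (S x) \<le> sqrt (S z)\<close> for \<open>z \<le> x\<close>.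
\<close>

lemma whp_linear_E:
  assumes \<delta>: "0 < \<delta>"
  shows "whp M (\<lambda>n w. \<forall>x\<le>b n. S x * (linear_E n w x)\<^sup>2 \<le> \<delta> * s n)"
proof -
  define \<phi> where "\<phi> n z = indicator {..b n} z * sqrt (S z) / (C z)\<^sup>2" for n z
  have [measurable]: "\<phi> n \<in> borel_measurable borel" for n unfolding \<phi>_def by measurable
  have \<phi>: "0 \<le> \<phi> n z" for n z unfolding \<phi>_def using S_bounds by simp
  define f where "f n w = ennreal (s n powr (-1/2)) * (\<integral>\<^sup>+p. ennreal (\<phi> n (fst p) * \<bar>Cn n w (fst p) - C (fst p)\<bar>) \<partial>observed)" for n w
  have [measurable]: "f n \<in> borel_measurable M" for n unfolding f_def by measurable
  have "whp M (\<lambda>n w. f n w \<le> ennreal (sqrt \<delta>))"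
  proof (rule whp_Markov[OF prob_space_axioms])
    show "(\<lambda>n. sqrt \<alpha> * K * real n powr (-1/2) * (\<eta> * real n powr (-1/2)) powr (- (3/4))) \<longlonglongrightarrow> 0"
      using \<eta> by (intro rate_tendsto_0) auto
    show "\<forall>\<^sub>F n in sequentially. (\<integral>\<^sup>+w. f n w \<partial>M) \<le> ennreal (sqrt \<alpha> * K * real n powr (-1/2) * (\<eta> * real n powr (-1/2)) powr (- (3/4)))"
      using eventually_b
    proof eventually_elim
      case (elim n)
      have "(\<integral>\<^sup>+w. f n w \<partial>M) = ennreal (s n powr (-1/2)) * (\<integral>\<^sup>+w. (\<integral>\<^sup>+p. ennreal (\<phi> n (fst p) * \<bar>Cn n w (fst p) - C (fst p)\<bar>) \<partial>observed) \<partial>M)"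
        unfolding f_def by (rule nn_integral_cmult) measurable
      also have "\<dots> \<le> ennreal (s n powr (-1/2)) * (ennreal (1 / sqrt n) * ennreal (sqrt \<alpha> * s n powr (- 1/4) * K))"
        using elim \<phi> integral_sqrt_S_div_C[of "b n" "s n"]
        by (intro mult_left_mono order_trans[OF mean_error_at_fixed_points]) (auto simp: \<phi>_def)
      also have "\<dots> = ennreal (s n powr (-1/2) * ((1 / sqrt n) * (sqrt \<alpha> * s n powr (- 1/4) * K)))"
        using \<alpha>_pos K_finite(2) by (simp add: ennreal_mult'[symmetric])
      also have "s n powr (-1/2) * ((1 / sqrt n) * (sqrt \<alpha> * s n powr (- 1/4) * K))
         = sqrt \<alpha> * K * real n powr (-1/2) * (s n powr (-1/2) * s n powr (- 1/4))"
        using elim by (simp add: powr_minus_divide powr_half_sqrt)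
      also have "s n powr (-1/2) * s n powr (- 1/4) = s n powr (- (3/4))" by (simp flip: powr_add)
      finally show ?case by (simp add: s_def)
    qed
  qed (use \<delta> in auto)
  then show ?thesis
  proof (rule whp_mono, use eventually_b in eventually_elim, intro ballI impI allI)
    fix n w x assume n: "0 < n \<and> 0 < s n \<and> S (b n) = s n" and w: "w \<in> space M" "f n w \<le> ennreal (sqrt \<delta>)" and x: "x \<le> b n"
    note [measurable] = w(1)
    have Sx: "s n \<le> S x" "0 < S x" using S_antimono[OF x] n by auto
    have int: "integrable observed (\<lambda>p. indicator {..x} (fst p) * 1 * (Cn n w (fst p) - C (fst p)) / (C (fst p))\<^sup>2)"
      using integrable_error_div_C2[OF Sx(2) w(1), of "\<lambda>_. 1"] by simp
    have "ennreal (sqrt (S x) * \<bar>linear_E n w x\<bar>) = ennreal (sqrt (S x)) * ennreal \<bar>linear_E n w x\<bar>"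
      using Sx by (simp add: ennreal_mult')
    also have "\<dots> \<le> ennreal (sqrt (S x)) * (\<integral>\<^sup>+p. ennreal \<bar>indicator {..x} (fst p) * 1 * (Cn n w (fst p) - C (fst p)) / (C (fst p))\<^sup>2\<bar> \<partial>observed)"
      unfolding linear_E_def using integral_norm_bound_ennreal[OF int] by (intro mult_left_mono) auto
    also have "\<dots> = (\<integral>\<^sup>+p. ennreal (sqrt (S x)) * ennreal \<bar>indicator {..x} (fst p) * 1 * (Cn n w (fst p) - C (fst p)) / (C (fst p))\<^sup>2\<bar> \<partial>observed)"
      by (rule nn_integral_cmult[symmetric]) measurable
    also have "\<dots> \<le> (\<integral>\<^sup>+p. ennreal (\<phi> n (fst p) * \<bar>Cn n w (fst p) - C (fst p)\<bar>) \<partial>observed)"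
    proof (rule nn_integral_mono)
      fix p :: "real \<times> real"
      have "sqrt (S x) * \<bar>indicator {..x} (fst p) * 1 * (Cn n w (fst p) - C (fst p)) / (C (fst p))\<^sup>2\<bar>
          \<le> \<phi> n (fst p) * \<bar>Cn n w (fst p) - C (fst p)\<bar>"
      proof (cases "fst p \<le> x")
        case True
        have "sqrt (S x) * (\<bar>Cn n w (fst p) - C (fst p)\<bar> / (C (fst p))\<^sup>2) \<le> sqrt (S (fst p)) * (\<bar>Cn n w (fst p) - C (fst p)\<bar> / (C (fst p))\<^sup>2)"
          using S_antimono[OF True] by (intro mult_right_mono) auto
        then show ?thesis using True x by (simp add: \<phi>_def abs_mult)
      qed (use \<phi> in simp)
      then show "ennreal (sqrt (S x)) * ennreal \<bar>indicator {..x} (fst p) * 1 * (Cn n w (fst p) - C (fst p)) / (C (fst p))\<^sup>2\<bar>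
          \<le> ennreal (\<phi> n (fst p) * \<bar>Cn n w (fst p) - C (fst p)\<bar>)"
        using Sx by (simp add: ennreal_mult'[symmetric] ennreal_leI)
    qed
    finally have "ennreal (s n powr (-1/2)) * ennreal (sqrt (S x) * \<bar>linear_E n w x\<bar>) \<le> f n w"
      unfolding f_def by (rule mult_left_mono) simp
    then have "ennreal (s n powr (-1/2) * (sqrt (S x) * \<bar>linear_E n w x\<bar>)) \<le> ennreal (sqrt \<delta>)"
      using w(2) by (simp add: ennreal_mult')
    then have "s n powr (-1/2) * (sqrt (S x) * \<bar>linear_E n w x\<bar>) \<le> sqrt \<delta>"
      using \<delta> by (simp add: ennreal_le_iff)
    then have "sqrt (S x) * \<bar>linear_E n w x\<bar> \<le> sqrt \<delta> * sqrt (s n)"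
      using n by (simp add: powr_minus_divide powr_half_sqrt field_simps)
    then have "(sqrt (S x) * \<bar>linear_E n w x\<bar>)\<^sup>2 \<le> (sqrt \<delta> * sqrt (s n))\<^sup>2"
      using Sx by (intro power_mono) auto
    then show "S x * (linear_E n w x)\<^sup>2 \<le> \<delta> * s n"
      using Sx n \<delta> by (simp add: power_mult_distrib)
  qed
qed

lemma s_le_1: "0 < s n \<Longrightarrow> S (b n) = s n \<Longrightarrow> s n \<le> 1"
  using S_bounds(2)[of "b n"] by simp

text \<open>
  The other part of the linear term is a centred empirical integral. On a grid of about
  \<open>n powr (1/3)\<close> points the hazard increases by little from each point to the next. At each point
  the weight \<open>S\<close> keeps the mean square of order \<open>s powr (-1/4) / n\<close>, which is so much smaller than \<open>s\<close>
  that Chebyshev's inequality and a union bound suffice.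
\<close>

lemma whp_linear_A:
  assumes \<delta>: "0 < \<delta>"
  shows "whp M (\<lambda>n w. \<forall>x\<le>b n. S x * (linear_A n w x)\<^sup>2 \<le> \<delta> * s n)"
proof -
  define good where "good n \<longleftrightarrow> 0 < n \<and> 0 < s n \<and> S (b n) = s n" for n
  define N where "N n = nat \<lceil>real n powr (1/3)\<rceil>" for n
  \<comment> \<open>The hazard, stopped at \<open>b n\<close> to remain finite.\<close>
  define V where "V n x = - ln (max (S x) (s n))" for n x
  define W where "W n w x = (\<Sum>i<n. indicator {..x} (X i w) / C (X i w)) / real n" for n w x
  define d where "d n = V n (b n) / N n" for n
  have N: "0 < N n" "real n powr (1/3) \<le> N n" "N n \<le> 2 * real n powr (1/3)" if "0 < n" for n
  proof -
    have 1: "1 \<le> real n powr (1/3)" using that by (intro ge_one_powr_ge_zero) auto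
    then show "0 < N n" unfolding N_def by linarith
    show "real n powr (1/3) \<le> N n" unfolding N_def by linarith
    have "real (N n) \<le> real n powr (1/3) + 1" unfolding N_def using 1 by linarith
    then show "N n \<le> 2 * real n powr (1/3)" using 1 by linarith
  qed
  have S_cont: "continuous_on UNIV S" unfolding S_def[abs_def] by (intro continuous_intros cont_F)
  have Vm: "mono (V n)" if "good n" for n
    unfolding V_def
  proof (intro monoI)
    fix x y :: real assume "x \<le> y"
    then show "- ln (max (S x) (s n)) \<le> - ln (max (S y) (s n))"
      using S_antimono[of x y] that unfolding good_def by (auto simp: max_def)
  qed
  have ex: "\<exists>T. finite T \<and> card T \<le> N n \<and> T \<subseteq> {..b n} \<and>
    (\<forall>x\<le>b n. \<exists>t\<in>T. x \<le> t \<and> V n t - V n x \<le> d n \<and> (V n x \<le> d n \<or> (\<exists>t'\<in>T. t' \<le> x \<and> V n x - V n t' \<le> d n)))"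
    if n: "good n" for n
  proof -
    have c: "continuous_on UNIV (V n)"
      unfolding V_def using n by (intro continuous_intros S_cont) (auto simp: good_def max_def)
    have m: "max (1 - 0) (s n) = 1" using n s_le_1 by (simp add: good_def)
    have lim: "((\<lambda>x. - ln (max (1 - F x) (s n))) \<longlongrightarrow> - ln (max (1 - 0) (s n))) at_bot"
      using n by (intro tendsto_intros X.cdf_lim_at_bot) (auto simp: good_def)
    have l: "(V n \<longlongrightarrow> 0) at_bot"
      using lim unfolding m V_def S_def by simp
    show ?thesis
      using finite_grid[OF c Vm[OF n] l, of "N n" "b n"] N n unfolding good_def d_def by metis
  qed
  define T where "T n = (SOME T. finite T \<and> card T \<le> N n \<and> T \<subseteq> {..b n} \<and>
    (\<forall>x\<le>b n. \<exists>t\<in>T. x \<le> t \<and> V n t - V n x \<le> d n \<and> (V n x \<le> d n \<or> (\<exists>t'\<in>T. t' \<le> x \<and> V n x - V n t' \<le> d n))))" for n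
  have T: "finite (T n)" "card (T n) \<le> N n" "T n \<subseteq> {..b n}"
    "\<And>x. x \<le> b n \<Longrightarrow> \<exists>t\<in>T n. x \<le> t \<and> V n t - V n x \<le> d n \<and> (V n x \<le> d n \<or> (\<exists>t'\<in>T n. t' \<le> x \<and> V n x - V n t' \<le> d n))"
    if "good n" for n
    using someI_ex[OF ex[OF that]] unfolding T_def[symmetric] by auto
  have V_eq: "V n x = - ln (S x)" if "good n" "x \<le> b n" for n x
    using that S_antimono[of x "b n"] by (simp add: V_def good_def max_def)
  have A_eq: "linear_A n w x = W n w x - V n x" if "good n" "x \<le> b n" for n w x
    using V_eq[OF that] by (simp add: linear_A_def W_def)
  have S_ge: "s n \<le> S x" "0 < S x" if "good n" "x \<le> b n" for n x
    using that S_antimono[of x "b n"] by (auto simp: good_def)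
  have [measurable]: "(\<lambda>w. linear_A n w x) \<in> borel_measurable M" for n x unfolding linear_A_def by measurable

  define f where "f n w = ennreal (1 / s n) * (\<Sum>t\<in>T n. ennreal (S t * (linear_A n w t)\<^sup>2))" for n w
  have one: "(\<integral>\<^sup>+w. ennreal (S t * (linear_A n w t)\<^sup>2) \<partial>M) \<le> ennreal (\<alpha> * s n powr (- 1/4) * K / n)"
    if n: "good n" and t: "t \<le> b n" for n t
  proof -
    define g where "g p = indicator {..t} (fst p) / C (fst p)" for p :: "real \<times> real"
    have [measurable]: "g \<in> borel_measurable observed" unfolding g_def by measurable
    have g2: "(g p)\<^sup>2 = indicator {..t} (fst p) / (C (fst p))\<^sup>2" for p
      by (auto simp: g_def indicator_def power_divide)
    have sq: "integrable observed (\<lambda>p. (g p)\<^sup>2)"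
      unfolding g2 by (rule integrable_inverse_C2[OF S_ge(2)[OF n t]])
    have mean: "(\<integral>p. g p \<partial>observed) = - ln (S t)"
      using integral_hazard[OF S_ge(2)[OF n t]] C_nonneg S_bounds S_ge(2)[OF n t]
      by (subst integral_eq_nn_integral) (auto simp: g_def)
    have "ennreal (S t * (\<integral>p. (g p)\<^sup>2 \<partial>observed)) = ennreal (S t) * (\<integral>\<^sup>+p. ennreal ((g p)\<^sup>2) \<partial>observed)"
      using nn_integral_eq_integral[OF sq] S_bounds by (simp add: ennreal_mult')
    also have "\<dots> = (\<integral>\<^sup>+p. ennreal (S t) * ennreal ((g p)\<^sup>2) \<partial>observed)"
      by (rule nn_integral_cmult[symmetric]) simp
    also have "\<dots> \<le> (\<integral>\<^sup>+p. ennreal (indicator {..b n} (fst p) * S (fst p) / (C (fst p))\<^sup>2) \<partial>observed)"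
      using t S_bounds S_antimono[of _ t] unfolding g2
      by (intro nn_integral_mono) (auto simp: ennreal_mult'[symmetric] indicator_def intro!: ennreal_leI divide_right_mono)
    also have "\<dots> \<le> ennreal (\<alpha> * s n powr (- 1/4) * K)"
      using n integral_S_div_C2[of "b n" "s n"] by (simp add: good_def)
    finally have le: "S t * (\<integral>p. (g p)\<^sup>2 \<partial>observed) \<le> \<alpha> * s n powr (- 1/4) * K"
      using \<alpha>_pos K_finite(2) by (simp add: ennreal_le_iff)
    have "(\<integral>\<^sup>+w. ennreal (S t * (linear_A n w t)\<^sup>2) \<partial>M) = ennreal (S t) * (\<integral>\<^sup>+w. ennreal ((linear_A n w t)\<^sup>2) \<partial>M)"
      using S_bounds by (subst nn_integral_cmult[symmetric]) (auto simp: ennreal_mult')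
    also have "\<dots> \<le> ennreal (S t) * ennreal ((\<integral>p. (g p)\<^sup>2 \<partial>observed) / n)"
      using mean_square_average_le[OF _ sq, of n] n unfolding mean
      by (intro mult_left_mono) (auto simp: linear_A_def g_def good_def)
    also have "\<dots> = ennreal (S t * (\<integral>p. (g p)\<^sup>2 \<partial>observed) / n)"
      using S_bounds by (simp add: ennreal_mult'[symmetric])
    also have "\<dots> \<le> ennreal (\<alpha> * s n powr (- 1/4) * K / n)"
      by (intro ennreal_leI divide_right_mono le) simp
    finally show ?thesis .
  qed
  have at_points: "whp M (\<lambda>n w. f n w \<le> ennreal (\<delta> / 8))"
  proof (rule whp_Markov[OF prob_space_axioms])
    show "\<forall>\<^sub>F n in sequentially. f n \<in> borel_measurable M" unfolding f_def by measurable
    show "(\<lambda>n. 2 * \<alpha> * K * real n powr (-2/3) * (\<eta> * real n powr (-1/2)) powr (- (5/4))) \<longlonglongrightarrow> 0"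
      using \<eta> by (intro rate_tendsto_0) auto
    show "\<forall>\<^sub>F n in sequentially. (\<integral>\<^sup>+w. f n w \<partial>M) \<le> ennreal (2 * \<alpha> * K * real n powr (-2/3) * (\<eta> * real n powr (-1/2)) powr (- (5/4)))"
      using eventually_b
    proof eventually_elim
      case (elim n)
      then have n: "good n" by (simp add: good_def)
      define c where "c = \<alpha> * s n powr (- 1/4) * K / n"
      have c: "0 \<le> c" unfolding c_def using \<alpha>_pos K_finite(2) by simp
      have "(\<integral>\<^sup>+w. f n w \<partial>M) = ennreal (1 / s n) * (\<Sum>t\<in>T n. \<integral>\<^sup>+w. ennreal (S t * (linear_A n w t)\<^sup>2) \<partial>M)"
        unfolding f_def by (simp add: nn_integral_cmult nn_integral_sum)
      also have "\<dots> \<le> ennreal (1 / s n) * (\<Sum>t\<in>T n. ennreal c)"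
        unfolding c_def using one[OF n] T(3)[OF n] by (intro mult_left_mono sum_mono) auto
      also have "\<dots> = ennreal (1 / s n * (card (T n) * c))"
        using elim c by (simp add: ennreal_mult'[symmetric] ennreal_of_nat_eq_real_of_nat)
      also have "\<dots> \<le> ennreal (1 / s n * ((2 * real n powr (1/3)) * c))"
      proof (intro ennreal_leI mult_left_mono mult_right_mono c)
        have "real (card (T n)) \<le> real (N n)" using T(2)[OF n] by simp
        also have "\<dots> \<le> 2 * real n powr (1/3)" using N(3) elim by simp
        finally show "real (card (T n)) \<le> 2 * real n powr (1/3)" .
      qed (use elim in auto)
      also have "1 / s n * ((2 * real n powr (1/3)) * c) = 2 * \<alpha> * K * (real n powr (1/3) / n) * (s n powr (- 1/4) / s n)"
        unfolding c_def by (simp add: mult_ac)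
      also have "real n powr (1/3) / n = real n powr (-2/3)"
        using elim powr_diff[of "real n" "1/3" 1] by simp
      also have "s n powr (- 1/4) / s n = s n powr (- (5/4))"
        using elim powr_diff[of "s n" "- 1/4" 1] by simp
      finally show ?case by (simp add: s_def)
    qed
  qed (use \<delta> in auto)
  have spacing: "\<forall>\<^sub>F n in sequentially. good n \<and> 0 \<le> d n \<and> d n \<le> 1/2 \<and> (d n)\<^sup>2 \<le> \<delta> / 4 * s n"
  proof -
    \<comment> \<open>The spacing is \<open>ln (1 / s) / N\<close>, and \<open>ln y \<le> 12 * y powr (1/12)\<close> for \<open>1 \<le> y\<close>.\<close>
    have "(\<lambda>n. 12 * real n powr (-1/3) * (\<eta> * real n powr (-1/2)) powr (- (1/12))) \<longlonglongrightarrow> 0"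
      using \<eta> by (intro rate_tendsto_0) auto
    then have e1: "\<forall>\<^sub>F n in sequentially. 12 * real n powr (-1/3) * (\<eta> * real n powr (-1/2)) powr (- (1/12)) < 1/2"
      by (intro order_tendstoD(2)) auto
    have "(\<lambda>n. 144 * real n powr (-2/3) * (\<eta> * real n powr (-1/2)) powr (- (7/6))) \<longlonglongrightarrow> 0"
      using \<eta> by (intro rate_tendsto_0) auto
    then have e2: "\<forall>\<^sub>F n in sequentially. 144 * real n powr (-2/3) * (\<eta> * real n powr (-1/2)) powr (- (7/6)) < \<delta> / 4"
      using \<delta> by (intro order_tendstoD(2)) auto
    from eventually_b e1 e2 show ?thesis
    proof eventually_elim
      case (elim n)
      then have n: "good n" by (simp add: good_def)
      have s1: "s n \<le> 1" using elim s_le_1 by simp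
      have Vb: "V n (b n) = ln (1 / s n)" using V_eq[OF n, of "b n"] elim by (simp add: ln_div)
      have "ln (1 / s n) \<le> (1 / s n) powr (1/12) / (1/12)"
        using elim s1 by (intro ln_powr_bound) auto
      also have "\<dots> = 12 * s n powr (- (1/12))"
        using elim by (simp add: powr_divide powr_minus_divide)
      finally have "V n (b n) \<le> 12 * s n powr (- (1/12))" unfolding Vb .
      moreover have V0: "0 \<le> V n (b n)" unfolding Vb using elim s1 by (intro ln_ge_zero) auto
      ultimately have "d n \<le> 12 * s n powr (- (1/12)) / real n powr (1/3)"
        unfolding d_def using N[of n] elim by (intro frac_le) auto
      also have "\<dots> = 12 * real n powr (-1/3) * s n powr (- (1/12))"
        by (simp add: powr_minus_divide)
      finally have d: "d n \<le> 12 * real n powr (-1/3) * s n powr (- (1/12))" .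
      have d0: "0 \<le> d n" unfolding d_def using V0 by simp
      have "(d n)\<^sup>2 \<le> (12 * real n powr (-1/3) * s n powr (- (1/12)))\<^sup>2"
        using d d0 by (intro power_mono)
      also have "\<dots> = 144 * (real n powr (-1/3))\<^sup>2 * (s n powr (- (1/12)))\<^sup>2"
        by (simp add: power_mult_distrib)
      also have "(real n powr (-1/3))\<^sup>2 = real n powr (-2/3)"
        using powr_add[of "real n" "-1/3" "-1/3"] by (simp add: power2_eq_square)
      also have "(s n powr (- (1/12)))\<^sup>2 = s n powr (- (7/6)) * s n"
        using elim powr_add[of "s n" "- (1/12)" "- (1/12)"] powr_add[of "s n" "- (7/6)" 1] by (simp add: power2_eq_square)
      also have "144 * real n powr (-2/3) * (s n powr (- (7/6)) * s n) \<le> \<delta> / 4 * s n"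
        unfolding mult.assoc[symmetric] using elim by (intro mult_right_mono) (auto simp: s_def)
      finally have "(d n)\<^sup>2 \<le> \<delta> / 4 * s n" .
      then show ?case using n d d0 elim by (auto simp: s_def)
    qed
  qed
  from at_points show ?thesis
  proof (rule whp_mono, use spacing in eventually_elim, intro ballI impI allI)
    fix n w x assume n: "good n \<and> 0 \<le> d n \<and> d n \<le> 1/2 \<and> (d n)\<^sup>2 \<le> \<delta> / 4 * s n"
      and w: "w \<in> space M" "f n w \<le> ennreal (\<delta> / 8)" and x: "x \<le> b n"
    then have g: "good n" and sn: "0 < s n" by (auto simp: good_def)
    have at_grid: "S t * (linear_A n w t)\<^sup>2 \<le> \<delta> / 8 * s n" if t: "t \<in> T n" for t
    proof -
      have "ennreal (1 / s n) * ennreal (S t * (linear_A n w t)\<^sup>2) \<le> f n w"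
        unfolding f_def using t T(1)[OF g] by (intro mult_left_mono member_le_sum) auto
      also note w(2)
      finally have "ennreal (1 / s n * (S t * (linear_A n w t)\<^sup>2)) \<le> ennreal (\<delta> / 8)"
        using S_bounds sn by (simp add: ennreal_mult'[symmetric])
      then have "1 / s n * (S t * (linear_A n w t)\<^sup>2) \<le> \<delta> / 8" using \<delta> by (simp add: ennreal_le_iff)
      then show ?thesis using sn by (simp add: field_simps)
    qed
    have W: "mono (W n w)"
      unfolding W_def using C_nonneg by (intro monoI divide_right_mono sum_mono) (auto simp: indicator_def)
    have W0: "0 \<le> W n w y" for y
      unfolding W_def using C_nonneg by (intro divide_nonneg_nonneg sum_nonneg) auto
    have d2: "S x * (d n)\<^sup>2 \<le> \<delta> / 4 * s n"
    proof -
      have "S x * (d n)\<^sup>2 \<le> 1 * (d n)\<^sup>2" using S_bounds by (intro mult_right_mono) auto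
      then show ?thesis using n by linarith
    qed
    have "\<bar>W n w x - V n x\<bar> \<le> d n \<or> (\<exists>t\<in>T n. \<bar>W n w x - V n x\<bar> \<le> \<bar>W n w t - V n t\<bar> + d n \<and> V n t - V n x \<le> d n)"
      using n by (intro grid_bracketing[OF T(4)[OF g x] W W0 Vm[OF g]]) auto
    then show "S x * (linear_A n w x)\<^sup>2 \<le> \<delta> * s n"
    proof
      assume "\<bar>W n w x - V n x\<bar> \<le> d n"
      then have "(linear_A n w x)\<^sup>2 \<le> (d n)\<^sup>2"
        unfolding A_eq[OF g x] using n by (metis abs_ge_zero power2_abs power_mono)
      then have "S x * (linear_A n w x)\<^sup>2 \<le> S x * (d n)\<^sup>2" using S_bounds by (intro mult_left_mono) auto
      also note d2
      also have "\<delta> / 4 * s n \<le> \<delta> * s n" using \<delta> sn by simp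
      finally show ?thesis .
    next
      assume "\<exists>t\<in>T n. \<bar>W n w x - V n x\<bar> \<le> \<bar>W n w t - V n t\<bar> + d n \<and> V n t - V n x \<le> d n"
      then obtain t where t: "t \<in> T n" "\<bar>W n w x - V n x\<bar> \<le> \<bar>W n w t - V n t\<bar> + d n" "V n t - V n x \<le> d n" by auto
      have tb: "t \<le> b n" using t T(3)[OF g] by auto
      have St: "0 < S t" "0 < S x" using S_ge g tb x by auto
      have "S x \<le> 2 * S t"
      proof -
        have "ln (S x) - ln (S t) \<le> d n" using t(3) V_eq[OF g] tb x by simp
        then have "ln (S x / S t) \<le> d n" using St by (simp add: ln_div)
        then have "S x / S t \<le> exp (d n)" using St by (metis divide_pos_pos exp_le_cancel_iff exp_ln)
        also have "exp (d n) \<le> 2"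
        proof -
          have "1/2 \<le> 1 - d n" using n by simp
          also have "\<dots> \<le> exp (- d n)" using exp_ge_add_one_self[of "- d n"] by simp
          finally show ?thesis by (simp add: exp_minus field_simps)
        qed
        finally show ?thesis using St by (simp add: field_simps)
      qed
      have "(linear_A n w x)\<^sup>2 \<le> (\<bar>linear_A n w t\<bar> + d n)\<^sup>2"
        using t(2) unfolding A_eq[OF g x] A_eq[OF g tb] by (metis abs_ge_zero power2_abs power_mono)
      also have "\<dots> \<le> 2 * (linear_A n w t)\<^sup>2 + 2 * (d n)\<^sup>2"
        using sum_squares_bound[of "\<bar>linear_A n w t\<bar>" "d n"] by (simp add: power2_sum)
      finally have "S x * (linear_A n w x)\<^sup>2 \<le> S x * (2 * (linear_A n w t)\<^sup>2 + 2 * (d n)\<^sup>2)"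
        using St by (intro mult_left_mono) auto
      also have "\<dots> = S x * (2 * (linear_A n w t)\<^sup>2) + 2 * (S x * (d n)\<^sup>2)" by (simp add: algebra_simps)
      also have "\<dots> \<le> (2 * S t) * (2 * (linear_A n w t)\<^sup>2) + 2 * (\<delta> / 4 * s n)"
        using \<open>S x \<le> 2 * S t\<close> d2 by (intro add_mono mult_right_mono mult_left_mono) auto
      also have "\<dots> \<le> \<delta> * s n" using at_grid[OF t(1)] by simp
      finally show ?thesis .
    qed
  qed
qed

text \<open>The supremum over \<open>x\<close> costs nothing, because \<open>S x \<le> S z\<close> for the points \<open>z \<le> x\<close> that contribute.\<close>

lemma weighted_error_le:
  assumes w: "w \<in> space M" and x: "x \<le> y" "0 < S x"
    and [measurable]: "\<theta> \<in> borel_measurable borel" and \<theta>: "\<And>z. 0 \<le> \<theta> z" "\<And>z. \<theta> z \<le> 1"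
  defines "\<phi> \<equiv> \<lambda>z. indicator {..y} z * \<theta> z * S z / (C z)\<^sup>2"
  shows "ennreal (S x * \<bar>(\<Sum>i<n. indicator {..x} (X i w) * \<theta> (X i w) * (Cn n w (X i w) - C (X i w)) / (C (X i w))\<^sup>2) / n
     - (\<integral>p. indicator {..x} (fst p) * \<theta> (fst p) * (Cn n w (fst p) - C (fst p)) / (C (fst p))\<^sup>2 \<partial>observed)\<bar>)
   \<le> ennreal ((\<Sum>i<n. \<phi> (X i w) * \<bar>Cn n w (X i w) - C (X i w)\<bar>) / n)
     + (\<integral>\<^sup>+p. ennreal (\<phi> (fst p) * \<bar>Cn n w (fst p) - C (fst p)\<bar>) \<partial>observed)"
proof -
  note [measurable] = w
  define g where "g z = indicator {..x} z * \<theta> z * (Cn n w z - C z) / (C z)\<^sup>2" for z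
  have [measurable]: "g \<in> borel_measurable borel" unfolding g_def using risk_freq_measurable'[OF w] by measurable
  have S_g: "S x * \<bar>g z\<bar> \<le> \<phi> z * \<bar>Cn n w z - C z\<bar>" for z
  proof (cases "z \<le> x")
    case True
    have "S x * (\<theta> z * \<bar>Cn n w z - C z\<bar> / (C z)\<^sup>2) \<le> S z * (\<theta> z * \<bar>Cn n w z - C z\<bar> / (C z)\<^sup>2)"
      using S_antimono[OF True] \<theta> by (intro mult_right_mono) auto
    then show ?thesis using True x \<theta> by (simp add: g_def \<phi>_def abs_mult mult_ac)
  qed (use S_bounds \<theta> in \<open>simp add: g_def \<phi>_def\<close>)
  have int: "integrable observed (\<lambda>p. g (fst p))"
    unfolding g_def using \<theta> by (intro integrable_error_div_C2[OF x(2) w]) (auto simp: abs_of_nonneg)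
  have "S x * \<bar>(\<Sum>i<n. g (X i w)) / n\<bar> \<le> S x * ((\<Sum>i<n. \<bar>g (X i w)\<bar>) / n)"
    using x by (intro mult_left_mono) (auto intro!: divide_right_mono)
  also have "\<dots> = (\<Sum>i<n. S x * \<bar>g (X i w)\<bar>) / n" by (simp add: sum_distrib_left)
  also have "\<dots> \<le> (\<Sum>i<n. \<phi> (X i w) * \<bar>Cn n w (X i w) - C (X i w)\<bar>) / n"
    by (intro divide_right_mono sum_mono S_g) auto
  finally have 1: "S x * \<bar>(\<Sum>i<n. g (X i w)) / n\<bar> \<le> (\<Sum>i<n. \<phi> (X i w) * \<bar>Cn n w (X i w) - C (X i w)\<bar>) / n" .
  have "ennreal (S x * \<bar>\<integral>p. g (fst p) \<partial>observed\<bar>) = ennreal (S x) * ennreal \<bar>\<integral>p. g (fst p) \<partial>observed\<bar>"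
    using x by (simp add: ennreal_mult')
  also have "\<dots> \<le> ennreal (S x) * (\<integral>\<^sup>+p. ennreal \<bar>g (fst p)\<bar> \<partial>observed)"
    using integral_norm_bound_ennreal[OF int] by (intro mult_left_mono) auto
  also have "\<dots> = (\<integral>\<^sup>+p. ennreal (S x) * ennreal \<bar>g (fst p)\<bar> \<partial>observed)"
    by (rule nn_integral_cmult[symmetric]) measurable
  also have "\<dots> \<le> (\<integral>\<^sup>+p. ennreal (\<phi> (fst p) * \<bar>Cn n w (fst p) - C (fst p)\<bar>) \<partial>observed)"
    using S_g x by (intro nn_integral_mono) (simp add: ennreal_mult'[symmetric] ennreal_leI)
  finally have 2: "ennreal (S x * \<bar>\<integral>p. g (fst p) \<partial>observed\<bar>)
     \<le> (\<integral>\<^sup>+p. ennreal (\<phi> (fst p) * \<bar>Cn n w (fst p) - C (fst p)\<bar>) \<partial>observed)" .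
  have "ennreal (S x * \<bar>(\<Sum>i<n. g (X i w)) / n - (\<integral>p. g (fst p) \<partial>observed)\<bar>)
    \<le> ennreal (S x * \<bar>(\<Sum>i<n. g (X i w)) / n\<bar> + S x * \<bar>\<integral>p. g (fst p) \<partial>observed\<bar>)"
    unfolding distrib_left[symmetric] using x by (intro ennreal_leI mult_left_mono abs_triangle_ineq4) auto
  also have "\<dots> = ennreal (S x * \<bar>(\<Sum>i<n. g (X i w)) / n\<bar>) + ennreal (S x * \<bar>\<integral>p. g (fst p) \<partial>observed\<bar>)"
    using x by (intro ennreal_plus) auto
  also have "\<dots> \<le> ennreal ((\<Sum>i<n. \<phi> (X i w) * \<bar>Cn n w (X i w) - C (X i w)\<bar>) / n)
     + (\<integral>\<^sup>+p. ennreal (\<phi> (fst p) * \<bar>Cn n w (fst p) - C (fst p)\<bar>) \<partial>observed)"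
    by (intro add_mono ennreal_leI 1 2)
  finally show ?thesis unfolding g_def .
qed

text \<open>
  The degenerate term is split according to the size of \<open>C\<close>. Where \<open>C\<close> is bounded away from \<open>0\<close>,
  the weight \<open>1 / C\<^sup>2\<close> is bounded; where it is small, the term is small in mean absolute value.
\<close>

lemma whp_degenerate:
  assumes \<delta>: "0 < \<delta>"
  shows "whp M (\<lambda>n w. \<forall>x\<le>b n. sqrt n * (S x * \<bar>degenerate n w x\<bar>) \<le> \<delta>)"
  unfolding whp_def
proof (intro allI impI)
  fix \<rho> :: real assume \<rho>: "0 < \<rho>"
  \<comment> \<open>The mean of the part with small \<open>C\<close> will be at most \<open>4 * \<epsilon>\<close>, to be exceeded by \<open>\<delta> / 2\<close> with probability at most \<open>\<rho> / 2\<close>.\<close>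
  define \<epsilon> where "\<epsilon> = \<delta> * \<rho> / 16"
  have \<epsilon>: "0 < \<epsilon>" unfolding \<epsilon>_def using \<delta> \<rho> by simp
  obtain c where c: "0 < c" "(\<integral>\<^sup>+p. ennreal (of_bool (C (fst p) < c) * S (fst p) / (C (fst p))\<^sup>2 * sqrt (C (fst p))) \<partial>observed) \<le> ennreal \<epsilon>"
    using integral_small_C[OF \<epsilon>] by auto
  define \<psi> where "\<psi> z = of_bool (c \<le> C z) / (C z)\<^sup>2" for z
  have [measurable]: "\<psi> \<in> borel_measurable borel" unfolding \<psi>_def by measurable
  obtain B where B: "\<And>z. B < z \<Longrightarrow> C z < c"
  proof -
    have "(F \<longlongrightarrow> 1) at_top" by (rule X.cdf_lim_at_top_prob)
    then have "\<forall>\<^sub>F z in at_top. 1 - \<alpha> * c < F z"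
      using \<alpha>_pos c by (intro order_tendstoD(1)) auto
    then obtain B where B: "\<And>z. B \<le> z \<Longrightarrow> 1 - \<alpha> * c < F z" by (auto simp: eventually_at_top_linorder)
    have "C z < c" if "B < z" for z
    proof -
      have "G z * S z \<le> 1 * S z" using G_bounds S_bounds by (intro mult_right_mono) auto
      also have "\<dots> < \<alpha> * c" using B[of z] that by (simp add: S_def)
      finally show ?thesis using \<alpha>_pos by (simp add: C_def field_simps)
    qed
    then show thesis using that by blast
  qed
  have "whp M (\<lambda>n w. \<forall>x. sqrt n *
    \<bar>(\<Sum>i<n. \<psi> (X i w) * indicator {..x} (X i w) * (Cn n w (X i w) - risk_prob (X i w))) / n
      - (\<integral>p. \<psi> (fst p) * indicator {..x} (fst p) * (Cn n w (fst p) - risk_prob (fst p)) \<partial>observed)\<bar> \<le> \<delta> / 2)"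
  proof (rule degenerate_term_bounded_weight[where B = "1 / c\<^sup>2" and b = B])
    show "\<psi> z \<le> 1 / c\<^sup>2" for z
      unfolding \<psi>_def using c power_mono[of c "C z" 2] by (auto intro!: divide_left_mono mult_pos_pos)
    show "B < z \<Longrightarrow> \<psi> z = 0" for z using B[of z] by (simp add: \<psi>_def)
  qed (use \<delta> in \<open>auto simp: \<psi>_def\<close>)
  then have mid: "\<forall>\<^sub>F n in sequentially. \<exists>A\<in>sets M. measure M A \<le> \<rho> / 2 \<and> (\<forall>w\<in>space M - A. \<forall>x. sqrt n *
    \<bar>(\<Sum>i<n. \<psi> (X i w) * indicator {..x} (X i w) * (Cn n w (X i w) - C (X i w))) / n
      - (\<integral>p. \<psi> (fst p) * indicator {..x} (fst p) * (Cn n w (fst p) - C (fst p)) \<partial>observed)\<bar> \<le> \<delta> / 2)"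
    using \<rho> by (intro whpD) auto

  define \<theta> :: "real \<Rightarrow> real" where "\<theta> z = of_bool (C z < c)" for z
  have [measurable]: "\<theta> \<in> borel_measurable borel" unfolding \<theta>_def by measurable
  define \<phi> where "\<phi> n z = indicator {..b n} z * \<theta> z * S z / (C z)\<^sup>2" for n z
  have [measurable]: "\<phi> n \<in> borel_measurable borel" for n unfolding \<phi>_def by measurable
  have \<phi>: "0 \<le> \<phi> n z" for n z unfolding \<phi>_def \<theta>_def using S_bounds by simp
  define f where "f n w = ennreal (sqrt n) * (ennreal ((\<Sum>i<n. \<phi> n (X i w) * \<bar>Cn n w (X i w) - C (X i w)\<bar>) / n)
     + (\<integral>\<^sup>+p. ennreal (\<phi> n (fst p) * \<bar>Cn n w (fst p) - C (fst p)\<bar>) \<partial>observed))" for n w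
  have fm: "f n \<in> borel_measurable M" for n unfolding f_def by measurable
  have tail: "\<forall>\<^sub>F n in sequentially. \<exists>A\<in>sets M. measure M A \<le> \<rho> / 2 \<and> (\<forall>w\<in>space M - A. f n w \<le> ennreal (\<delta> / 2))"
  proof -
    have "(\<lambda>n. 2 * \<alpha> * K * real n powr (-1/2) * (\<eta> * real n powr (-1/2)) powr (- (1/4))) \<longlonglongrightarrow> 0"
      using \<eta> by (intro rate_tendsto_0) auto
    then have "\<forall>\<^sub>F n in sequentially. 2 * \<alpha> * K * real n powr (-1/2) * (\<eta> * real n powr (-1/2)) powr (- (1/4)) < 2 * \<epsilon>"
      using \<epsilon> by (intro order_tendstoD(2)) auto
    with eventually_b show ?thesis
    proof eventually_elim
      case (elim n)
      have I1: "(\<integral>\<^sup>+p. ennreal (\<phi> n (fst p)) \<partial>observed) \<le> ennreal (\<alpha> * s n powr (- 1/4) * K)"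
      proof (rule order_trans)
        show "(\<integral>\<^sup>+p. ennreal (\<phi> n (fst p)) \<partial>observed)
            \<le> (\<integral>\<^sup>+p. ennreal (indicator {..b n} (fst p) * S (fst p) / (C (fst p))\<^sup>2) \<partial>observed)"
          using S_bounds by (intro nn_integral_mono ennreal_leI) (auto simp: \<phi>_def \<theta>_def)
        show "\<dots> \<le> ennreal (\<alpha> * s n powr (- 1/4) * K)"
          using elim by (intro integral_S_div_C2) auto
      qed
      have I2: "(\<integral>\<^sup>+p. ennreal (\<phi> n (fst p) * sqrt (C (fst p))) \<partial>observed) \<le> ennreal \<epsilon>"
      proof (rule order_trans[OF _ c(2)])
        show "(\<integral>\<^sup>+p. ennreal (\<phi> n (fst p) * sqrt (C (fst p))) \<partial>observed)
            \<le> (\<integral>\<^sup>+p. ennreal (of_bool (C (fst p) < c) * S (fst p) / (C (fst p))\<^sup>2 * sqrt (C (fst p))) \<partial>observed)"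
          using S_bounds C_nonneg by (intro nn_integral_mono ennreal_leI) (auto simp: \<phi>_def \<theta>_def indicator_def)
      qed
      have "(\<integral>\<^sup>+w. f n w \<partial>M) = ennreal (sqrt n) * ((\<integral>\<^sup>+w. ennreal ((\<Sum>i<n. \<phi> n (X i w) * \<bar>Cn n w (X i w) - C (X i w)\<bar>) / n) \<partial>M)
         + (\<integral>\<^sup>+w. (\<integral>\<^sup>+p. ennreal (\<phi> n (fst p) * \<bar>Cn n w (fst p) - C (fst p)\<bar>) \<partial>observed) \<partial>M))"
        unfolding f_def by (simp add: nn_integral_cmult nn_integral_add)
      also have "\<dots> \<le> ennreal (sqrt n) * ((ennreal (2 / n) * ennreal (\<alpha> * s n powr (- 1/4) * K) + ennreal (1 / sqrt n) * ennreal \<epsilon>)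
         + ennreal (1 / sqrt n) * ennreal \<epsilon>)"
        using elim \<phi> I1 I2
        by (intro mult_left_mono add_mono order_trans[OF mean_error_at_observations] order_trans[OF mean_error_at_fixed_points]) auto
      also have "\<dots> = ennreal (sqrt n * ((2 / n) * (\<alpha> * s n powr (- 1/4) * K) + (1 / sqrt n) * \<epsilon> + (1 / sqrt n) * \<epsilon>))"
        using \<epsilon> \<alpha>_pos K_finite(2) by (simp add: ennreal_mult'[symmetric] ennreal_plus[symmetric] del: ennreal_plus)
      also have "sqrt n * ((2 / n) * (\<alpha> * s n powr (- 1/4) * K) + (1 / sqrt n) * \<epsilon> + (1 / sqrt n) * \<epsilon>)
          = 2 * \<alpha> * K * (sqrt n / n) * s n powr (- 1/4) + 2 * \<epsilon>"
        using elim by (simp add: distrib_left)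
      also have "\<dots> \<le> 4 * \<epsilon>" using elim sqrt_div_eq_powr[of n] by (simp add: s_def)
      also have "ennreal (4 * \<epsilon>) = ennreal (\<delta> / 2 * (\<rho> / 2))" by (simp add: \<epsilon>_def)
      finally show ?case using \<delta> \<rho> by (intro Markov_exceptional_set fm prob_space_axioms) (auto intro: ennreal_leI)
    qed
  qed
  from mid tail eventually_b
  show "\<forall>\<^sub>F n in sequentially. \<exists>A\<in>sets M. measure M A \<le> \<rho> \<and> (\<forall>w\<in>space M - A. \<forall>x\<le>b n. sqrt n * (S x * \<bar>degenerate n w x\<bar>) \<le> \<delta>)"
  proof eventually_elim
    case (elim n)
    then obtain A A' where A: "A \<in> sets M" "measure M A \<le> \<rho> / 2" "\<And>w x. w \<in> space M - A \<Longrightarrow> sqrt n *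
      \<bar>(\<Sum>i<n. \<psi> (X i w) * indicator {..x} (X i w) * (Cn n w (X i w) - C (X i w))) / n
      - (\<integral>p. \<psi> (fst p) * indicator {..x} (fst p) * (Cn n w (fst p) - C (fst p)) \<partial>observed)\<bar> \<le> \<delta> / 2"
      and A': "A' \<in> sets M" "measure M A' \<le> \<rho> / 2" "\<And>w. w \<in> space M - A' \<Longrightarrow> f n w \<le> ennreal (\<delta> / 2)"
      by blast
    have "sqrt n * (S x * \<bar>degenerate n w x\<bar>) \<le> \<delta>" if w: "w \<in> space M - (A \<union> A')" and x: "x \<le> b n" for w x
    proof -
      have wM: "w \<in> space M" using w by simp
      have Sx: "0 < S x" using S_antimono[OF x] elim by simp
      define u v where "u z = \<psi> z * indicator {..x} z * (Cn n w z - C z)"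
        and "v z = indicator {..x} z * \<theta> z * (Cn n w z - C z) / (C z)\<^sup>2" for z
      have split: "indicator {..x} z * (C z - Cn n w z) / (C z)\<^sup>2 = - (u z + v z)" for z
        unfolding u_def v_def \<psi>_def \<theta>_def by (cases "c \<le> C z"; cases "z \<le> x") (simp_all add: diff_divide_distrib)
      have [measurable]: "u \<in> borel_measurable borel" "v \<in> borel_measurable borel"
        unfolding u_def v_def using risk_freq_measurable'[OF wM] by measurable
      have iv: "integrable observed (\<lambda>p. v (fst p))"
        unfolding v_def by (intro integrable_error_div_C2[OF Sx wM]) (auto simp: \<theta>_def)
      have iu: "integrable observed (\<lambda>p. u (fst p))"
      proof -
        have "integrable observed (\<lambda>p. indicator {..x} (fst p) * (1 - \<theta> (fst p)) * (Cn n w (fst p) - C (fst p)) / (C (fst p))\<^sup>2)"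
          by (intro integrable_error_div_C2[OF Sx wM]) (auto simp: \<theta>_def)
        moreover have "indicator {..x} z * (1 - \<theta> z) * (Cn n w z - C z) / (C z)\<^sup>2 = u z" for z
          unfolding u_def \<psi>_def \<theta>_def by (cases "c \<le> C z") auto
        ultimately show ?thesis by simp
      qed
      define U where "U = (\<Sum>i<n. u (X i w)) / n - (\<integral>p. u (fst p) \<partial>observed)"
      define V where "V = (\<Sum>i<n. v (X i w)) / n - (\<integral>p. v (fst p) \<partial>observed)"
      have deg: "degenerate n w x = - (U + V)"
        unfolding degenerate_def split U_def V_def using iu iv
        by (simp add: sum_subtractf sum_negf diff_divide_distrib)
      have U: "sqrt n * \<bar>U\<bar> \<le> \<delta> / 2" unfolding U_def u_def using A(3) w by blast
      have "ennreal (sqrt n * (S x * \<bar>V\<bar>)) = ennreal (sqrt n) * ennreal (S x * \<bar>V\<bar>)"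
        by (simp add: ennreal_mult')
      also have "\<dots> \<le> f n w"
        unfolding f_def V_def v_def \<phi>_def using wM x Sx by (intro mult_left_mono weighted_error_le) (auto simp: \<theta>_def)
      also have "\<dots> \<le> ennreal (\<delta> / 2)" using A'(3) w by blast
      finally have V: "sqrt n * (S x * \<bar>V\<bar>) \<le> \<delta> / 2" using \<delta> by (simp add: ennreal_le_iff)
      have "S x * \<bar>degenerate n w x\<bar> \<le> S x * (\<bar>U\<bar> + \<bar>V\<bar>)"
        unfolding deg using Sx by (intro mult_left_mono) auto
      also have "\<dots> \<le> \<bar>U\<bar> + S x * \<bar>V\<bar>"
        using S_bounds[of x] by (simp add: distrib_left mult_left_le_one_le)
      finally have "sqrt n * (S x * \<bar>degenerate n w x\<bar>) \<le> sqrt n * (\<bar>U\<bar> + S x * \<bar>V\<bar>)"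
        by (rule mult_left_mono) simp
      then show ?thesis using U V by (simp add: distrib_left)
    qed
    moreover have "measure M (A \<union> A') \<le> \<rho>"
      using measure_Un_le[of A M A'] A A' by simp
    ultimately show ?case using A A' by (intro bexI[of _ "A \<union> A'"]) auto
  qed
qed

text \<open>The two nondecreasing parts of the linear term beyond \<open>b n\<close>, with the weight \<open>S\<close> inside.\<close>

definition tail_bound :: "nat \<Rightarrow> 'a \<Rightarrow> ennreal" where
  "tail_bound n w = ennreal ((\<Sum>i<n. indicator {b n<..} (X i w) * S (X i w) / C (X i w)) / n)
    + (\<integral>\<^sup>+p. ennreal (indicator {b n<..} (fst p) * S (fst p) / (C (fst p))\<^sup>2 * Cn n w (fst p)) \<partial>observed)"

lemma tail_bound_measurable [measurable]: "tail_bound n \<in> borel_measurable M"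
proof -
  show ?thesis unfolding tail_bound_def by measurable
qed

lemma mean_tail_bound:
  assumes n: "0 < n" "S (b n) = s n"
  shows "(\<integral>\<^sup>+w. ennreal (sqrt n) * tail_bound n w \<partial>M) \<le> ennreal (2 * \<eta>)"
proof -
  have "(\<integral>\<^sup>+p. ennreal (indicator {b n<..} (fst p) * S (fst p) / (C (fst p))\<^sup>2 * C (fst p)) \<partial>observed)
    = (\<integral>\<^sup>+p. ennreal (indicator {b n<..} (fst p) * S (fst p) / C (fst p)) \<partial>observed)"
    by (intro nn_integral_cong) (simp add: power2_eq_square)
  also have "\<dots> = ennreal (s n)" unfolding integral_S_div_C_beyond n(2) ..
  finally have 1: "(\<integral>\<^sup>+p. ennreal (indicator {b n<..} (fst p) * S (fst p) / (C (fst p))\<^sup>2 * C (fst p)) \<partial>observed) = ennreal (s n)" .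
  have "(\<integral>\<^sup>+w. tail_bound n w \<partial>M) = (\<integral>\<^sup>+w. ennreal ((\<Sum>i<n. indicator {b n<..} (X i w) * S (X i w) / C (X i w)) / n) \<partial>M)
    + (\<integral>\<^sup>+w. (\<integral>\<^sup>+p. ennreal (indicator {b n<..} (fst p) * S (fst p) / (C (fst p))\<^sup>2 * Cn n w (fst p)) \<partial>observed) \<partial>M)"
    unfolding tail_bound_def by (rule nn_integral_add) measurable
  also have "(\<integral>\<^sup>+w. ennreal ((\<Sum>i<n. indicator {b n<..} (X i w) * S (X i w) / C (X i w)) / n) \<partial>M) = ennreal (s n)"
    using mean_average_at_observations[of "\<lambda>z. indicator {b n<..} z * S z / C z" n] n S_bounds C_nonneg
    by (simp add: integral_S_div_C_beyond)
  also have "(\<integral>\<^sup>+w. (\<integral>\<^sup>+p. ennreal (indicator {b n<..} (fst p) * S (fst p) / (C (fst p))\<^sup>2 * Cn n w (fst p)) \<partial>observed) \<partial>M) = ennreal (s n)"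
    using mean_Cn_integral[of "\<lambda>z. indicator {b n<..} z * S z / (C z)\<^sup>2" n] n S_bounds 1 by simp
  finally have "(\<integral>\<^sup>+w. ennreal (sqrt n) * tail_bound n w \<partial>M) = ennreal (sqrt n) * (ennreal (s n) + ennreal (s n))"
    by (simp add: nn_integral_cmult)
  also have "\<dots> = ennreal (2 * (sqrt n * s n))"
    using \<eta> by (simp add: s_def ennreal_mult'[symmetric] ennreal_plus[symmetric] algebra_simps del: ennreal_plus)
  also have "sqrt n * s n = \<eta>"
    using n \<eta> by (simp add: s_def powr_minus_divide powr_half_sqrt)
  finally show ?thesis by simp
qed

end

section \<open>The Lynden-Bell estimator on a fixed sample\<close>

lemma left_limit_emp_Fstar: "left_limit (emp_Fstar n xs) z = (\<Sum>i<n. of_bool (xs i < z)) / n"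
proof -
  have "((\<lambda>x. of_bool (xs i \<le> x) :: real) \<longlongrightarrow> of_bool (xs i < z)) (at_left z)" for i
  proof (rule tendsto_eventually)
    show "\<forall>\<^sub>F x in at_left z. (of_bool (xs i \<le> x) :: real) = of_bool (xs i < z)"
    proof (cases "xs i < z")
      case True
      show ?thesis
        using eventually_at_left_real[OF True] by eventually_elim (use True in auto)
    next
      case False
      then show ?thesis
        using eventually_at_left_real[of "z - 1" z] by (auto elim!: eventually_mono)
    qed
  qed
  then have "(emp_Fstar n xs \<longlongrightarrow> (\<Sum>i<n. of_bool (xs i < z)) / n) (at_left z)"
    unfolding emp_Fstar_def[abs_def] divide_inverse by (intro tendsto_intros)
  then show ?thesis unfolding left_limit_def by (intro tendsto_Lim) auto
qed

lemma jump_emp_Fstar: "jump (emp_Fstar n xs) z = (\<Sum>i<n. of_bool (xs i = z)) / n"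
proof -
  have "of_bool (xs i \<le> z) - of_bool (xs i < z) = (of_bool (xs i = z) :: real)" for i by auto
  then show ?thesis
    unfolding jump_def left_limit_emp_Fstar emp_Fstar_def
    by (simp only: diff_divide_distrib[symmetric] sum_subtractf[symmetric])
qed

lemma lynden_bell_distinct:
  assumes "inj_on xs {..<n}"
  shows "lynden_bell n xs ys x = 1 - (\<Prod>i\<in>{i. i < n \<and> xs i \<le> x}. 1 - 1 / (n * emp_C n xs ys (xs i)))"
proof -
  have set: "{z \<in> xs ` {..<n}. z \<le> x} = xs ` {i. i < n \<and> xs i \<le> x}" by auto
  have "(\<Prod>z\<in>{z \<in> xs ` {..<n}. z \<le> x}. 1 - jump (emp_Fstar n xs) z / emp_C n xs ys z)
     = (\<Prod>i\<in>{i. i < n \<and> xs i \<le> x}. 1 - jump (emp_Fstar n xs) (xs i) / emp_C n xs ys (xs i))"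
    unfolding set by (subst prod.reindex) (auto intro: inj_on_subset[OF assms])
  also have "\<dots> = (\<Prod>i\<in>{i. i < n \<and> xs i \<le> x}. 1 - 1 / (n * emp_C n xs ys (xs i)))"
  proof (intro prod.cong refl)
    fix i assume "i \<in> {i. i < n \<and> xs i \<le> x}"
    then have i: "i < n" by simp
    have "(\<Sum>j<n. of_bool (xs j = xs i) :: real) = (\<Sum>j<n. if j = i then 1 else 0)"
      using assms i by (intro sum.cong) (auto simp: inj_on_def)
    also have "\<dots> = 1" using i by simp
    finally show "1 - jump (emp_Fstar n xs) (xs i) / emp_C n xs ys (xs i) = 1 - 1 / (n * emp_C n xs ys (xs i))"
      by (simp add: jump_emp_Fstar)
  qed
  finally show ?thesis unfolding lynden_bell_def by simp
qed

lemma interval_measure_cdf: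
  assumes "real_distribution M"
  shows "interval_measure (cdf M) = M"
proof -
  interpret real_distribution M by fact
  note cdf_facts = cdf_nondecreasing cdf_is_right_cont cdf_lim_at_bot
  show ?thesis
    by (rule cdf_unique) (use assms real_distribution_interval_measure[of "cdf M"] cdf_interval_measure[of "cdf M"]
      cdf_facts cdf_lim_at_top_prob in auto)
qed

lemma integral_emp_Fstar:
  fixes f :: "real \<Rightarrow> real"
  assumes n: "0 < n" and [measurable]: "f \<in> borel_measurable borel"
  shows "(LINT y|interval_measure (emp_Fstar n xs). f y) = (\<Sum>i<n. f (xs i)) / n"
proof -
  let ?U = "uniform_count_measure {..<n}"
  interpret U: prob_space ?U using n by (intro prob_space_uniform_count_measure) auto
  have m[measurable]: "xs \<in> measurable ?U borel" by (simp add: measurable_def sets_uniform_count_measure space_uniform_count_measure)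
  have rd: "real_distribution (distr ?U borel xs)" by (rule U.real_distribution_distr[OF m])
  have "cdf (distr ?U borel xs) x = emp_Fstar n xs x" for x
  proof -
    have "cdf (distr ?U borel xs) x = measure ?U {i. i < n \<and> xs i \<le> x}"
      unfolding cdf_def by (subst measure_distr[OF m]) (auto simp: space_uniform_count_measure intro!: arg_cong[of _ _ "measure ?U"])
    also have "\<dots> = real (card {i. i < n \<and> xs i \<le> x}) / n"
      by (subst measure_uniform_count_measure) auto
    also have "\<dots> = emp_Fstar n xs x"
      unfolding emp_Fstar_def by (simp add: lessThan_def Int_def)
    finally show ?thesis .
  qed
  then have "emp_Fstar n xs = cdf (distr ?U borel xs)" by auto
  then have "(LINT y|interval_measure (emp_Fstar n xs). f y) = (\<integral>y. f y \<partial>distr ?U borel xs)"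
    using interval_measure_cdf[OF rd] by simp
  also have "\<dots> = (\<integral>i. f (xs i) \<partial>?U)" by (rule integral_distr[OF m]) simp
  also have "\<dots> = (\<Sum>i<n. f (xs i)) / n"
    unfolding uniform_count_measure_def
    by (subst lebesgue_integral_point_measure_finite) (auto simp: sum_divide_distrib)
  finally show ?thesis .
qed

lemma exp_minus_linear_bound:
  fixes y :: real
  assumes "\<bar>y\<bar> \<le> 1"
  shows "\<bar>exp y - 1 - y\<bar> \<le> y\<^sup>2"
proof -
  have "exp y \<le> 1 + y + y\<^sup>2"
  proof (cases "0 \<le> y")
    case True
    then show ?thesis using assms by (intro exp_bound) auto
  next
    case False
    define t where "t = - y"
    have t: "0 < t" using False by (simp add: t_def)
    have "1 + t \<le> exp t" by (rule exp_ge_add_one_self)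
    then have "exp y \<le> 1 / (1 + t)" using t by (simp add: t_def exp_minus field_simps)
    also have "\<dots> \<le> 1 - t + t\<^sup>2"
    proof -
      have "1 \<le> (1 - t + t\<^sup>2) * (1 + t)" using t by (simp add: algebra_simps power2_eq_square)
      then show ?thesis using t by (simp add: pos_divide_le_eq)
    qed
    finally show ?thesis by (simp add: t_def)
  qed
  then show ?thesis using exp_ge_add_one_self[of y] by linarith
qed

context truncation_model
begin

lemma psi_eq: "psi F x y = indicator {..x} y * S x"
proof -
  have "interval_measure F = \<mu>" by (rule interval_measure_cdf) unfold_locales
  then have "psi F x y = (\<integral>z. indicator {z. y < z} z * (indicator {..x} y - indicator {..x} z) \<partial>\<mu>)"
    by (simp add: psi_def set_lebesgue_integral_def)
  also have "\<dots> = (\<integral>z. indicator {..x} y * indicator {x<..} z \<partial>\<mu>)"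
    by (intro Bochner_Integration.integral_cong) (auto simp: indicator_def)
  also have "\<dots> = indicator {..x} y * measure \<mu> (space \<mu> - {..x})"
  proof -
    have "{x<..} = space \<mu> - {..x}" by auto
    then show ?thesis by simp
  qed
  also have "\<dots> = indicator {..x} y * S x"
    using X.prob_compl[of "{..x}"] by (simp add: S_def cdf_def)
  finally show ?thesis .
qed

lemma integral_observed_cdf:
  fixes f :: "real \<Rightarrow> real"
  assumes [measurable]: "f \<in> borel_measurable borel"
  shows "(LINT y|interval_measure (cdf (distr observed borel fst)). f y) = (\<integral>p. f (fst p) \<partial>observed)"
proof -
  have "interval_measure (cdf (distr observed borel fst)) = distr observed borel fst"
    by (intro interval_measure_cdf P.real_distribution_distr) simp
  then show ?thesis by (simp add: integral_distr)
qed

lemma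
  assumes "0 < S x"
  shows integrable_inverse_C: "integrable observed (\<lambda>p. indicator {..x} (fst p) / C (fst p))"
    and integral_inverse_C: "(\<integral>p. indicator {..x} (fst p) / C (fst p) \<partial>observed) = - ln (S x)"
proof -
  show "integrable observed (\<lambda>p. indicator {..x} (fst p) / C (fst p))"
    using integral_hazard[OF assms] C_nonneg by (intro integrableI_nonneg) auto
  show "(\<integral>p. indicator {..x} (fst p) / C (fst p) \<partial>observed) = - ln (S x)"
    using integral_hazard[OF assms] C_nonneg assms S_bounds[of x]
    by (subst integral_eq_nn_integral) auto
qed

end

context truncated_sample
begin

abbreviation Fn :: "nat \<Rightarrow> 'a \<Rightarrow> real \<Rightarrow> real" where
  "Fn n w x \<equiv> lynden_bell n (\<lambda>i. X i w) (\<lambda>i. snd (Z i w)) x"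

abbreviation R :: "nat \<Rightarrow> 'a \<Rightarrow> real \<Rightarrow> real" where
  "R n w x \<equiv> remainder F (cdf (distr observed borel fst)) C n (\<lambda>i. X i w) (\<lambda>i. snd (Z i w)) x"

lemma emp_C_eq: "emp_C n (\<lambda>i. X i w) (\<lambda>i. snd (Z i w)) = Cn n w"
  by (simp add: emp_C_def risk_freq_def risk_def fun_eq_iff)

lemma R_eq:
  assumes w: "w \<in> space M" and n: "0 < n"
  shows "R n w x = Fn n w x - F x - S x * ((\<Sum>i<n. indicator {..x} (X i w) / C (X i w)) / n
    - (\<integral>p. indicator {..x} (fst p) / C (fst p) \<partial>observed) - linear_E n w x)"
proof -
  note [measurable] = risk_freq_measurable'[OF w]
  have "(LINT y|interval_measure (emp_Fstar n (\<lambda>i. X i w)). psi F x y / C y)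
     = S x * ((\<Sum>i<n. indicator {..x} (X i w) / C (X i w)) / n)"
    unfolding psi_eq by (subst integral_emp_Fstar[OF n]) (auto simp: sum_distrib_left mult_ac)
  moreover have "(LINT y|interval_measure (cdf (distr observed borel fst)). psi F x y / C y)
     = S x * (\<integral>p. indicator {..x} (fst p) / C (fst p) \<partial>observed)"
    unfolding psi_eq integral_mult_right_zero[symmetric] by (subst integral_observed_cdf) (auto simp: mult_ac)
  moreover have "(LINT y|interval_measure (cdf (distr observed borel fst)). (Cn n w y - C y) / (C y)\<^sup>2 * psi F x y)
     = S x * linear_E n w x"
    unfolding psi_eq linear_E_def integral_mult_right_zero[symmetric] by (subst integral_observed_cdf) (auto simp: mult_ac)
  ultimately show ?thesis
    unfolding remainder_def emp_C_eq by (simp add: algebra_simps)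
qed

lemma R_eq_linear:
  assumes w: "w \<in> space M" and n: "0 < n" and "0 < S x"
  shows "R n w x = Fn n w x - F x - S x * (linear_A n w x - linear_E n w x)"
  unfolding R_eq[OF w n] linear_A_def integral_inverse_C[OF assms(3)] ..

definition regular :: "nat \<Rightarrow> 'a \<Rightarrow> bool" where
  "regular n w \<longleftrightarrow> w \<in> space M \<and> 0 < n \<and> inj_on (\<lambda>i. X i w) {..<n} \<and> (\<forall>i<n. snd (Z i w) \<le> X i w \<and> 0 < C (X i w))"

lemma AE_regular:
  assumes n: "0 < n"
  shows "AE w in M. regular n w"
proof -
  have "AE w in M. X i w \<noteq> X j w" if "i \<noteq> j" for i j
  proof -
    have singleton: "(\<Sum>k\<in>{j}. f k) = f j" for f :: "nat \<Rightarrow> real" by simp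
    have "(\<integral>\<^sup>+w. ennreal (\<Sum>k\<in>{j}. of_bool (X i w = X k w)) \<partial>M)
      = (\<integral>\<^sup>+p. (\<integral>\<^sup>+w. ennreal (\<Sum>k\<in>{j}. of_bool (fst p = X k w)) \<partial>M) \<partial>observed)"
      using that by (intro leave_one_out[of "\<lambda>p q. of_bool (fst p = fst q)" "\<lambda>_. ennreal"]) auto
    also have "\<dots> = (\<integral>\<^sup>+p. 0 \<partial>observed)"
    proof (rule nn_integral_cong)
      fix p :: "real \<times> real"
      have "AE z in \<mu>. z \<noteq> fst p"
        by (rule AE_I'[of "{fst p}"]) (auto simp: null_sets_def X.emeasure_eq_measure X_no_atom)
      then have "AE q in observed. fst q \<noteq> fst p" by (rule AE_observed_fst) measurable
      from AE_Z[OF this, of j] have "AE w in M. X j w \<noteq> fst p" .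
      then have "(\<integral>\<^sup>+w. ennreal (\<Sum>k\<in>{j}. of_bool (fst p = X k w)) \<partial>M) = (\<integral>\<^sup>+w. 0 \<partial>M)"
        by (intro nn_integral_cong_AE) (auto elim!: eventually_mono)
      then show "(\<integral>\<^sup>+w. ennreal (\<Sum>k\<in>{j}. of_bool (fst p = X k w)) \<partial>M) = 0" by simp
    qed
    finally have "(\<integral>\<^sup>+w. ennreal (of_bool (X i w = X j w)) \<partial>M) = 0"
      unfolding singleton by simp
    then have "AE w in M. ennreal (of_bool (X i w = X j w)) = 0"
      by (subst (asm) nn_integral_0_iff_AE) auto
    then show ?thesis by eventually_elim (auto simp: of_bool_def split: if_splits)
  qed
  then have 1: "AE w in M. \<forall>i j. i \<noteq> j \<longrightarrow> X i w \<noteq> X j w"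
    unfolding AE_all_countable by auto
  have 2: "AE w in M. \<forall>i. snd (Z i w) \<le> X i w" "AE w in M. \<forall>i. 0 < C (X i w)"
    unfolding AE_all_countable using AE_Z[OF AE_observed_ordered] AE_Z[OF AE_observed_C_pos] by auto
  show ?thesis
    using 1 2 AE_space[of M] n unfolding regular_def
    by (auto elim!: eventually_elim2 simp: inj_on_def intro: AE_mp)
qed

context
  fixes n w assumes reg: "regular n w"
begin

lemma own_risk_set: "i < n \<Longrightarrow> 1 \<le> n * Cn n w (X i w)"
proof -
  assume i: "i < n"
  have "risk (X i w) (Z i w) \<le> (\<Sum>j<n. risk (X i w) (Z j w))"
    using i by (intro member_le_sum) (auto simp: risk_bounds)
  then show ?thesis
    using reg i n_times_Cn[of n w "X i w"] by (simp add: regular_def risk_def)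
qed

lemma one_minus_Fn: "1 - Fn n w x = (\<Prod>i\<in>{i. i < n \<and> X i w \<le> x}. 1 - 1 / (n * Cn n w (X i w)))"
  using lynden_bell_distinct[of "\<lambda>i. X i w" n] reg by (simp add: regular_def emp_C_eq)

lemma Fn_factor_bounds:
  assumes "i < n"
  shows "0 \<le> 1 - 1 / (n * Cn n w (X i w))" "1 - 1 / (n * Cn n w (X i w)) \<le> 1"
  using own_risk_set[OF assms] by auto

lemma Fn_bounds: "0 \<le> 1 - Fn n w x" "1 - Fn n w x \<le> 1"
  unfolding one_minus_Fn using Fn_factor_bounds by (auto intro!: prod_nonneg prod_le_1)

lemma Fn_mono:
  assumes "x \<le> y"
  shows "1 - Fn n w y \<le> 1 - Fn n w x"
proof -
  let ?u = "\<lambda>i. 1 - 1 / (n * Cn n w (X i w))"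
  have "{i. i < n \<and> X i w \<le> y} = {i. i < n \<and> X i w \<le> x} \<union> {i. i < n \<and> x < X i w \<and> X i w \<le> y}"
    using assms by auto
  then have "1 - Fn n w y = (\<Prod>i\<in>{i. i < n \<and> X i w \<le> x} \<union> {i. i < n \<and> x < X i w \<and> X i w \<le> y}. ?u i)"
    unfolding one_minus_Fn by simp
  also have "\<dots> = (1 - Fn n w x) * (\<Prod>i\<in>{i. i < n \<and> x < X i w \<and> X i w \<le> y}. ?u i)"
    unfolding one_minus_Fn by (rule prod.union_disjoint) auto
  also have "\<dots> \<le> (1 - Fn n w x) * 1"
    using Fn_bounds Fn_factor_bounds by (intro mult_left_mono prod_le_1) auto
  finally show ?thesis by simp
qed

text \<open>
  Taking logarithms turns the product into the empirical cumulative hazard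
  \<open>\<Sum>i. 1 / (n * C\<^sub>n (X i))\<close>, up to squares of its terms. Then
  \<open>1 / C\<^sub>n = 1 / C + (C - C\<^sub>n) / C\<^sup>2 + (C - C\<^sub>n)\<^sup>2 / (C\<^sub>n * C\<^sup>2)\<close> separates the linear term, the degenerate
  term and a square error.
\<close>

lemma log_survival_expansion:
  assumes b: "0 < S b" and x: "x \<le> b"
    and two: "\<And>i. i < n \<Longrightarrow> X i w \<le> b \<Longrightarrow> 2 \<le> n * Cn n w (X i w)"
  shows "0 < 1 - Fn n w x"
    and "S x * \<bar>(ln (S x) - ln (1 - Fn n w x)) - (linear_A n w x - linear_E n w x)\<bar>
      \<le> 2 * (\<Sum>i<n. indicator {..b} (X i w) * S (X i w) / (n * Cn n w (X i w))\<^sup>2)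
       + (\<Sum>i<n. indicator {..b} (X i w) * S (X i w) / (C (X i w))\<^sup>2 * ((C (X i w) - Cn n w (X i w))\<^sup>2 / Cn n w (X i w))) / n
       + S x * \<bar>degenerate n w x\<bar>"
proof -
  have n: "0 < n" and w: "w \<in> space M" and Cpos: "\<And>i. i < n \<Longrightarrow> 0 < C (X i w)"
    using reg by (auto simp: regular_def)
  have Sx: "0 < S x" using b S_antimono[OF x] by simp
  define I where "I = {i. i < n \<and> X i w \<le> x}"
  define u where "u i = 1 / (n * Cn n w (X i w))" for i
  have fin: "finite I" unfolding I_def by simp
  have I: "i < n" "0 \<le> u i" "u i \<le> 1/2" "0 < Cn n w (X i w)" if "i \<in> I" for i
  proof -
    show i: "i < n" using that by (simp add: I_def)
    have "2 \<le> n * Cn n w (X i w)" using that x by (intro two) (auto simp: I_def)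
    then show "0 \<le> u i" "u i \<le> 1/2" unfolding u_def by (auto simp: field_simps)
    show "0 < Cn n w (X i w)" using own_risk_set[OF i] risk_freq_bounds[of n w "X i w"]
      by (metis less_eq_real_def mult_zero_right not_one_le_zero)
  qed
  have prod: "1 - Fn n w x = (\<Prod>i\<in>I. 1 - u i)" unfolding one_minus_Fn I_def u_def ..
  have pos: "0 < 1 - u i" if "i \<in> I" for i using I(3)[OF that] by simp
  show Fpos: "0 < 1 - Fn n w x" unfolding prod using pos by (intro prod_pos) auto
  have ln: "ln (1 - Fn n w x) = (\<Sum>i\<in>I. ln (1 - u i))" unfolding prod using pos fin by (intro ln_prod) fastforce+
  have ln_error: "\<bar>- ln (1 - u i) - u i\<bar> \<le> 2 * (u i)\<^sup>2" if "i \<in> I" for i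
    using ln_one_minus_pos_lower_bound[of "u i"] ln_le_minus_one[OF pos[OF that]] I[OF that] by simp
  have E1: "S x * \<bar>- ln (1 - Fn n w x) - (\<Sum>i\<in>I. u i)\<bar>
    \<le> 2 * (\<Sum>i<n. indicator {..b} (X i w) * S (X i w) / (n * Cn n w (X i w))\<^sup>2)"
  proof -
    have "\<bar>- ln (1 - Fn n w x) - (\<Sum>i\<in>I. u i)\<bar> = \<bar>\<Sum>i\<in>I. - ln (1 - u i) - u i\<bar>"
      unfolding ln by (simp add: sum_subtractf sum_negf)
    also have "\<dots> \<le> (\<Sum>i\<in>I. \<bar>- ln (1 - u i) - u i\<bar>)" by (rule sum_abs)
    also have "\<dots> \<le> (\<Sum>i\<in>I. 2 * (u i)\<^sup>2)" by (intro sum_mono ln_error)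
    finally have "S x * \<bar>- ln (1 - Fn n w x) - (\<Sum>i\<in>I. u i)\<bar> \<le> S x * (\<Sum>i\<in>I. 2 * (u i)\<^sup>2)"
      using Sx by (intro mult_left_mono) auto
    also have "\<dots> = 2 * (\<Sum>i\<in>I. S x * (u i)\<^sup>2)" by (simp add: sum_distrib_left mult_ac)
    also have "\<dots> \<le> 2 * (\<Sum>i\<in>I. indicator {..b} (X i w) * S (X i w) / (n * Cn n w (X i w))\<^sup>2)"
    proof (intro mult_left_mono sum_mono)
      fix i assume "i \<in> I"
      then have "X i w \<le> x" "X i w \<le> b" using x by (auto simp: I_def)
      then show "S x * (u i)\<^sup>2 \<le> indicator {..b} (X i w) * S (X i w) / (n * Cn n w (X i w))\<^sup>2"
        using S_antimono[of "X i w" x] by (simp add: u_def power_divide divide_right_mono)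
    qed simp
    also have "\<dots> \<le> 2 * (\<Sum>i<n. indicator {..b} (X i w) * S (X i w) / (n * Cn n w (X i w))\<^sup>2)"
      using S_bounds by (intro mult_left_mono sum_mono2) (auto simp: I_def)
    finally show ?thesis .
  qed
  define q where "q i = (C (X i w) - Cn n w (X i w))\<^sup>2 / (Cn n w (X i w) * (C (X i w))\<^sup>2)" for i
  have q0: "0 \<le> q i" for i unfolding q_def using risk_freq_bounds by simp
  have E2: "S x * \<bar>(\<Sum>i\<in>I. q i) / n\<bar>
    \<le> (\<Sum>i<n. indicator {..b} (X i w) * S (X i w) / (C (X i w))\<^sup>2 * ((C (X i w) - Cn n w (X i w))\<^sup>2 / Cn n w (X i w))) / n"
  proof -
    have "S x * \<bar>(\<Sum>i\<in>I. q i) / n\<bar> = (\<Sum>i\<in>I. S x * q i) / n"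
      using q0 by (simp add: sum_nonneg sum_distrib_left abs_of_nonneg)
    also have "\<dots> \<le> (\<Sum>i\<in>I. indicator {..b} (X i w) * S (X i w) / (C (X i w))\<^sup>2 * ((C (X i w) - Cn n w (X i w))\<^sup>2 / Cn n w (X i w))) / n"
    proof (intro divide_right_mono sum_mono)
      fix i assume "i \<in> I"
      then have i: "X i w \<le> x" "X i w \<le> b" using x by (auto simp: I_def)
      have "S x * q i \<le> S (X i w) * q i" using S_antimono[OF i(1)] q0 by (intro mult_right_mono) auto
      then show "S x * q i \<le> indicator {..b} (X i w) * S (X i w) / (C (X i w))\<^sup>2 * ((C (X i w) - Cn n w (X i w))\<^sup>2 / Cn n w (X i w))"
        using i by (simp add: q_def mult_ac)
    qed simp
    also have "\<dots> \<le> (\<Sum>i<n. indicator {..b} (X i w) * S (X i w) / (C (X i w))\<^sup>2 * ((C (X i w) - Cn n w (X i w))\<^sup>2 / Cn n w (X i w))) / n"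
      using S_bounds risk_freq_bounds by (intro divide_right_mono sum_mono2) (auto simp: I_def)
    finally show ?thesis .
  qed
  have sum_I: "(\<Sum>i<n. indicator {..x} (X i w) * h i) = (\<Sum>i\<in>I. h i)" for h :: "nat \<Rightarrow> real"
    unfolding I_def by (intro sum.mono_neutral_cong_right) (auto simp: indicator_def)
  have A: "linear_A n w x = (\<Sum>i\<in>I. 1 / C (X i w)) / n + ln (S x)"
    using sum_I[of "\<lambda>i. 1 / C (X i w)"] by (simp add: linear_A_def)
  have Q: "degenerate n w x = (\<Sum>i\<in>I. (C (X i w) - Cn n w (X i w)) / (C (X i w))\<^sup>2) / n + linear_E n w x"
  proof -
    have "(\<integral>p. indicator {..x} (fst p) * (C (fst p) - Cn n w (fst p)) / (C (fst p))\<^sup>2 \<partial>observed)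
       = (\<integral>p. - (indicator {..x} (fst p) * (Cn n w (fst p) - C (fst p)) / (C (fst p))\<^sup>2) \<partial>observed)"
      by (intro Bochner_Integration.integral_cong refl) (simp add: minus_divide_left right_diff_distrib)
    then show ?thesis
      using sum_I[of "\<lambda>i. (C (X i w) - Cn n w (X i w)) / (C (X i w))\<^sup>2"] by (simp add: degenerate_def linear_E_def)
  qed
  have "u i = (1 / C (X i w) + (C (X i w) - Cn n w (X i w)) / (C (X i w))\<^sup>2 + q i) / n" if "i \<in> I" for i
  proof -
    have "1 / cn = 1 / c + (c - cn) / c\<^sup>2 + (c - cn)\<^sup>2 / (cn * c\<^sup>2)" if "0 < c" "0 < cn" for c cn :: real
      using that by (simp add: field_simps power2_eq_square)
    from this[OF Cpos[OF I(1)[OF that]] I(4)[OF that]] show ?thesis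
      unfolding u_def q_def by (metis divide_divide_eq_left mult.commute)
  qed
  then have "(\<Sum>i\<in>I. u i) = (\<Sum>i\<in>I. 1 / C (X i w)) / n + (\<Sum>i\<in>I. (C (X i w) - Cn n w (X i w)) / (C (X i w))\<^sup>2) / n + (\<Sum>i\<in>I. q i) / n"
    by (simp add: sum_divide_distrib sum.distrib add_divide_distrib)
  then have "(ln (S x) - ln (1 - Fn n w x)) - (linear_A n w x - linear_E n w x)
     = (- ln (1 - Fn n w x) - (\<Sum>i\<in>I. u i)) + (\<Sum>i\<in>I. q i) / n + degenerate n w x"
    unfolding A Q by simp
  then have "\<bar>(ln (S x) - ln (1 - Fn n w x)) - (linear_A n w x - linear_E n w x)\<bar>
     \<le> \<bar>- ln (1 - Fn n w x) - (\<Sum>i\<in>I. u i)\<bar> + \<bar>(\<Sum>i\<in>I. q i) / n\<bar> + \<bar>degenerate n w x\<bar>" by linarith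
  then have "S x * \<bar>(ln (S x) - ln (1 - Fn n w x)) - (linear_A n w x - linear_E n w x)\<bar>
     \<le> S x * (\<bar>- ln (1 - Fn n w x) - (\<Sum>i\<in>I. u i)\<bar> + \<bar>(\<Sum>i\<in>I. q i) / n\<bar> + \<bar>degenerate n w x\<bar>)"
    using Sx by (intro mult_left_mono) auto
  also have "\<dots> = S x * \<bar>- ln (1 - Fn n w x) - (\<Sum>i\<in>I. u i)\<bar> + S x * \<bar>(\<Sum>i\<in>I. q i) / n\<bar> + S x * \<bar>degenerate n w x\<bar>"
    by (simp add: distrib_left)
  also have "\<dots> \<le> 2 * (\<Sum>i<n. indicator {..b} (X i w) * S (X i w) / (n * Cn n w (X i w))\<^sup>2)
       + (\<Sum>i<n. indicator {..b} (X i w) * S (X i w) / (C (X i w))\<^sup>2 * ((C (X i w) - Cn n w (X i w))\<^sup>2 / Cn n w (X i w))) / n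
       + S x * \<bar>degenerate n w x\<bar>"
    using E1 E2 by (intro add_mono) auto
  finally show "S x * \<bar>(ln (S x) - ln (1 - Fn n w x)) - (linear_A n w x - linear_E n w x)\<bar>
      \<le> 2 * (\<Sum>i<n. indicator {..b} (X i w) * S (X i w) / (n * Cn n w (X i w))\<^sup>2)
       + (\<Sum>i<n. indicator {..b} (X i w) * S (X i w) / (C (X i w))\<^sup>2 * ((C (X i w) - Cn n w (X i w))\<^sup>2 / Cn n w (X i w))) / n
       + S x * \<bar>degenerate n w x\<bar>" .
qed

text \<open>
  Beyond \<open>b\<close> the linear term changes by a difference of two nondecreasing functions, each of which
  is controlled by its increments with the weight \<open>S\<close> inside.
\<close>

lemma linear_term_beyond:
  assumes x: "b < x" and Sx: "0 < S x"
    and tail: "ennreal ((\<Sum>i<n. indicator {b<..} (X i w) * S (X i w) / C (X i w)) / n)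
    + (\<integral>\<^sup>+p. ennreal (indicator {b<..} (fst p) * S (fst p) / (C (fst p))\<^sup>2 * Cn n w (fst p)) \<partial>observed) \<le> ennreal \<epsilon>"
    and \<epsilon>: "0 \<le> \<epsilon>"
  shows "\<bar>S x * (linear_A n w x - linear_E n w x)\<bar> \<le> S b * \<bar>linear_A n w b - linear_E n w b\<bar> + \<epsilon>"
proof -
  have n: "0 < n" and w: "w \<in> space M" using reg by (auto simp: regular_def)
  note [measurable] = risk_freq_measurable'[OF w]
  have Sb: "0 < S b" "S x \<le> S b" using Sx S_antimono[of b x] x by auto
  define k where "k z = indicator {b<..x} z / (C z)\<^sup>2 * Cn n w z" for z
  have ind: "indicator {..x} z = indicator {..b} z + (indicator {b<..x} z :: real)" for z
    using x by (auto simp: indicator_def)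
  have E_int: "integrable observed (\<lambda>p. indicator {..y} (fst p) * (Cn n w (fst p) - C (fst p)) / (C (fst p))\<^sup>2)"
    if "0 < S y" for y
    using integrable_error_div_C2[OF that w, of "\<lambda>_. 1"] by simp
  have "linear_E n w x - linear_E n w b
     = (\<integral>p. indicator {..x} (fst p) * (Cn n w (fst p) - C (fst p)) / (C (fst p))\<^sup>2
         - indicator {..b} (fst p) * (Cn n w (fst p) - C (fst p)) / (C (fst p))\<^sup>2 \<partial>observed)"
    unfolding linear_E_def using E_int[OF Sx] E_int[OF Sb(1)] by simp
  also have "\<dots> = (\<integral>p. k (fst p) - (indicator {..x} (fst p) / C (fst p) - indicator {..b} (fst p) / C (fst p)) \<partial>observed)"
  proof (intro Bochner_Integration.integral_cong refl)
    fix p :: "real \<times> real"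
    show "indicator {..x} (fst p) * (Cn n w (fst p) - C (fst p)) / (C (fst p))\<^sup>2
         - indicator {..b} (fst p) * (Cn n w (fst p) - C (fst p)) / (C (fst p))\<^sup>2
       = k (fst p) - (indicator {..x} (fst p) / C (fst p) - indicator {..b} (fst p) / C (fst p))"
      by (cases "C (fst p) = 0") (simp_all add: ind k_def field_simps power2_eq_square)
  qed
  also have "\<dots> = (\<integral>p. k (fst p) \<partial>observed) - (ln (S b) - ln (S x))"
  proof -
    have "integrable observed (\<lambda>p. k (fst p))"
    proof (rule Bochner_Integration.integrable_bound[OF integrable_inverse_C2[OF Sx]])
      show "AE p in observed. norm (k (fst p)) \<le> norm (indicator {..x} (fst p) / (C (fst p))\<^sup>2)"
        using risk_freq_bounds by (intro AE_I2) (auto simp: k_def indicator_def abs_mult divide_right_mono)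
    qed (unfold k_def, measurable)
    then show ?thesis
      using integrable_inverse_C[OF Sx] integrable_inverse_C[OF Sb(1)] integral_inverse_C[OF Sx] integral_inverse_C[OF Sb(1)]
      by simp
  qed
  finally have E: "linear_E n w x - linear_E n w b = (\<integral>p. k (fst p) \<partial>observed) - (ln (S b) - ln (S x))" .
  define a where "a = (\<Sum>i<n. indicator {b<..x} (X i w) / C (X i w)) / n"
  have A: "linear_A n w x - linear_A n w b = a + ln (S x) - ln (S b)"
    unfolding linear_A_def a_def ind by (simp add: add_divide_distrib sum.distrib)
  have L: "linear_A n w x - linear_E n w x = (linear_A n w b - linear_E n w b) + (a - (\<integral>p. k (fst p) \<partial>observed))"
    using A E by simp
  have k0: "0 \<le> k z" for z unfolding k_def using risk_freq_bounds by simp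
  have a0: "0 \<le> a" unfolding a_def using C_nonneg by (intro divide_nonneg_nonneg sum_nonneg) auto
  have ki0: "0 \<le> (\<integral>p. k (fst p) \<partial>observed)" using k0 by simp
  have Sa: "S x * a \<le> (\<Sum>i<n. indicator {b<..} (X i w) * S (X i w) / C (X i w)) / n"
  proof -
    have "S x * a = (\<Sum>i<n. S x * (indicator {b<..x} (X i w) / C (X i w))) / n"
      unfolding a_def by (simp add: sum_distrib_left)
    also have "\<dots> \<le> (\<Sum>i<n. indicator {b<..} (X i w) * S (X i w) / C (X i w)) / n"
      using S_antimono[of _ x] S_bounds C_nonneg
      by (intro divide_right_mono sum_mono) (auto simp: indicator_def intro!: divide_right_mono)
    finally show ?thesis .
  qed
  have Sk: "ennreal (S x * (\<integral>p. k (fst p) \<partial>observed))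
     \<le> (\<integral>\<^sup>+p. ennreal (indicator {b<..} (fst p) * S (fst p) / (C (fst p))\<^sup>2 * Cn n w (fst p)) \<partial>observed)"
  proof -
    have "ennreal (S x * (\<integral>p. k (fst p) \<partial>observed)) = ennreal (\<integral>p. S x * k (fst p) \<partial>observed)" by simp
    also have "\<dots> \<le> (\<integral>\<^sup>+p. ennreal (S x * k (fst p)) \<partial>observed)"
    proof (cases "integrable observed (\<lambda>p. S x * k (fst p))")
      case True
      then show ?thesis using k0 Sx by (simp add: nn_integral_eq_integral)
    qed (simp add: not_integrable_integral_eq)
    also have "\<dots> \<le> (\<integral>\<^sup>+p. ennreal (indicator {b<..} (fst p) * S (fst p) / (C (fst p))\<^sup>2 * Cn n w (fst p)) \<partial>observed)"
      using S_antimono[of _ x] S_bounds risk_freq_bounds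
      by (intro nn_integral_mono ennreal_leI) (auto simp: k_def indicator_def intro!: divide_right_mono mult_right_mono)
    finally show ?thesis .
  qed
  have "ennreal (S x * a + S x * (\<integral>p. k (fst p) \<partial>observed)) = ennreal (S x * a) + ennreal (S x * (\<integral>p. k (fst p) \<partial>observed))"
    using Sx a0 ki0 by (intro ennreal_plus) auto
  also have "\<dots> \<le> ennreal \<epsilon>"
    by (rule order_trans[OF add_mono[OF ennreal_leI[OF Sa] Sk] tail])
  finally have "S x * a + S x * (\<integral>p. k (fst p) \<partial>observed) \<le> \<epsilon>" using \<epsilon> by (simp add: ennreal_le_iff)
  moreover have "0 \<le> S x * a" "0 \<le> S x * (\<integral>p. k (fst p) \<partial>observed)" using Sx a0 ki0 by auto
  ultimately have "\<bar>S x * a - S x * (\<integral>p. k (fst p) \<partial>observed)\<bar> \<le> \<epsilon>" by linarith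
  moreover have "\<bar>S x * (linear_A n w b - linear_E n w b)\<bar> \<le> S b * \<bar>linear_A n w b - linear_E n w b\<bar>"
    unfolding abs_mult using Sb S_bounds[of x] by (intro mult_right_mono) auto
  moreover have "S x * (linear_A n w x - linear_E n w x) = S x * (linear_A n w b - linear_E n w b)
      + (S x * a - S x * (\<integral>p. k (fst p) \<partial>observed))"
    unfolding L by (simp add: algebra_simps)
  ultimately show ?thesis by linarith
qed

end

end

section \<open>Convergence in probability of the remainder\<close>

text \<open>
  The quadratic error of \<open>1 - exp (- D)\<close>, for \<open>r = sqrt n\<close>: it is governed by \<open>S * L\<^sup>2\<close>, and dividing by
  \<open>S \<ge> s\<close> shows that \<open>D\<close> itself is bounded.
\<close>

lemma second_order_term_le:
  fixes S s r D L \<eta> \<delta> :: real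
  assumes s: "0 < s" "s \<le> S" and r: "0 < r" "r * s = \<eta>" and \<eta>: "0 < \<eta>"
    and \<delta>: "0 \<le> \<delta>" "\<delta> \<le> 1/16" "\<delta> \<le> \<eta> / 8"
    and DL: "r * (S * \<bar>D - L\<bar>) \<le> 4 * \<delta>" and L: "S * L\<^sup>2 \<le> 4 * \<delta> * s"
  shows "\<bar>D\<bar> \<le> 1" "r * (S * D\<^sup>2) \<le> \<eta>"
proof -
  have "r * (S * \<bar>D - L\<bar>) \<le> r * (s / 2)" using DL \<delta> r by simp
  then have "S * \<bar>D - L\<bar> \<le> s / 2" unfolding mult_le_cancel_left_pos[OF r(1)] .
  then have "(S * \<bar>D - L\<bar>)\<^sup>2 \<le> (s / 2)\<^sup>2" using s by (intro power_mono) auto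
  then have "S\<^sup>2 * (D - L)\<^sup>2 \<le> s\<^sup>2 / 2\<^sup>2" by (simp only: power_mult_distrib power_divide power2_abs)
  then have "S * (S * (D - L)\<^sup>2) \<le> s * (s / 4)" by (simp add: power2_eq_square)
  also have "\<dots> \<le> S * (s / 4)" using s by (intro mult_right_mono) auto
  finally have DL2: "S * (D - L)\<^sup>2 \<le> s / 4" using s by simp
  have "0 \<le> (D - 2 * L)\<^sup>2" by simp
  then have "D\<^sup>2 \<le> 2 * L\<^sup>2 + 2 * (D - L)\<^sup>2" by (simp add: power2_eq_square algebra_simps)
  then have "S * D\<^sup>2 \<le> S * (2 * L\<^sup>2 + 2 * (D - L)\<^sup>2)" using s by (intro mult_left_mono) auto
  also have "\<dots> = 2 * (S * L\<^sup>2) + 2 * (S * (D - L)\<^sup>2)" by (simp add: algebra_simps)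
  also have "\<dots> \<le> s"
  proof -
    have "4 * \<delta> * s \<le> s / 4" using mult_right_mono[OF \<delta>(2), of s] s by simp
    then show ?thesis using L DL2 by linarith
  qed
  finally have SD: "S * D\<^sup>2 \<le> s" .
  also note s(2)
  finally have "D\<^sup>2 \<le> 1" using s by simp
  then show "\<bar>D\<bar> \<le> 1" by (simp add: abs_square_le_1)
  show "r * (S * D\<^sup>2) \<le> \<eta>" using mult_left_mono[OF SD, of r] r by simp
qed

context truncated_sample
begin

text \<open>
  To the left of the quantile \<open>b n\<close> the remainder is expanded. To its right both the estimator and the
  linear term are compared with their values at \<open>b n\<close>, using that the estimator is monotone.
\<close>

lemma whp_remainder:
  assumes \<epsilon>: "0 < \<epsilon>"
  shows "whp M (\<lambda>n w. \<forall>x. sqrt n * \<bar>R n w x\<bar> \<le> \<epsilon>)"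
  unfolding whp_def
proof (intro allI impI)
  fix \<rho> :: real assume \<rho>: "0 < \<rho>"
  \<comment> \<open>The remainder will be bounded by \<open>4 * \<delta> + \<eta>\<close> up to \<open>b n\<close> and by \<open>4 * \<delta> + 5 * \<eta>\<close> plus a tail beyond; the tail has mean \<open>2 * \<eta>\<close> and is allowed \<open>\<epsilon> / 4\<close>.\<close>
  define \<eta> where "\<eta> = min (\<epsilon> / 14) (\<epsilon> * \<rho> / 16)"
  have \<eta>_bounds: "0 < \<eta>" "\<eta> \<le> \<epsilon> / 14" "\<eta> \<le> \<epsilon> * \<rho> / 16" unfolding \<eta>_def using \<epsilon> \<rho> by auto
  define \<delta> where "\<delta> = min (1/16) (min (\<eta> / 8) (\<epsilon> / 16))"
  have \<delta>: "0 < \<delta>" "\<delta> \<le> 1/16" "\<delta> \<le> \<eta> / 8" "\<delta> \<le> \<epsilon> / 16" unfolding \<delta>_def using \<epsilon> \<eta>_bounds by auto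
  define s where "s n = \<eta> * real n powr (-1/2)" for n :: nat
  have ex_b: "\<forall>\<^sub>F n in sequentially. \<exists>y. S y = s n"
  proof -
    have "s \<longlonglongrightarrow> \<eta> * 0"
      unfolding s_def by (intro tendsto_mult tendsto_const tendsto_neg_powr filterlim_real_sequentially) simp
    then have "\<forall>\<^sub>F n in sequentially. s n < 1" by (intro order_tendstoD(2)) auto
    with eventually_gt_at_top[of 0] show ?thesis
    proof eventually_elim
      case (elim n)
      then have sn: "0 < s n" "s n < 1" using \<eta>_bounds by (auto simp: s_def)
      have "\<forall>\<^sub>F z in at_bot. F z < 1 - s n" using sn by (intro order_tendstoD(2)[OF X.cdf_lim_at_bot]) auto
      then obtain y1 where y1: "F y1 < 1 - s n" using eventually_happens'[OF trivial_limit_at_bot_linorder] by blast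
      have "\<forall>\<^sub>F z in at_top. 1 - s n < F z" using sn by (intro order_tendstoD(1)[OF X.cdf_lim_at_top_prob]) auto
      then obtain y2 where y2: "1 - s n < F y2" using eventually_happens'[OF trivial_limit_at_top_linorder] by blast
      have "y1 \<le> y2" using y1 y2 X.cdf_nondecreasing[of y2 y1] by linarith
      then have "\<exists>y\<ge>y1. y \<le> y2 \<and> F y = 1 - s n"
        using y1 y2 by (intro IVT') (auto intro: continuous_on_subset[OF cont_F])
      then obtain y where "F y = 1 - s n" by blast
      then have "S y = s n" by (simp add: S_def)
      then show ?case ..
    qed
  qed
  define b where "b n = (SOME y. S y = s n)" for n
  have b: "\<forall>\<^sub>F n in sequentially. S (b n) = s n"
    using ex_b unfolding b_def by eventually_elim (rule someI_ex)
  interpret high_quantile \<mu> \<nu> \<alpha> M Z \<eta> b s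
    by unfold_locales (use \<eta>_bounds b s_def in auto)
  let ?T1 = "\<lambda>n w. \<Sum>i<n. indicator {..b n} (X i w) * S (X i w) / (n * Cn n w (X i w))\<^sup>2"
  let ?T2 = "\<lambda>n w. (\<Sum>i<n. indicator {..b n} (X i w) * S (X i w) / (C (X i w))\<^sup>2
      * ((C (X i w) - Cn n w (X i w))\<^sup>2 / Cn n w (X i w))) / n"
  have reg: "whp M (\<lambda>n w. n = 0 \<or> regular n w)"
    using AE_regular by (intro whp_AE prob_space_axioms) auto
  note facts = whp_conj[OF prob_space_axioms whp_risk_sets_not_singletons
    whp_conj[OF prob_space_axioms whp_logarithm_error[OF \<delta>(1)]
    whp_conj[OF prob_space_axioms whp_relative_square_error[OF \<delta>(1)]
    whp_conj[OF prob_space_axioms whp_degenerate[OF \<delta>(1)]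
    whp_conj[OF prob_space_axioms whp_linear_A[OF \<delta>(1)]
    whp_conj[OF prob_space_axioms whp_linear_E[OF \<delta>(1)] reg]]]]]]
  have ev1: "\<forall>\<^sub>F n in sequentially. \<exists>A\<in>sets M. measure M A \<le> \<rho> / 2 \<and> (\<forall>w\<in>space M - A.
     (\<forall>i<n. X i w \<le> b n \<longrightarrow> 2 \<le> n * Cn n w (X i w)) \<and> sqrt n * ?T1 n w \<le> \<delta> \<and> sqrt n * ?T2 n w \<le> \<delta>
     \<and> (\<forall>x\<le>b n. sqrt n * (S x * \<bar>degenerate n w x\<bar>) \<le> \<delta>)
     \<and> (\<forall>x\<le>b n. S x * (linear_A n w x)\<^sup>2 \<le> \<delta> * s n)
     \<and> (\<forall>x\<le>b n. S x * (linear_E n w x)\<^sup>2 \<le> \<delta> * s n) \<and> (n = 0 \<or> regular n w))"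
    using \<rho> by (intro whpD[OF facts]) auto
  from ev1 eventually_b
  show "\<forall>\<^sub>F n in sequentially. \<exists>A\<in>sets M. measure M A \<le> \<rho> \<and> (\<forall>w\<in>space M - A. \<forall>x. sqrt n * \<bar>R n w x\<bar> \<le> \<epsilon>)"
  proof eventually_elim
    case (elim n)
    then have n: "0 < n" and sn: "0 < s n" "S (b n) = s n" by auto
    have rs: "sqrt n * s n = \<eta>" using n \<eta>_bounds by (simp add: s_def powr_minus_divide powr_half_sqrt)
    from elim(1) obtain A where A: "A \<in> sets M" "measure M A \<le> \<rho> / 2" "\<forall>w\<in>space M - A.
     (\<forall>i<n. X i w \<le> b n \<longrightarrow> 2 \<le> n * Cn n w (X i w)) \<and> sqrt n * ?T1 n w \<le> \<delta> \<and> sqrt n * ?T2 n w \<le> \<delta>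
     \<and> (\<forall>x\<le>b n. sqrt n * (S x * \<bar>degenerate n w x\<bar>) \<le> \<delta>)
     \<and> (\<forall>x\<le>b n. S x * (linear_A n w x)\<^sup>2 \<le> \<delta> * s n)
     \<and> (\<forall>x\<le>b n. S x * (linear_E n w x)\<^sup>2 \<le> \<delta> * s n) \<and> (n = 0 \<or> regular n w)"
      by (elim bexE conjE) (rule that)
    have "(\<integral>\<^sup>+w. ennreal (sqrt n) * tail_bound n w \<partial>M) \<le> ennreal (2 * \<eta>)"
      by (rule mean_tail_bound[OF n sn(2)])
    also have "\<dots> \<le> ennreal (\<epsilon> / 4 * (\<rho> / 2))" using \<eta>_bounds(3) by (intro ennreal_leI) simp
    finally have "\<exists>B\<in>sets M. measure M B \<le> \<rho> / 2 \<and> (\<forall>w\<in>space M - B. ennreal (sqrt n) * tail_bound n w \<le> ennreal (\<epsilon> / 4))"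
      using \<epsilon> \<rho> by (intro Markov_exceptional_set prob_space_axioms) auto
    then obtain B where B: "B \<in> sets M" "measure M B \<le> \<rho> / 2"
      "\<And>w. w \<in> space M - B \<Longrightarrow> ennreal (sqrt n) * tail_bound n w \<le> ennreal (\<epsilon> / 4)" by blast
    have "sqrt n * \<bar>R n w x\<bar> \<le> \<epsilon>" if w: "w \<in> space M - (A \<union> B)" for w x
    proof -
      have wA: "w \<in> space M - A" and wB: "w \<in> space M - B" and wM: "w \<in> space M" using w by auto
      note Aw = bspec[OF A(3) wA]
      have reg: "regular n w" using Aw n by simp
      let ?L = "\<lambda>x. linear_A n w x - linear_E n w x"
      have L2: "S x * (?L x)\<^sup>2 \<le> 4 * \<delta> * s n" if x: "x \<le> b n" for x
      proof -
        have "0 \<le> (linear_A n w x + linear_E n w x)\<^sup>2" by simp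
        then have "(?L x)\<^sup>2 \<le> 2 * (linear_A n w x)\<^sup>2 + 2 * (linear_E n w x)\<^sup>2"
          by (simp add: power2_eq_square algebra_simps)
        then have "S x * (?L x)\<^sup>2 \<le> S x * (2 * (linear_A n w x)\<^sup>2 + 2 * (linear_E n w x)\<^sup>2)"
          using S_bounds by (intro mult_left_mono) auto
        also have "\<dots> = 2 * (S x * (linear_A n w x)\<^sup>2) + 2 * (S x * (linear_E n w x)\<^sup>2)" by (simp add: algebra_simps)
        finally show ?thesis using Aw x by force
      qed
      have left: "sqrt n * \<bar>R n w x\<bar> \<le> 4 * \<delta> + \<eta>" if x: "x \<le> b n" for x
      proof -
        have Sx: "s n \<le> S x" "0 < S x" using S_antimono[OF x] sn by auto
        define D where "D = ln (S x) - ln (1 - Fn n w x)"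
        have Fpos: "0 < 1 - Fn n w x"
          and exp1: "S x * \<bar>D - ?L x\<bar> \<le> 2 * ?T1 n w + ?T2 n w + S x * \<bar>degenerate n w x\<bar>"
          using log_survival_expansion[OF reg, of "b n" x] sn x Aw unfolding D_def by auto
        have "sqrt n * (S x * \<bar>D - ?L x\<bar>) \<le> sqrt n * (2 * ?T1 n w + ?T2 n w + S x * \<bar>degenerate n w x\<bar>)"
          by (rule mult_left_mono[OF exp1]) simp
        also have "\<dots> = 2 * (sqrt n * ?T1 n w) + sqrt n * ?T2 n w + sqrt n * (S x * \<bar>degenerate n w x\<bar>)"
          by (simp only: distrib_left mult.left_commute)
        also have "\<dots> \<le> 2 * \<delta> + \<delta> + \<delta>" using Aw x by (intro add_mono mult_left_mono) auto
        finally have DL: "sqrt n * (S x * \<bar>D - ?L x\<bar>) \<le> 4 * \<delta>" by simp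
        have D: "\<bar>D\<bar> \<le> 1" "sqrt n * (S x * D\<^sup>2) \<le> \<eta>"
          using second_order_term_le[OF sn(1) Sx(1) _ rs \<eta>_bounds(1) _ \<delta>(2,3) DL L2[OF x]] \<delta> n by auto
        have "1 - Fn n w x = S x * exp (- D)"
          unfolding D_def using Sx Fpos by (simp add: exp_diff)
        then have "R n w x = S x * (D - ?L x) - S x * (exp (- D) - 1 - (- D))"
          unfolding R_eq_linear[OF wM n Sx(2)] by (simp add: S_def algebra_simps)
        also have "\<bar>\<dots>\<bar> \<le> \<bar>S x * (D - ?L x)\<bar> + \<bar>S x * (exp (- D) - 1 - (- D))\<bar>"
          by (rule abs_triangle_ineq4)
        also have "\<dots> \<le> S x * \<bar>D - ?L x\<bar> + S x * D\<^sup>2"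
          using Sx exp_minus_linear_bound[of "- D"] D(1) by (simp add: abs_mult)
        finally have "sqrt n * \<bar>R n w x\<bar> \<le> sqrt n * (S x * \<bar>D - ?L x\<bar> + S x * D\<^sup>2)"
          by (rule mult_left_mono) simp
        then show ?thesis using DL D(2) by (simp add: distrib_left)
      qed
      show ?thesis
      proof (cases "x \<le> b n")
        case True
        have "4 * \<delta> + \<eta> \<le> \<epsilon>" using \<delta>(4) \<eta>_bounds(2) \<epsilon> by linarith
        then show ?thesis using left[OF True] by linarith
      next
        case False
        then have x: "b n < x" by simp
        have SL: "S (b n) * \<bar>?L (b n)\<bar> \<le> s n"
        proof -
          have "(S (b n) * \<bar>?L (b n)\<bar>)\<^sup>2 = s n * (S (b n) * (?L (b n))\<^sup>2)"
            using sn(2) by (simp add: power_mult_distrib power2_eq_square)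
          also have "\<dots> \<le> s n * (4 * \<delta> * s n)" using L2[of "b n"] sn by (intro mult_left_mono) auto
          also have "\<dots> \<le> s n * (1 * s n)" using \<delta>(2) sn by (intro mult_left_mono mult_right_mono) auto
          also have "\<dots> = (s n)\<^sup>2" by (simp add: power2_eq_square)
          finally show ?thesis by (rule power2_le_imp_le) (use sn in simp)
        qed
        have Fb: "1 - Fn n w (b n) \<le> 2 * s n + \<bar>R n w (b n)\<bar>"
        proof -
          have "Fn n w (b n) - F (b n) = R n w (b n) + S (b n) * ?L (b n)"
            using R_eq_linear[OF wM n, of "b n"] sn by simp
          moreover have "\<bar>S (b n) * ?L (b n)\<bar> \<le> s n" using SL sn by (simp add: abs_mult)
          moreover have "F (b n) = 1 - s n" using sn(2) by (simp add: S_def)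
          ultimately show ?thesis by linarith
        qed
        have FF: "\<bar>Fn n w x - F x\<bar> \<le> 3 * s n + \<bar>R n w (b n)\<bar>"
        proof -
          have "0 \<le> 1 - Fn n w x" "1 - Fn n w x \<le> 1 - Fn n w (b n)"
            using Fn_bounds[OF reg] Fn_mono[OF reg, of "b n" x] x by auto
          moreover have "0 \<le> 1 - F x" "1 - F x \<le> s n"
            using S_bounds[of x] S_antimono[of "b n" x] x sn unfolding S_def by auto
          ultimately show ?thesis using Fb by linarith
        qed
        define t where "t = \<epsilon> / (4 * sqrt n)"
        have t0: "0 \<le> t" unfolding t_def using \<epsilon> by simp
        have tail: "tail_bound n w \<le> ennreal t"
        proof -
          have "ennreal (1 / sqrt n) * (ennreal (sqrt n) * tail_bound n w) \<le> ennreal (1 / sqrt n) * ennreal (\<epsilon> / 4)"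
            using B(3)[OF wB] by (rule mult_left_mono) simp
          then show ?thesis using n \<epsilon> by (simp add: t_def mult.assoc[symmetric] ennreal_mult'[symmetric] mult.commute)
        qed
        have lin: "\<bar>R n w x\<bar> \<le> \<bar>Fn n w x - F x\<bar> + (s n + t)"
        proof (cases "S x = 0")
          case True
          then show ?thesis unfolding R_eq[OF wM n] using t0 sn by simp
        next
          case False
          then have Sx: "0 < S x" using S_bounds[of x] by linarith
          have "\<bar>S x * ?L x\<bar> \<le> S (b n) * \<bar>?L (b n)\<bar> + t"
            using tail t0 unfolding tail_bound_def by (intro linear_term_beyond[OF reg x Sx]) auto
          then show ?thesis unfolding R_eq_linear[OF wM n Sx] using SL by linarith
        qed
        have "sqrt n * \<bar>R n w x\<bar> \<le> sqrt n * (4 * s n + \<bar>R n w (b n)\<bar> + t)"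
          using lin FF by (intro mult_left_mono) auto
        also have "\<dots> = 4 * (sqrt n * s n) + sqrt n * \<bar>R n w (b n)\<bar> + sqrt n * t"
          by (simp only: distrib_left mult.left_commute)
        also have "\<dots> \<le> 4 * \<eta> + (4 * \<delta> + \<eta>) + \<epsilon> / 4"
          using left[of "b n"] rs n by (intro add_mono) (auto simp: t_def)
        also have "\<dots> \<le> \<epsilon>" using \<delta>(4) \<eta>_bounds(2) \<epsilon> by linarith
        finally show ?thesis .
      qed
    qed
    moreover have "measure M (A \<union> B) \<le> \<rho>"
      using measure_Un_le[of A M B] A B by simp
    ultimately show ?case using A B by (intro bexI[of _ "A \<union> B"]) auto
  qed
qed

end

section \<open>Measurability of the supremum\<close>

lemma SUP_right_continuous:
  fixes f :: "real \<Rightarrow> real"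
  assumes "\<And>x. (f \<longlongrightarrow> f x) (at_right x)"
  shows "(SUP x. \<bar>ereal (f x)\<bar>) = (SUP x\<in>\<rat>. \<bar>ereal (f x)\<bar>)"
proof (rule antisym)
  show "(SUP x. \<bar>ereal (f x)\<bar>) \<le> (SUP x\<in>\<rat>. \<bar>ereal (f x)\<bar>)"
  proof (rule SUP_least, rule ccontr)
    fix x assume "\<not> \<bar>ereal (f x)\<bar> \<le> (SUP x\<in>\<rat>. \<bar>ereal (f x)\<bar>)"
    then have less: "(SUP x\<in>\<rat>. \<bar>ereal (f x)\<bar>) < ereal \<bar>f x\<bar>" by simp
    have "((\<lambda>y. ereal \<bar>f y\<bar>) \<longlongrightarrow> ereal \<bar>f x\<bar>) (at_right x)"
      by (intro tendsto_ereal tendsto_rabs assms)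
    from order_tendstoD(1)[OF this less] obtain y where y: "x < y" "\<And>z. x < z \<Longrightarrow> z < y \<Longrightarrow> (SUP x\<in>\<rat>. \<bar>ereal (f x)\<bar>) < ereal \<bar>f z\<bar>"
      unfolding eventually_at_right_field by blast
    obtain q where q: "q \<in> \<rat>" "x < q" "q < y" using Rats_dense_in_real[OF y(1)] by auto
    have "\<bar>ereal (f q)\<bar> \<le> (SUP x\<in>\<rat>. \<bar>ereal (f x)\<bar>)" using q(1) by (rule SUP_upper)
    then show False using y(2)[OF q(2,3)] by simp
  qed
qed (rule SUP_subset_mono, auto)

lemma tendsto_at_right_indicator_atMost:
  fixes a x :: real
  shows "((\<lambda>x. indicator {..x} a :: real) \<longlongrightarrow> indicator {..x} a) (at_right x)"
proof (rule tendsto_eventually)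
  show "\<forall>\<^sub>F y in at_right x. (indicator {..y} a :: real) = indicator {..x} a"
  proof (cases "x < a")
    case True
    show ?thesis using eventually_at_right_real[OF True] by eventually_elim (use True in auto)
  next
    case False
    then show ?thesis
      using eventually_at_right_real[of x "x + 1"] by (auto elim!: eventually_mono simp: indicator_def)
  qed
qed

lemma lynden_bell_right_continuous:
  "(lynden_bell n xs ys \<longlongrightarrow> lynden_bell n xs ys x) (at_right x)"
proof -
  have "\<forall>\<^sub>F y in at_right x. \<forall>i\<in>{..<n}. xs i \<le> y \<longleftrightarrow> xs i \<le> x"
  proof (intro eventually_ball_finite ballI finite_lessThan)
    fix i
    show "\<forall>\<^sub>F y in at_right x. xs i \<le> y \<longleftrightarrow> xs i \<le> x"
    proof (cases "x < xs i")
      case True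
      show ?thesis using eventually_at_right_real[OF True] by eventually_elim (use True in auto)
    next
      case False
      then show ?thesis
        using eventually_at_right_real[of x "x + 1"] by (auto elim!: eventually_mono)
    qed
  qed
  then have "\<forall>\<^sub>F y in at_right x. lynden_bell n xs ys y = lynden_bell n xs ys x"
  proof eventually_elim
    case (elim y)
    then have "{z \<in> xs ` {..<n}. z \<le> y} = {z \<in> xs ` {..<n}. z \<le> x}" by auto
    then show ?case unfolding lynden_bell_def by simp
  qed
  then show ?thesis by (rule tendsto_eventually)
qed

lemma integral_atMost_right_continuous:
  fixes g v :: "'a \<Rightarrow> real" and x y :: real
  assumes int: "integrable P (\<lambda>p. indicator {..y} (v p) * g p)" and x: "x < y"
    and [measurable]: "g \<in> borel_measurable P" "v \<in> borel_measurable P"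
  shows "((\<lambda>x. \<integral>p. indicator {..x} (v p) * g p \<partial>P) \<longlongrightarrow> (\<integral>p. indicator {..x} (v p) * g p \<partial>P)) (at_right x)"
proof (rule tendsto_at_right_sequentially[OF x])
  fix f :: "nat \<Rightarrow> real"
  assume f: "\<And>n. x < f n" "\<And>n. f n < y" "decseq f" "f \<longlonglongrightarrow> x"
  have at_right: "filterlim f (at_right x) sequentially"
    using f by (auto simp: filterlim_at intro!: always_eventually)
  show "(\<lambda>n. \<integral>p. indicator {..f n} (v p) * g p \<partial>P) \<longlonglongrightarrow> (\<integral>p. indicator {..x} (v p) * g p \<partial>P)"
  proof (rule integral_dominated_convergence[where w = "\<lambda>p. \<bar>indicator {..y} (v p) * g p\<bar>"])
    show "AE p in P. (\<lambda>n. indicator {..f n} (v p) * g p) \<longlonglongrightarrow> indicator {..x} (v p) * g p"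
      by (intro AE_I2 tendsto_mult tendsto_const filterlim_compose[OF tendsto_at_right_indicator_atMost at_right])
    show "AE p in P. norm (indicator {..f n} (v p) * g p) \<le> \<bar>indicator {..y} (v p) * g p\<bar>" for n
      using f(2)[of n] by (intro AE_I2) (auto simp: indicator_def)
  qed (use int in auto)
qed

lemma lynden_bell_measurable:
  fixes xs ys :: "nat \<Rightarrow> 'a \<Rightarrow> real"
  assumes [measurable]: "\<And>i. xs i \<in> borel_measurable M" "\<And>i. ys i \<in> borel_measurable M"
  shows "(\<lambda>w. lynden_bell n (\<lambda>i. xs i w) (\<lambda>i. ys i w) x) \<in> borel_measurable M"
proof -
  define g where "g w i = 1 - (\<Sum>j<n. of_bool (xs j w = xs i w)) / n
    / ((\<Sum>j<n. of_bool (ys j w \<le> xs i w \<and> xs i w \<le> xs j w)) / real n)" for w i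
  have [measurable]: "(\<lambda>w. g w i) \<in> borel_measurable M" for i unfolding g_def by measurable
  \<comment> \<open>Each value is represented by the first index at which it occurs.\<close>
  have "lynden_bell n (\<lambda>i. xs i w) (\<lambda>i. ys i w) x
    = 1 - (\<Prod>i<n. if xs i w \<le> x \<and> (\<forall>j\<in>{..<i}. xs j w \<noteq> xs i w) then g w i else 1)" for w
  proof -
    define J where "J = {i. i < n \<and> xs i w \<le> x \<and> (\<forall>j\<in>{..<i}. xs j w \<noteq> xs i w)}"
    have inj: "inj_on (\<lambda>i. xs i w) J"
    proof (rule inj_onI)
      fix i j assume "i \<in> J" "j \<in> J" "xs i w = xs j w"
      then show "i = j" unfolding J_def by (cases i j rule: linorder_cases) auto
    qed
    have "{z \<in> (\<lambda>i. xs i w) ` {..<n}. z \<le> x} = (\<lambda>i. xs i w) ` J"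
    proof (intro set_eqI iffI)
      fix z assume "z \<in> {z \<in> (\<lambda>i. xs i w) ` {..<n}. z \<le> x}"
      then obtain k where k: "k < n" "xs k w = z" "z \<le> x" by auto
      define i where "i = (LEAST i. xs i w = z)"
      have "xs i w = z" unfolding i_def by (rule LeastI[of _ k]) (rule k)
      moreover have "i \<le> k" unfolding i_def by (rule Least_le) (rule k)
      moreover have "xs j w \<noteq> z" if "j < i" for j using not_less_Least[of j "\<lambda>i. xs i w = z"] that unfolding i_def by auto
      ultimately have "i \<in> J" "xs i w = z" using k unfolding J_def by auto
      then show "z \<in> (\<lambda>i. xs i w) ` J" by auto
    qed (auto simp: J_def)
    then have "(\<Prod>z\<in>{z \<in> (\<lambda>i. xs i w) ` {..<n}. z \<le> x}. 1 - jump (emp_Fstar n (\<lambda>i. xs i w)) z / emp_C n (\<lambda>i. xs i w) (\<lambda>i. ys i w) z)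
      = (\<Prod>i\<in>J. g w i)"
      unfolding jump_emp_Fstar emp_C_def g_def by (simp add: prod.reindex[OF inj])
    also have "\<dots> = (\<Prod>i<n. if xs i w \<le> x \<and> (\<forall>j\<in>{..<i}. xs j w \<noteq> xs i w) then g w i else 1)"
      unfolding J_def by (intro prod.mono_neutral_cong_left) auto
    finally show ?thesis unfolding lynden_bell_def by simp
  qed
  then show ?thesis by simp
qed

context truncated_sample
begin

lemma R_right_continuous:
  assumes w: "w \<in> space M" and n: "0 < n"
  shows "(R n w \<longlongrightarrow> R n w x) (at_right x)"
proof -
  note [measurable] = risk_freq_measurable'[OF w]
  have F: "(F \<longlongrightarrow> F y) (at_right y)" for y
    using X.cdf_is_right_cont[of y] by (simp add: continuous_within)
  have S: "(S \<longlongrightarrow> S x) (at_right x)" unfolding S_def[abs_def] by (intro tendsto_intros F)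
  show ?thesis
  proof (cases "S x = 0")
    case True
    have "\<forall>\<^sub>F y in at_right x. R n w y = Fn n w y - F y"
      using eventually_at_right_real[of x "x + 1", simplified]
    proof eventually_elim
      case (elim y)
      then have "S y = 0" using S_antimono[of x y] S_bounds[of y] True by auto
      then show ?case unfolding R_eq[OF w n] by simp
    qed
    moreover have "((\<lambda>y. Fn n w y - F y) \<longlongrightarrow> Fn n w x - F x) (at_right x)"
      by (intro tendsto_intros lynden_bell_right_continuous F)
    moreover have "R n w x = Fn n w x - F x" unfolding R_eq[OF w n] True by simp
    ultimately show ?thesis by (simp add: tendsto_cong)
  next
    case False
    then have "0 < S x" using S_bounds[of x] by linarith
    from order_tendstoD(1)[OF S this] obtain y0 where y0: "x < y0" "\<And>z. x < z \<Longrightarrow> z < y0 \<Longrightarrow> 0 < S z"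
      unfolding eventually_at_right_field by blast
    define y where "y = (x + y0) / 2"
    have y: "x < y" "0 < S y" unfolding y_def using y0 by (auto intro!: y0(2))
    have "integrable observed (\<lambda>p. indicator {..y} (fst p) * (1 / C (fst p)))"
      using integrable_inverse_C[OF y(2)] by simp
    from integral_atMost_right_continuous[OF this y(1)]
    have i1: "((\<lambda>x. \<integral>p. indicator {..x} (fst p) / C (fst p) \<partial>observed) \<longlongrightarrow> (\<integral>p. indicator {..x} (fst p) / C (fst p) \<partial>observed)) (at_right x)"
      by simp
    have "integrable observed (\<lambda>p. indicator {..y} (fst p) * ((Cn n w (fst p) - C (fst p)) / (C (fst p))\<^sup>2))"
      using integrable_error_div_C2[OF y(2) w, of "\<lambda>_. 1"] by simp
    from integral_atMost_right_continuous[OF this y(1)]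
    have i2: "(linear_E n w \<longlongrightarrow> linear_E n w x) (at_right x)"
      unfolding linear_E_def by simp
    have i0: "((\<lambda>x. (\<Sum>i<n. indicator {..x} (X i w) / C (X i w)) / n)
        \<longlongrightarrow> (\<Sum>i<n. indicator {..x} (X i w) / C (X i w)) / n) (at_right x)"
      unfolding divide_inverse by (intro tendsto_intros tendsto_at_right_indicator_atMost)
    show ?thesis
      unfolding R_eq[OF w n]
      by (intro tendsto_diff tendsto_mult lynden_bell_right_continuous F S i0 i1 i2)
  qed
qed

lemma R_measurable:
  assumes n: "0 < n"
  shows "(\<lambda>w. R n w x) \<in> borel_measurable M"
proof -
  have [measurable]: "(\<lambda>w. Fn n w x) \<in> borel_measurable M"
    by (intro lynden_bell_measurable) measurable
  have [measurable]: "(\<lambda>w. linear_E n w x) \<in> borel_measurable M"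
    unfolding linear_E_def by measurable
  have "(\<lambda>w. Fn n w x - F x - S x * ((\<Sum>i<n. indicator {..x} (X i w) / C (X i w)) / n
    - (\<integral>p. indicator {..x} (fst p) / C (fst p) \<partial>observed) - linear_E n w x)) \<in> borel_measurable M"
    by measurable
  then show ?thesis
    by (subst measurable_cong[OF R_eq[OF _ n]]) auto
qed

lemma sup_remainder_measurable:
  "(\<lambda>w. ereal (sqrt (real n)) * (SUP x. \<bar>ereal (R n w x)\<bar>)) \<in> borel_measurable M"
proof (cases "n = 0")
  case False
  then have n: "0 < n" by simp
  have [measurable]: "(\<lambda>w. R n w x) \<in> borel_measurable M" for x by (rule R_measurable[OF n])
  have "(\<lambda>w. SUP x\<in>\<rat>. \<bar>ereal (R n w x)\<bar>) \<in> borel_measurable M"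
    by (intro borel_measurable_SUP countable_rat) measurable
  moreover have "(SUP x. \<bar>ereal (R n w x)\<bar>) = (SUP x\<in>\<rat>. \<bar>ereal (R n w x)\<bar>)" if "w \<in> space M" for w
    by (intro SUP_right_continuous R_right_continuous that n)
  ultimately have "(\<lambda>w. SUP x. \<bar>ereal (R n w x)\<bar>) \<in> borel_measurable M"
    by (simp cong: measurable_cong)
  then show ?thesis by measurable
qed (simp add: zero_ereal_def[symmetric])

lemma sup_remainder_tends_to_0:
  "tends_to_0_in_prob M (\<lambda>n w. ereal (sqrt (real n)) * (SUP x. \<bar>ereal (R n w x)\<bar>))"
  unfolding tends_to_0_in_prob_def
proof (intro conjI allI impI)
  let ?Z = "\<lambda>n w. ereal (sqrt (real n)) * (SUP x. \<bar>ereal (R n w x)\<bar>)"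
  show meas[measurable]: "?Z n \<in> borel_measurable M" for n by (rule sup_remainder_measurable)
  fix \<epsilon> :: real assume \<epsilon>: "0 < \<epsilon>"
  show "(\<lambda>n. \<P>(w in M. \<bar>?Z n w\<bar> > ereal \<epsilon>)) \<longlonglongrightarrow> 0"
  proof (rule order_tendstoI)
    fix \<rho> :: real assume "0 < \<rho>"
    then have "0 < \<rho> / 2" by simp
    from eventually_conj[OF eventually_gt_at_top[of 0] whpD[OF whp_remainder[OF \<epsilon>] this]]
    show "\<forall>\<^sub>F n in sequentially. \<P>(w in M. \<bar>?Z n w\<bar> > ereal \<epsilon>) < \<rho>"
    proof eventually_elim
      case (elim n)
      then obtain A where A: "A \<in> sets M" "measure M A \<le> \<rho> / 2"
        "\<And>w x. w \<in> space M - A \<Longrightarrow> sqrt n * \<bar>R n w x\<bar> \<le> \<epsilon>" by blast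
      have n: "0 < n" using elim by simp
      have "\<bar>?Z n w\<bar> \<le> ereal \<epsilon>" if w: "w \<in> space M - A" for w
      proof -
        have "(SUP x. \<bar>ereal (R n w x)\<bar>) \<le> ereal (\<epsilon> / sqrt n)"
        proof (rule SUP_least)
          fix x
          have "\<bar>R n w x\<bar> \<le> \<epsilon> / sqrt n" using A(3)[OF w, of x] n by (simp add: field_simps)
          then show "\<bar>ereal (R n w x)\<bar> \<le> ereal (\<epsilon> / sqrt n)" by simp
        qed
        then have "?Z n w \<le> ereal (sqrt n) * ereal (\<epsilon> / sqrt n)" by (intro ereal_mult_left_mono) auto
        also have "\<dots> = ereal \<epsilon>" using n by simp
        finally have "?Z n w \<le> ereal \<epsilon>" .
        moreover have "0 \<le> ?Z n w" by (intro ereal_0_le_mult) (auto intro: SUP_upper2)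
        ultimately show ?thesis by simp
      qed
      then have "{w \<in> space M. \<bar>?Z n w\<bar> > ereal \<epsilon>} \<subseteq> A" by (auto simp: not_less[symmetric])
      then have "\<P>(w in M. \<bar>?Z n w\<bar> > ereal \<epsilon>) \<le> measure M A" by (rule finite_measure_mono) (rule A)
      then show ?case using A \<open>0 < \<rho>\<close> by simp
    qed
  qed (simp add: less_le_trans[OF _ measure_nonneg])
qed

end

section \<open>The sample of observed pairs\<close>

text \<open>The quadrants form an intersection-stable generator of the Borel sets of the plane.\<close>

lemma plane_measure_eqI:
  fixes P Q :: "(real \<times> real) measure"
  assumes P: "prob_space P" "sets P = sets (borel \<Otimes>\<^sub>M borel)"
    and Q: "prob_space Q" "sets Q = sets (borel \<Otimes>\<^sub>M borel)"
    and eq: "\<And>x y. measure P ({..x} \<times> {..y}) = measure Q ({..x} \<times> {..y})"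
  shows "P = Q"
proof -
  interpret P: prob_space P by fact
  interpret Q: prob_space Q by fact
  define E where "E = range (\<lambda>a :: real \<times> real. {..a})"
  have box: "{..a} = {..fst a} \<times> {..snd a}" for a :: "real \<times> real"
    by (auto simp: less_eq_prod_def)
  have gen: "sigma_sets UNIV E = sets (borel :: (real \<times> real) measure)"
    unfolding E_def borel_eq_atMost by (simp add: sets_measure_of)
  show ?thesis
  proof (rule measure_eqI_generator_eq[where \<Omega> = UNIV and E = E and A = "\<lambda>i. {..(real i, real i)}"])
    show "Int_stable E"
      unfolding Int_stable_def E_def
    proof (intro ballI)
      fix A B :: "(real \<times> real) set" assume "A \<in> range (\<lambda>a. {..a})" "B \<in> range (\<lambda>a. {..a})"
      then obtain a c where "A = {..a}" "B = {..c}" by auto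
      then have "A \<inter> B = {..(min (fst a) (fst c), min (snd a) (snd c))}" by (auto simp: box)
      then show "A \<inter> B \<in> range (\<lambda>a. {..a})" by blast
    qed
    show "sets P = sigma_sets UNIV E" "sets Q = sigma_sets UNIV E"
      unfolding gen P(2) Q(2) borel_prod by (rule refl)+
    show "emeasure P A = emeasure Q A" if "A \<in> E" for A
      using that eq unfolding E_def by (auto simp: box P.emeasure_eq_measure Q.emeasure_eq_measure)
    show "(\<Union>i. {..(real i, real i)}) = UNIV"
    proof (intro set_eqI iffI UNIV_I)
      fix p :: "real \<times> real"
      obtain i :: nat where "max (fst p) (snd p) \<le> real i" using real_arch_simple by blast
      then show "p \<in> (\<Union>i. {..(real i, real i)})" by (auto simp: less_eq_prod_def intro!: exI[of _ i])
    qed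
    show "emeasure P {..(real i, real i)} \<noteq> \<infinity>" for i by simp
  qed (auto simp: E_def)
qed

theorem corollary1p2:
  fixes N :: "'b measure" and X Y :: "'b \<Rightarrow> real"
    and M :: "'a measure" and Xs Ys :: "nat \<Rightarrow> 'a \<Rightarrow> real"
    and F G Fs C :: "real \<Rightarrow> real"
  assumes "prob_space N"
    and "prob_space.indep_var N borel X borel Y"
    and F: "F = cdf (distr N borel X)"
    and G: "G = cdf (distr N borel Y)"
    and "\<P>(v in N. Y v \<le> X v) > 0"
    and Fs: "Fs = trunc_Fstar N X Y"
    and C: "C = trunc_C N X Y"
    and "prob_space M"
    and "prob_space.indep_vars M (\<lambda>_. borel \<Otimes>\<^sub>M borel) (\<lambda>i w. (Xs i w, Ys i w)) UNIV"
    and "\<And>i x y. \<P>(w in M. Xs i w \<le> x \<and> Ys i w \<le> y) = trunc_Hstar N X Y x y"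
    and "(\<integral>\<^sup>+ z. 1 / ennreal (G z) \<partial>interval_measure F) < \<infinity>"
    and "lower_end G \<le> lower_end F"
    and "\<And>a. lower_end F = ereal a \<Longrightarrow> jump F a = 0"
    and "continuous_on UNIV F"
  shows "tends_to_0_in_prob M
    (\<lambda>n w. ereal (sqrt (real n)) *
       (SUP x. \<bar>ereal (remainder F Fs C n (\<lambda>i. Xs i w) (\<lambda>i. Ys i w) x)\<bar>))"
proof -
  interpret N: prob_space N by fact
  interpret M: prob_space M by fact
  note indep_XY = assms(2) and pos = assms(5) and indep_Z = assms(9) and joint = assms(10)
  have [measurable]: "X \<in> borel_measurable N" "Y \<in> borel_measurable N"
    using N.indep_var_rv1[OF indep_XY] N.indep_var_rv2[OF indep_XY] by auto
  define \<mu> \<nu> where "\<mu> = distr N borel X" and "\<nu> = distr N borel Y"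
  interpret X: real_distribution \<mu> unfolding \<mu>_def by (rule N.real_distribution_distr) simp
  interpret Y: real_distribution \<nu> unfolding \<nu>_def by (rule N.real_distribution_distr) simp
  define \<alpha> where "\<alpha> = \<P>(v in N. Y v \<le> X v)"
  have XY: "distr N (borel \<Otimes>\<^sub>M borel) (\<lambda>v. (X v, Y v)) = \<mu> \<Otimes>\<^sub>M \<nu>"
    using indep_XY unfolding N.indep_var_distribution_eq \<mu>_def \<nu>_def by simp
  have measure_XY: "measure (\<mu> \<Otimes>\<^sub>M \<nu>) A = \<P>(v in N. (X v, Y v) \<in> A)"
    if "A \<in> sets (borel \<Otimes>\<^sub>M borel)" for A
    unfolding XY[symmetric] using that by (subst measure_distr) (auto intro!: arg_cong[of _ _ "measure N"])
  have order: "{p. snd p \<le> fst p} \<in> sets (borel \<Otimes>\<^sub>M borel :: (real \<times> real) measure)"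
  proof -
    have "{p \<in> space (borel \<Otimes>\<^sub>M borel :: (real \<times> real) measure). snd p \<le> fst p} \<in> sets (borel \<Otimes>\<^sub>M borel)"
      by measurable
    then show ?thesis by (simp add: space_pair_measure)
  qed
  interpret T: truncation_model \<mu> \<nu> \<alpha>
  proof
    show "continuous_on UNIV (cdf \<mu>)" using assms(14) unfolding F \<mu>_def .
    show "\<alpha> = measure (\<mu> \<Otimes>\<^sub>M \<nu>) {p. snd p \<le> fst p}" unfolding \<alpha>_def by (simp add: measure_XY[OF order])
    show "0 < \<alpha>" unfolding \<alpha>_def by (rule pos)
    have "interval_measure F = \<mu>" unfolding F \<mu>_def[symmetric] by (rule interval_measure_cdf) unfold_locales
    then show "(\<integral>\<^sup>+z. 1 / ennreal (cdf \<nu> z) \<partial>\<mu>) < \<infinity>" using assms(11) unfolding G \<nu>_def by simp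
  qed
  have measure_observed: "measure T.observed A = \<P>(v in N. (X v, Y v) \<in> A \<bar> Y v \<le> X v)"
    if A: "A \<in> sets (borel \<Otimes>\<^sub>M borel)" for A
  proof -
    have "measure T.observed A = measure (\<mu> \<Otimes>\<^sub>M \<nu>) ({p. snd p \<le> fst p} \<inter> A) / measure (\<mu> \<Otimes>\<^sub>M \<nu>) {p. snd p \<le> fst p}"
      unfolding T.observed_def using A by (intro measure_uniform_measure) (auto simp: T.emeasure_order_set T.\<alpha>_pos ennreal_eq_0_iff not_le)
    also have "\<dots> = \<P>(v in N. (X v, Y v) \<in> A \<bar> Y v \<le> X v)"
      using A order by (subst (1 2) measure_XY) (auto simp: cond_prob_def conj_commute)
    finally show ?thesis .
  qed
  have half_planes: "{p. fst p \<le> x} \<in> sets (borel \<Otimes>\<^sub>M borel :: (real \<times> real) measure)"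
    "{p. snd p \<le> z \<and> z \<le> fst p} \<in> sets (borel \<Otimes>\<^sub>M borel :: (real \<times> real) measure)" for x z :: real
  proof -
    have "{p \<in> space (borel \<Otimes>\<^sub>M borel :: (real \<times> real) measure). fst p \<le> x} \<in> sets (borel \<Otimes>\<^sub>M borel)"
      "{p \<in> space (borel \<Otimes>\<^sub>M borel :: (real \<times> real) measure). snd p \<le> z \<and> z \<le> fst p} \<in> sets (borel \<Otimes>\<^sub>M borel)"
      by measurable
    then show "{p. fst p \<le> x} \<in> sets (borel \<Otimes>\<^sub>M borel :: (real \<times> real) measure)"
      "{p. snd p \<le> z \<and> z \<le> fst p} \<in> sets (borel \<Otimes>\<^sub>M borel :: (real \<times> real) measure)"
      by (simp_all add: space_pair_measure)
  qed
  define Z where "Z i w = (Xs i w, Ys i w)" for i w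
  have Z[measurable]: "Z i \<in> measurable M (borel \<Otimes>\<^sub>M borel)" for i
    using indep_Z unfolding M.indep_vars_def Z_def by simp
  have law: "distr M T.observed (Z i) = T.observed" for i
  proof (rule plane_measure_eqI)
    have Z': "Z i \<in> measurable M T.observed" by simp
    show "prob_space (distr M T.observed (Z i))" by (rule M.prob_space_distr[OF Z'])
    show "prob_space T.observed" by (rule T.prob_space_observed)
    fix x y :: real
    have "measure (distr M T.observed (Z i)) ({..x} \<times> {..y}) = \<P>(w in M. Xs i w \<le> x \<and> Ys i w \<le> y)"
      by (subst measure_distr[OF Z']) (auto simp: Z_def intro!: arg_cong[of _ _ "measure M"])
    also have "\<dots> = \<P>(v in N. X v \<le> x \<and> Y v \<le> y \<bar> Y v \<le> X v)" unfolding joint trunc_Hstar_def ..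
    also have "\<dots> = measure T.observed ({..x} \<times> {..y})" by (subst measure_observed) auto
    finally show "measure (distr M T.observed (Z i)) ({..x} \<times> {..y}) = measure T.observed ({..x} \<times> {..y})" .
  qed simp_all
  interpret S: truncated_sample \<mu> \<nu> \<alpha> M Z
  proof
    have "M.indep_vars (\<lambda>_. borel \<Otimes>\<^sub>M borel) Z UNIV" using indep_Z unfolding Z_def .
    then show "M.indep_vars (\<lambda>_. T.observed) Z UNIV"
      unfolding M.indep_vars_def2 by (simp cong: measurable_cong_sets)
    show "distr M T.observed (Z i) = T.observed" for i by (rule law)
  qed
  have "C = T.C"
  proof
    fix z
    have "C z = measure T.observed {p. snd p \<le> z \<and> z \<le> fst p}"
      unfolding C trunc_C_def measure_observed[OF half_planes(2)] by simp
    also have "\<dots> = (\<integral>q. risk z q \<partial>T.observed)"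
    proof -
      have "risk z q = indicator {p. snd p \<le> z \<and> z \<le> fst p} q" for q by (simp add: risk_def indicator_def)
      then show ?thesis using half_planes(2) by simp
    qed
    finally show "C z = T.C z" by (simp add: T.integral_risk_observed)
  qed
  moreover have "Fs = cdf (distr T.observed borel fst)"
  proof
    fix x
    have "Fs x = measure T.observed {p. fst p \<le> x}"
      unfolding Fs trunc_Fstar_def measure_observed[OF half_planes(1)] by simp
    then show "Fs x = cdf (distr T.observed borel fst) x"
      unfolding cdf_def by (subst measure_distr) (auto intro!: arg_cong[of _ _ "measure T.observed"])
  qed
  moreover have "F = cdf \<mu>" unfolding F \<mu>_def ..
  ultimately show ?thesis
    using S.sup_remainder_tends_to_0 by (simp add: Z_def)
qed

end
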